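(* Consider the following nine candidate surface branched covers, all with $\widetilde\Sigma=\Sigma=S$: \begin{enumerate} \item $d=6$: $(5,1),(4,1,1),(2^3)$; \item $d=8$: $(5,1,1,1),(4,4),(2^4)$; \item $d=8$: $(7,1),(3,3,1,1),(2^4)$; \item $d=9$: $(7,1,1),(3,3,3),(2^4,1)$; \item $d=10$: $(8,1,1),(3,3,3,1),(2^5)$; \item $d=12$: $(8,2,1,1),(3^4),(2^6)$; \item $d=12$: $(9,1,1,1),(3^4),(2^6)$; \item $d=16$: $(7,7,1,1),(3^5,1),(2^8)$; \item $d=24$: $(7,7,7,1,1,1),(3^8),(2^{12})$. \end{enumerate} The second and the eighth are exceptional, and all the other ones are realizable.
   Context: $S$ is the 2-sphere. A partition of $d$ is a finite unordered list (multiset) of positive integers with sum $d$; $\ell(\Pi)$ is the number of entries of $\Pi$; $(a^m,b,\ldots)$ means that $a$ is repeated $m$ times. For closed connected orientable surfaces $\widetilde\Sigma,\Sigma$, a branched cover $f:\widetilde\Sigma\to\Sigma$ is a map locally modelled on $(\mathbb{C},0)\to(\mathbb{C},0)$, $z\mapsto z^k$ with $k\geq 1$; $k$ is the local degree at the source point, and a point of $\Sigma$ having a preimage with local degree $>1$ is a branching point. The degree $d$ of $f$ is the degree of the genuine cover obtained by removing the branching points and their preimages; the local degrees at the preimages of a branching point form a partition of $d$. A candidate surface branched cover consists of closed connected orientable surfaces $\widetilde\Sigma,\Sigma$, integers $d\geq 2$ and $n\geq 1$, and an unordered collection (repetitions allowed) $\Pi_1,\ldots,\Pi_n$ of partitions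 of $d$ satisfying the Riemann-Hurwitz condition $\chi(\widetilde\Sigma)-\sum_i\ell(\Pi_i)=d\,(\chi(\Sigma)-n)$. It is realizable if there is a degree-$d$ branched cover $f:\widetilde\Sigma\to\Sigma$ with $n$ branching points whose associated partitions of local degrees are $\Pi_1,\ldots,\Pi_n$, and exceptional otherwise. *)

theory Defs
  imports "HOL-Analysis.Analysis" "HOL-Library.Multiset"
begin

text \<open>Branched covers are defined for arbitrary topologies; they are used below for
  the 2-sphere.\<close>

definition local_model ::
  "'a topology \<Rightarrow> 'b topology \<Rightarrow> ('a \<Rightarrow> 'b) \<Rightarrow> 'a \<Rightarrow> nat \<Rightarrow> bool" where
  "local_model X Y f x k \<longleftrightarrow>
     k \<ge> 1 \<and>
     (\<exists>U V (A :: complex set) (B :: complex set) \<phi> \<psi>.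
        openin X U \<and> openin Y V \<and> x \<in> U \<and> f ` U \<subseteq> V \<and>
        open A \<and> open B \<and>
        homeomorphic_map (subtopology X U) (top_of_set A) \<phi> \<and>
        homeomorphic_map (subtopology Y V) (top_of_set B) \<psi> \<and>
        \<phi> x = 0 \<and> \<psi> (f x) = 0 \<and>
        (\<forall>u\<in>U. \<psi> (f u) = \<phi> u ^ k))"

definition branched_cover :: "'a topology \<Rightarrow> 'b topology \<Rightarrow> ('a \<Rightarrow> 'b) \<Rightarrow> bool" where
  "branched_cover X Y f \<longleftrightarrow>
     continuous_map X Y f \<and> (\<forall>x\<in>topspace X. \<exists>k. local_model X Y f x k)"

text \<open>The exponent of a local model at a given point is unique: it is the number of
  preimages near the point of any nearby generic value.\<close>

definition local_degree :: "'a topology \<Rightarrow> 'b topology \<Rightarrow> ('a \<Rightarrow> 'b) \<Rightarrow> 'a \<Rightarrow> nat" where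
  "local_degree X Y f x = (THE k. local_model X Y f x k)"

definition fibre :: "'a topology \<Rightarrow> ('a \<Rightarrow> 'b) \<Rightarrow> 'b \<Rightarrow> 'a set" where
  "fibre X f y = {x \<in> topspace X. f x = y}"

definition branching_points :: "'a topology \<Rightarrow> 'b topology \<Rightarrow> ('a \<Rightarrow> 'b) \<Rightarrow> 'b set" where
  "branching_points X Y f =
     {y \<in> topspace Y. \<exists>x\<in>fibre X f y. local_degree X Y f x > 1}"

text \<open>The degree is the number of sheets of the cover obtained by removing the branching
  points and their preimages.\<close>

definition has_degree ::
  "'a topology \<Rightarrow> 'b topology \<Rightarrow> ('a \<Rightarrow> 'b) \<Rightarrow> nat \<Rightarrow> bool" where
  "has_degree X Y f d \<longleftrightarrow>
     (\<forall>y \<in> topspace Y - branching_points X Y f. finite (fibre X f y) \<and> card (fibre X f y) = d)"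

definition local_degrees_over ::
  "'a topology \<Rightarrow> 'b topology \<Rightarrow> ('a \<Rightarrow> 'b) \<Rightarrow> 'b \<Rightarrow> nat multiset" where
  "local_degrees_over X Y f y = image_mset (local_degree X Y f) (mset_set (fibre X f y))"

text \<open>Finiteness is required explicitly because \<^term>\<open>mset_set\<close> sends infinite sets to
  the empty multiset.\<close>

definition realizes ::
  "'a topology \<Rightarrow> 'b topology \<Rightarrow> nat \<Rightarrow> nat multiset multiset \<Rightarrow> ('a \<Rightarrow> 'b) \<Rightarrow> bool" where
  "realizes X Y d Ps f \<longleftrightarrow>
     branched_cover X Y f \<and> has_degree X Y f d \<and>
     finite (branching_points X Y f) \<and>
     (\<forall>y \<in> branching_points X Y f. finite (fibre X f y)) \<and>
     image_mset (local_degrees_over X Y f) (mset_set (branching_points X Y f)) = Ps"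

definition is_partition :: "nat \<Rightarrow> nat multiset \<Rightarrow> bool" where
  "is_partition d \<pi> \<longleftrightarrow> (\<forall>k \<in># \<pi>. k \<ge> 1) \<and> sum_mset \<pi> = d"

text \<open>The arguments \<open>chi'\<close> and \<open>chi\<close> are the Euler characteristics of the covering and the
  covered surface; the number \<open>n\<close> of partitions is \<^term>\<open>size Ps\<close>.\<close>

definition riemann_hurwitz :: "int \<Rightarrow> int \<Rightarrow> nat \<Rightarrow> nat multiset multiset \<Rightarrow> bool" where
  "riemann_hurwitz chi' chi d Ps \<longleftrightarrow>
     chi' - (\<Sum>\<pi>\<in>#Ps. int (size \<pi>)) = int d * (chi - int (size Ps))"

definition S2 :: "(real ^ 3) topology" where
  "S2 = top_of_set (sphere 0 1)"

text \<open>Both surfaces are the sphere from here on, and its Euler characteristic is 2.\<close>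

definition sphere_candidate :: "nat \<Rightarrow> nat multiset multiset \<Rightarrow> bool" where
  "sphere_candidate d Ps \<longleftrightarrow>
     d \<ge> 2 \<and> size Ps \<ge> 1 \<and> (\<forall>\<pi> \<in># Ps. is_partition d \<pi>) \<and> riemann_hurwitz 2 2 d Ps"

definition sphere_realizable :: "nat \<Rightarrow> nat multiset multiset \<Rightarrow> bool" where
  "sphere_realizable d Ps \<longleftrightarrow> sphere_candidate d Ps \<and> (\<exists>f. realizes S2 S2 d Ps f)"

definition sphere_exceptional :: "nat \<Rightarrow> nat multiset multiset \<Rightarrow> bool" where
  "sphere_exceptional d Ps \<longleftrightarrow> sphere_candidate d Ps \<and> \<not> (\<exists>f. realizes S2 S2 d Ps f)"

end

theory Submission
  imports Defs "HOL-Complex_Analysis.Complex_Analysis"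
    "HOL-Computational_Algebra.Computational_Algebra"
begin

text \<open>Each realizable candidate is realized by an explicit rational function \<open>p/q\<close> with branching
  values \<open>0\<close>, \<open>c\<close> and \<open>\<infinity>\<close>, where \<open>p - c q\<close> factors as prescribed. The total number of roots of
  \<open>p\<close>, \<open>q\<close> and \<open>p - c q\<close> allowed by the factorizations is the Mason--Stothers minimum
  \<open>degree p + 1\<close>, and this alone forces all the factors to be squarefree and every other value
  to be unbranched.

  For the exceptional ones, place the three branching points at \<open>0\<close>, \<open>1\<close>, \<open>\<infinity>\<close>. The plane minus two
  of the three segments into which \<open>0\<close> and \<open>1\<close> cut the real line is simply connected, so the
  fibre over \<open>\<i>\<close> is matched with the fibre over \<open>-\<i>\<close> in three ways, one through each segment.
  Comparing the matchings yields permutations \<open>\<sigma>\<close>, \<open>\<tau>\<close>, \<open>\<tau> \<circ> \<sigma>\<close>, generating a transitive group,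
  whose cycle types are the three partitions; such permutations do not exist.\<close>

section \<open>Local models\<close>

text \<open>The definitions are purely topological, so a realizing map carries no complex structure.
  Towards realizability, a rational function is moved to the sphere by a homeomorphism of the
  punctured sphere with the plane, and the local models come from k-th roots of holomorphic
  functions. Towards exceptionality, only lifting over simply connected plane domains is used,
  without fundamental groups: a disc around a preimage of local degree k, once punctured, is
  connected and meets each nearby fibre in k points, and this makes it one cycle of length k. Cycles
  are therefore described by invariant subsets, the form in which connectedness delivers them.
  Infinity always receives the partition with the largest part: the point at infinity contributes
  that part without any equation, and \<open>q\<close> keeps a low degree. The Mason-Stothers count
  turns one polynomial identity, checked by expansion, and a count of degrees, which is the
  Riemann-Hurwitz condition, into the full ramification data, so the roots of the factors are never
  computed.\<close>

lemma homeomorphic_map_restrict: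
  assumes h: "homeomorphic_map (subtopology X U) (top_of_set A) f"
    and U: "U \<subseteq> topspace X" and A': "A' \<subseteq> A"
  shows "homeomorphic_map (subtopology X {u \<in> U. f u \<in> A'}) (top_of_set A') f"
proof -
  have im: "f ` U = A"
    using homeomorphic_imp_surjective_map[OF h] U by (simp add: Int_absorb1)
  have "homeomorphic_map (subtopology (subtopology X U) {u \<in> U. f u \<in> A'})
          (subtopology (top_of_set A) A') f"
    by (rule homeomorphic_map_subtopologies[OF h]) (use im U A' in auto)
  then show ?thesis
    using A' by (simp add: subtopology_subtopology Int_absorb1 Int_absorb2 Collect_conj_eq)
qed

lemma openin_homeomorphic_preimage:
  assumes h: "homeomorphic_map (subtopology X U) (top_of_set A) f"
    and U: "openin X U" and A': "openin (top_of_set A) A'"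
  shows "openin X {u \<in> U. f u \<in> A'}"
proof -
  have "openin (subtopology X U) {u \<in> topspace (subtopology X U). f u \<in> A'}"
    using homeomorphic_imp_continuous_map[OF h] A' by (rule openin_continuous_map_preimage)
  moreover have "{u \<in> topspace (subtopology X U). f u \<in> A'} = {u \<in> U. f u \<in> A'}"
    using openin_subset[OF U] by auto
  ultimately show ?thesis
    using U openin_trans_full by metis
qed

text \<open>With the matched radii \<open>r\<close> and \<open>r ^ k\<close> the power map sends the
  source disc onto the target disc, so no k-th root of a value is lost at the boundary. The
  prescribed neighbourhoods \<open>W\<close> and \<open>W'\<close> allow models to be
  nested.\<close>

lemma local_model_discs:
  assumes lm: "local_model X Y f x k" and W: "openin X W" "x \<in> W"
    and W': "openin Y W'" "f x \<in> W'"
  obtains U V \<phi> \<psi> r where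
    "r > (0::real)" "k \<ge> 1" "openin X U" "U \<subseteq> W" "x \<in> U" "openin Y V" "V \<subseteq> W'"
    "homeomorphic_map (subtopology X U) (top_of_set (ball (0::complex) r)) \<phi>"
    "homeomorphic_map (subtopology Y V) (top_of_set (ball (0::complex) (r ^ k))) \<psi>"
    "\<phi> x = 0" "\<psi> (f x) = 0" "\<And>u. u \<in> U \<Longrightarrow> f u \<in> V \<and> \<psi> (f u) = \<phi> u ^ k"
proof -
  obtain U V and A B :: "complex set" and \<phi> \<psi> where k: "k \<ge> 1" and U: "openin X U" "x \<in> U" and V: "openin Y V"
    and fUV: "f ` U \<subseteq> V" and AB: "open A" "open B"
    and h\<phi>: "homeomorphic_map (subtopology X U) (top_of_set A) \<phi>"
    and h\<psi>: "homeomorphic_map (subtopology Y V) (top_of_set B) \<psi>"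
    and 0: "\<phi> x = 0" "\<psi> (f x) = 0" and eq: "\<forall>u\<in>U. \<psi> (f u) = \<phi> u ^ k"
    using lm unfolding local_model_def by blast
  have sub: "U \<subseteq> topspace X" "V \<subseteq> topspace Y"
    using U V openin_subset by auto
  have bij: "inj_on \<phi> U" "\<phi> ` U = A" "inj_on \<psi> V" "\<psi> ` V = B"
    using homeomorphic_imp_surjective_map[OF h\<phi>] homeomorphic_imp_surjective_map[OF h\<psi>]
      homeomorphic_imp_injective_map[OF h\<phi>] homeomorphic_imp_injective_map[OF h\<psi>] sub
    by (simp_all add: Int_absorb1)
  have "openin (top_of_set A) (\<phi> ` (U \<inter> W))"
    using homeomorphic_imp_open_map[OF h\<phi>] W(1) U(1)
    by (metis inf_commute open_map_def openin_subtopology_Int)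
  then have oA: "open (\<phi> ` (U \<inter> W))"
    using AB openin_open_trans by blast
  have "openin (top_of_set B) (\<psi> ` (V \<inter> W'))"
    using homeomorphic_imp_open_map[OF h\<psi>] W'(1) V(1)
    by (metis inf_commute open_map_def openin_subtopology_Int)
  then have oB: "open (\<psi> ` (V \<inter> W'))"
    using AB openin_open_trans by blast
  have "0 \<in> \<phi> ` (U \<inter> W)" "0 \<in> \<psi> ` (V \<inter> W')"
    using 0 U W W' fUV by (metis IntI imageI image_subset_iff)+
  then obtain a b where a: "a > 0" "ball 0 a \<subseteq> \<phi> ` (U \<inter> W)"
    and b: "b > 0" "ball 0 b \<subseteq> \<psi> ` (V \<inter> W')"
    using oA oB open_contains_ball by meson
  \<comment> \<open>The cap 1 gives \<open>r ^ k \<le> r\<close>, so the target disc stays within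
    radius \<open>b\<close>.\<close>
  define r where "r = Min {a, b, 1}"
  have r: "r > 0" "r \<le> a" "r \<le> b" "r \<le> 1"
    using a b by (auto simp: r_def)
  have rk: "r ^ k \<le> b"
    using r k by (metis less_eq_real_def order_trans power_decreasing power_one_right)
  have "ball 0 r \<subseteq> ball (0::complex) a" "ball 0 (r ^ k) \<subseteq> ball (0::complex) b"
    using r rk by (simp_all add: subset_ball)
  then have ballA: "ball 0 r \<subseteq> A" and ballB: "ball 0 (r ^ k) \<subseteq> B"
    using a(2) b(2) bij(2,4) by blast+
  let ?U = "{u \<in> U. \<phi> u \<in> ball 0 r}" and ?V = "{v \<in> V. \<psi> v \<in> ball 0 (r ^ k)}"
  show thesis
  proof (rule that[of r ?U ?V \<phi> \<psi>])
    show "?U \<subseteq> W"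
    proof
      fix u assume u: "u \<in> ?U"
      then have "\<phi> u \<in> ball 0 a" using r by simp
      then obtain w where "w \<in> U \<inter> W" "\<phi> w = \<phi> u"
        using a by (metis imageE subset_iff)
      then show "u \<in> W" using bij u by (metis (no_types, lifting) IntE inj_onD mem_Collect_eq)
    qed
    show "?V \<subseteq> W'"
    proof
      fix u assume u: "u \<in> ?V"
      then have "\<psi> u \<in> ball 0 b" using rk by simp
      then obtain w where "w \<in> V \<inter> W'" "\<psi> w = \<psi> u"
        using b by (metis imageE subset_iff)
      then show "u \<in> W'" using bij u by (metis (no_types, lifting) IntE inj_onD mem_Collect_eq)
    qed
    show "openin X ?U" "openin Y ?V"
      by (rule openin_homeomorphic_preimage[OF h\<phi>] openin_homeomorphic_preimage[OF h\<psi>];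
          use U V AB ballA ballB in \<open>auto simp: open_subset\<close>)+
    show "homeomorphic_map (subtopology X ?U) (top_of_set (ball 0 r)) \<phi>"
      "homeomorphic_map (subtopology Y ?V) (top_of_set (ball 0 (r ^ k))) \<psi>"
      by (rule homeomorphic_map_restrict[OF h\<phi>] homeomorphic_map_restrict[OF h\<psi>];
          use sub ballA ballB in auto)+
    show "f u \<in> ?V \<and> \<psi> (f u) = \<phi> u ^ k" if "u \<in> ?U" for u
      using that fUV eq k by (auto simp: norm_power intro!: power_strict_mono)
  qed (use 0 U k r in auto)
qed

text \<open>In the charts the fibre over \<open>y\<close> consists of the k-th roots of the nonzero
  number \<open>\<psi> y\<close>; the target radius \<open>r ^ k\<close> keeps all k of them in the
  source disc.\<close>

lemma local_model_fibre_card: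
  assumes r: "r > (0::real)" and k: "k \<ge> 1" and U: "openin X U" "x \<in> U" and V: "openin Y V"
    and h\<phi>: "homeomorphic_map (subtopology X U) (top_of_set (ball (0::complex) r)) \<phi>"
    and h\<psi>: "homeomorphic_map (subtopology Y V) (top_of_set (ball (0::complex) (r ^ k))) \<psi>"
    and 0: "\<phi> x = 0" "\<psi> (f x) = 0"
    and eq: "\<And>u. u \<in> U \<Longrightarrow> f u \<in> V \<and> \<psi> (f u) = \<phi> u ^ k"
    and y: "y \<in> V" "y \<noteq> f x"
  shows "finite {u \<in> U. f u = y} \<and> card {u \<in> U. f u = y} = k"
proof -
  have sub: "U \<subseteq> topspace X" "V \<subseteq> topspace Y"
    using U V openin_subset by auto
  have bij: "inj_on \<phi> U" "\<phi> ` U = ball 0 r" "inj_on \<psi> V" "\<psi> ` V = ball 0 (r ^ k)"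
    using homeomorphic_imp_surjective_map[OF h\<phi>] homeomorphic_imp_surjective_map[OF h\<psi>]
      homeomorphic_imp_injective_map[OF h\<phi>] homeomorphic_imp_injective_map[OF h\<psi>] sub
    by (simp_all add: Int_absorb1)
  have "\<psi> y \<noteq> \<psi> (f x)"
    using bij(3) y eq[OF U(2)] by (meson inj_onD)
  then have ny: "\<psi> y \<noteq> 0" "norm (\<psi> y) < r ^ k"
    using bij(4) y(1) 0 by auto
  have "\<phi> ` {u \<in> U. f u = y} = {z. z ^ k = \<psi> y}"
  proof (intro equalityI subsetI)
    fix z assume z: "z \<in> {z. z ^ k = \<psi> y}"
    then have "norm z ^ k < r ^ k"
      using ny(2) by (simp flip: norm_power)
    then have "z \<in> ball 0 r"
      using r power_less_imp_less_base[of "norm z" k r] by simp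
    then obtain u where u: "u \<in> U" "\<phi> u = z" using bij by (metis imageE)
    then have "f u = y"
      using eq[OF u(1)] z inj_onD[OF bij(3), of "f u" y] y(1) by simp
    then show "z \<in> \<phi> ` {u \<in> U. f u = y}" using u by auto
  qed (use eq in auto)
  moreover have "inj_on \<phi> {u \<in> U. f u = y}"
    using bij by (auto simp: inj_on_def)
  ultimately show ?thesis
    using card_nth_roots[OF ny(1), of k] finite_nth_roots[of k "\<psi> y"] k
      card_image[of \<phi> "{u \<in> U. f u = y}"] finite_imageD[of \<phi> "{u \<in> U. f u = y}"] by simp
qed

text \<open>Of two nested models, the inner one gives a value near \<open>f x\<close> its
  \<open>k\<close> preimages, all of them among the \<open>l\<close> preimages in the outer disc. By
  symmetry the exponents agree.\<close>

lemma local_model_unique: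
  assumes "local_model X Y f x k" "local_model X Y f x l" and x: "x \<in> topspace X"
    and fx: "f x \<in> topspace Y"
  shows "k = l"
proof -
  have le: "k \<le> l" if 1: "local_model X Y f x l" and 2: "local_model X Y f x k" for k l
  proof -
    obtain U V \<phi> \<psi> r where
      1: "r > (0::real)" "l \<ge> 1" "openin X U" "U \<subseteq> topspace X" "x \<in> U" "openin Y V" "V \<subseteq> topspace Y"
      "homeomorphic_map (subtopology X U) (top_of_set (ball (0::complex) r)) \<phi>"
      "homeomorphic_map (subtopology Y V) (top_of_set (ball (0::complex) (r ^ l))) \<psi>"
      "\<phi> x = 0" "\<psi> (f x) = 0" "\<And>u. u \<in> U \<Longrightarrow> f u \<in> V \<and> \<psi> (f u) = \<phi> u ^ l"
      by (rule local_model_discs[OF 1 openin_topspace x openin_topspace fx]) (rule that)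
    have "f x \<in> V" using 1 by auto
    then obtain U' V' \<phi>' \<psi>' r' where
      2: "r' > (0::real)" "k \<ge> 1" "openin X U'" "U' \<subseteq> U" "x \<in> U'" "openin Y V'" "V' \<subseteq> V"
      "homeomorphic_map (subtopology X U') (top_of_set (ball (0::complex) r')) \<phi>'"
      "homeomorphic_map (subtopology Y V') (top_of_set (ball (0::complex) (r' ^ k))) \<psi>'"
      "\<phi>' x = 0" "\<psi>' (f x) = 0" "\<And>u. u \<in> U' \<Longrightarrow> f u \<in> V' \<and> \<psi>' (f u) = \<phi>' u ^ k"
      by (rule local_model_discs[OF 2 1(3,5) 1(6)]) (rule that)
    have "\<psi>' ` V' = ball 0 (r' ^ k)"
      using homeomorphic_imp_surjective_map[OF 2(9)] openin_subset[OF 2(6)] by (simp add: Int_absorb1)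
    moreover have "complex_of_real (r' ^ k / 2) \<in> ball 0 (r' ^ k)" "complex_of_real (r' ^ k / 2) \<noteq> 0"
      using 2(1) by (auto simp: norm_power norm_divide)
    ultimately obtain y where y: "y \<in> V'" "y \<noteq> f x"
      using 2(11) by (metis imageE)
    have "card {u \<in> U'. f u = y} = k"
      using local_model_fibre_card[OF 2(1,2,3,5,6,8,9,10,11,12) y] by simp
    moreover have "finite {u \<in> U. f u = y}" "card {u \<in> U. f u = y} = l"
      using local_model_fibre_card[OF 1(1,2,3,5,6,8,9,10,11,12)] y 2(7) by blast+
    ultimately show "k \<le> l"
      using card_mono[of "{u \<in> U. f u = y}" "{u \<in> U'. f u = y}"] 2(4) by blast
  qed
  show ?thesis using le assms by (meson le_antisym)
qed

lemma local_degree_eq: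
  assumes "local_model X Y f x k" "x \<in> topspace X" "f x \<in> topspace Y"
  shows "local_degree X Y f x = k"
  unfolding local_degree_def using assms local_model_unique by (metis the_equality)

section \<open>Roots and ramification of a pencil of polynomials\<close>

definition root_orders :: "complex poly \<Rightarrow> nat multiset" where
  "root_orders p = image_mset (\<lambda>z. order z p) (mset_set {z. poly p z = 0})"

lemma sum_order_eq_degree:
  fixes p :: "complex poly"
  assumes "p \<noteq> 0"
  shows "(\<Sum>z | poly p z = 0. order z p) = degree p"
  using size_proots_complex[of p] assms by (simp add: size_multiset_overloaded_eq)

lemma sum_order_le_degree:
  fixes p :: "complex poly"
  assumes "p \<noteq> 0" "finite A"
  shows "(\<Sum>z\<in>A. order z p) \<le> degree p"
proof -
  have "(\<Sum>z\<in>A. order z p) = (\<Sum>z\<in>{z \<in> A. poly p z = 0}. order z p)"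
    using assms by (intro sum.mono_neutral_right) (auto simp: order_root)
  also have "\<dots> \<le> (\<Sum>z | poly p z = 0. order z p)"
    using assms by (intro sum_mono2) (auto simp: poly_roots_finite)
  finally show ?thesis using sum_order_eq_degree[OF assms(1)] by simp
qed

lemma simple_roots_card:
  fixes p :: "complex poly"
  assumes "p \<noteq> 0" "\<And>z. poly p z = 0 \<Longrightarrow> order z p = 1"
  shows "card {z. poly p z = 0} = degree p"
  using sum_order_eq_degree[OF assms(1)] assms(2) by simp

lemma order_eq_1_if_card_roots:
  fixes p :: "complex poly"
  assumes p: "p \<noteq> 0" and c: "degree p \<le> card {z. poly p z = 0}" and z: "poly p z = 0"
  shows "order z p = 1"
proof (rule ccontr)
  have fin: "finite {z. poly p z = 0}" using p by (rule poly_roots_finite)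
  assume "order z p \<noteq> 1"
  then have "order z p > 1" using order_root[of p z] p z by linarith
  then have "(\<Sum>z | poly p z = 0. 1) < (\<Sum>z | poly p z = 0. order z p)"
    using fin p z
    by (intro sum_strict_mono_ex1) (auto simp: order_gt_0_iff Suc_le_eq)
  then show False using sum_order_eq_degree[OF p] c by simp
qed

text \<open>There is room for \<open>degree A + degree B\<close> distinct roots only if
  \<open>A\<close> and \<open>B\<close> are squarefree and have no common root.\<close>

lemma root_orders_power_mult:
  fixes A B :: "complex poly"
  assumes p: "p = A ^ a * B ^ b" and ab: "a \<ge> 1" "b \<ge> 1" and nz: "A \<noteq> 0" "B \<noteq> 0"
    and c: "degree A + degree B \<le> card {z. poly p z = 0}"
  shows "root_orders p = replicate_mset (degree A) a + replicate_mset (degree B) b"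
proof -
  let ?A = "{z. poly A z = 0}" and ?B = "{z. poly B z = 0}"
  have fin: "finite ?A" "finite ?B" using nz by (auto simp: poly_roots_finite)
  have Z: "{z. poly p z = 0} = ?A \<union> ?B" using p ab by auto
  have cA: "card ?A \<le> degree A" and cB: "card ?B \<le> degree B"
    using nz by (simp_all add: card_poly_roots_bound)
  have "card (?A \<union> ?B) + card (?A \<inter> ?B) = card ?A + card ?B"
    using card_Un_Int[OF fin] by simp
  then have eq: "card ?A = degree A" "card ?B = degree B" and "card (?A \<inter> ?B) = 0"
    using cA cB c unfolding Z by linarith+
  then have disj: "?A \<inter> ?B = {}" using fin by simp
  have "order z p = a * order z A + b * order z B" for z
  proof -
    have "proots p = repeat_mset a (proots A) + repeat_mset b (proots B)"
      using p nz by (simp add: proots_mult proots_power)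
    then have "count (proots p) z = a * count (proots A) z + b * count (proots B) z" by simp
    moreover have "p \<noteq> 0" using p nz by simp
    ultimately show ?thesis using nz by simp
  qed
  moreover have "order z A = 1" if "z \<in> ?A" for z
    using order_eq_1_if_card_roots[OF nz(1)] eq that by simp
  moreover have "order z B = 1" if "z \<in> ?B" for z
    using order_eq_1_if_card_roots[OF nz(2)] eq that by simp
  moreover have "order z B = 0" if "z \<in> ?A" for z
    using that disj nz by (auto simp: order_root)
  moreover have "order z A = 0" if "z \<in> ?B" for z
    using that disj nz by (auto simp: order_root)
  ultimately have 1: "z \<in> ?A \<Longrightarrow> order z p = a" and 2: "z \<in> ?B \<Longrightarrow> order z p = b" for z
    by simp_all
  have "root_orders p = image_mset (\<lambda>z. order z p) (mset_set ?A) + image_mset (\<lambda>z. order z p) (mset_set ?B)"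
    unfolding root_orders_def Z using fin disj by (simp add: mset_set_Union)
  also have "image_mset (\<lambda>z. order z p) (mset_set ?A) = image_mset (\<lambda>_. a) (mset_set ?A)"
    by (rule image_mset_cong) (use fin 1 in auto)
  also have "image_mset (\<lambda>z. order z p) (mset_set ?B) = image_mset (\<lambda>_. b) (mset_set ?B)"
    by (rule image_mset_cong) (use fin 2 in auto)
  finally show ?thesis using eq by (simp add: image_mset_const_eq)
qed

section \<open>Wronskians and the Mason-Stothers count\<close>

definition wronskian :: "complex poly \<Rightarrow> complex poly \<Rightarrow> complex poly" where
  "wronskian p q = pderiv p * q - p * pderiv q"

text \<open>Differentiation lowers the order at a root by exactly one, so the power of X - z
  dividing \<open>pderiv r\<close> divides both terms of \<open>W\<close>, whatever \<open>q\<close>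
  is.\<close>

lemma wronskian_order:
  fixes r q W :: "complex poly"
  assumes r: "r \<noteq> 0" and z: "poly r z = 0" and W: "W = pderiv r * q - r * pderiv q" "W \<noteq> 0"
  shows "order z r \<le> order z W + 1"
proof -
  have o: "order z r = Suc (order z (pderiv r))"
    using order_pderiv[OF r z] .
  define k where "k = order z (pderiv r)"
  have "[:-z, 1:] ^ k dvd pderiv r" "[:-z, 1:] ^ k dvd r"
    using o unfolding k_def by (auto simp: order_divides)
  then have "[:-z, 1:] ^ k dvd W" using W by simp
  then show ?thesis using W(2) o by (simp add: order_divides k_def)
qed

text \<open>If \<open>pderiv p * q\<close> were equal to \<open>p * pderiv q\<close>, then at a root
  of \<open>p\<close>, where \<open>q\<close> does not vanish, \<open>pderiv p\<close> would vanish
  at least to the order of \<open>p\<close>; it vanishes to one order less.\<close>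

lemma wronskian_nonzero:
  assumes cop: "\<And>z. poly p z = 0 \<Longrightarrow> poly q z \<noteq> 0" and deg: "degree p > 0"
  shows "wronskian p q \<noteq> 0"
proof
  assume W: "wronskian p q = 0"
  obtain z where z: "poly p z = 0"
    using deg fundamental_theorem_of_algebra[of p] by (auto simp: constant_degree)
  have p: "p \<noteq> 0" using deg by auto
  have p': "pderiv p \<noteq> 0" using deg by (simp add: pderiv_eq_0_iff)
  have q: "q \<noteq> 0" "order z q = 0" using cop[OF z] by (auto simp: order_0I)
  have "order z (p * pderiv q) = order z (pderiv p * q)"
    using W by (simp add: wronskian_def)
  moreover have "pderiv q \<noteq> 0"
    using W p' q p by (auto simp: wronskian_def)
  ultimately have "order z p + order z (pderiv q) = order z (pderiv p)"
    using p p' q by (simp add: order_mult)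
  then show False using order_pderiv[OF p z] by simp
qed

lemma wronskian_degree:
  assumes "degree p > 0"
  shows "degree (wronskian p q) < degree p + degree q"
proof -
  have "degree (pderiv p * q) < degree p + degree q"
    using degree_mult_le[of "pderiv p" q] assms by (simp add: degree_pderiv)
  moreover have "degree (p * pderiv q) < degree p + degree q"
  \<comment> \<open>\<open>degree_pderiv\<close> subtracts in the naturals and shows no drop for
    constant \<open>q\<close>; there the whole term vanishes.\<close>
  proof (cases "degree q = 0")
    case True
    then have "pderiv q = 0" by (simp add: pderiv_eq_0_iff)
    then show ?thesis using assms by simp
  next
    case False
    then show ?thesis
      using degree_mult_le[of p "pderiv q"] by (simp add: degree_pderiv)
  qed
  ultimately show ?thesis unfolding wronskian_def by (rule degree_diff_less)
qed

text \<open>The count behind the Mason--Stothers theorem: every root of \<open>p - w q\<close> or of \<open>q\<close> of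
  order \<open>k\<close> is a root of the Wronskian of order at least \<open>k - 1\<close>.\<close>

lemma mason_stothers_count:
  fixes p q :: "complex poly"
  assumes cop: "\<And>z. poly p z = 0 \<Longrightarrow> poly q z \<noteq> 0" and deg: "degree q < degree p"
    and q: "q \<noteq> 0" and c: "c \<noteq> 0"
  defines "r \<equiv> \<lambda>w. p - smult w q"
  defines "Z \<equiv> \<lambda>p. {z. poly p z = 0}"
  shows "degree p + 1 \<le> card (Z p) + card (Z (r c)) + card (Z q)"
    and "\<lbrakk>card (Z p) + card (Z (r c)) + card (Z q) \<le> degree p + 1; w \<noteq> 0; w \<noteq> c;
          poly (r w) z = 0\<rbrakk> \<Longrightarrow> order z (r w) = 1"
proof -
  let ?W = "wronskian p q"
  have degp: "degree p > 0" using deg by simp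
  have W: "?W \<noteq> 0" using cop degp by (rule wronskian_nonzero)
  \<comment> \<open>Adding a multiple of \<open>q\<close> to \<open>p\<close> leaves the Wronskian
    unchanged, so all members of the pencil share it.\<close>
  have Wr: "?W = pderiv (r w) * q - r w * pderiv q" for w
    by (simp add: wronskian_def r_def pderiv_diff pderiv_smult algebra_simps)
  \<comment> \<open>Reading the pair (p, q) as (q, -p) makes the same order estimate available at
    the roots of \<open>q\<close>.\<close>
  have Wq: "?W = pderiv q * (- p) - q * pderiv (- p)"
    by (simp add: wronskian_def pderiv_minus)
  have dr: "degree (r w) = degree p" for w
    unfolding r_def diff_conv_add_uminus by (rule degree_add_eq_left) (use deg in simp)
  have rnz: "r w \<noteq> 0" for w using dr[of w] degp by auto
  have fin: "finite (Z (r w))" "finite (Z q)" for w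
    using rnz q by (simp_all add: Z_def poly_roots_finite)
  have r0: "r 0 = p" by (simp add: r_def)
  have notq: "poly q z \<noteq> 0" if "z \<in> Z (r w)" for w z
    using that cop[of z] by (auto simp: Z_def r_def)
  have disj: "Z (r w) \<inter> Z q = {}" "v \<noteq> w \<Longrightarrow> Z (r v) \<inter> Z (r w) = {}" for v w
    using notq[of _ w] by (auto simp: Z_def r_def)
  have sumr: "degree p \<le> (\<Sum>z\<in>Z (r w). order z ?W) + card (Z (r w))" for w
  proof -
    have "degree p = (\<Sum>z\<in>Z (r w). order z (r w))"
      using sum_order_eq_degree[OF rnz] dr by (simp add: Z_def)
    also have "\<dots> \<le> (\<Sum>z\<in>Z (r w). order z ?W + 1)"
      by (rule sum_mono, rule wronskian_order[OF rnz _ Wr W]) (simp add: Z_def)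
    finally show ?thesis by (simp only: sum.distrib card_eq_sum)
  qed
  have sumq: "degree q \<le> (\<Sum>z\<in>Z q. order z ?W) + card (Z q)"
  proof -
    have "degree q = (\<Sum>z\<in>Z q. order z q)"
      using sum_order_eq_degree[OF q] by (simp add: Z_def)
    also have "\<dots> \<le> (\<Sum>z\<in>Z q. order z ?W + 1)"
      by (rule sum_mono, rule wronskian_order[OF q _ Wq W]) (simp add: Z_def)
    finally show ?thesis by (simp only: sum.distrib card_eq_sum)
  qed
  let ?U = "Z p \<union> Z (r c) \<union> Z q"
  have finU: "finite ?U" using fin r0 by (metis finite_UnI)
  have sumU: "(\<Sum>z\<in>?U. order z ?W) =
      (\<Sum>z\<in>Z p. order z ?W) + (\<Sum>z\<in>Z (r c). order z ?W) + (\<Sum>z\<in>Z q. order z ?W)"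
  proof -
    have "Z p \<inter> Z (r c) = {}" "(Z p \<union> Z (r c)) \<inter> Z q = {}"
      using disj(2)[of 0 c] disj(1)[of 0] disj(1)[of c] c r0 by auto
    then show ?thesis using fin(1)[of 0] fin(1)[of c] fin(2) r0
      by (simp add: sum.union_disjoint)
  qed
  have low: "2 * degree p + degree q \<le>
      (\<Sum>z\<in>?U. order z ?W) + (card (Z p) + card (Z (r c)) + card (Z q))"
    using sumr[of 0] sumr[of c] sumq sumU r0 by simp
  show "degree p + 1 \<le> card (Z p) + card (Z (r c)) + card (Z q)"
    using low sum_order_le_degree[OF W finU] wronskian_degree[OF degp, of q] by linarith
  assume N: "card (Z p) + card (Z (r c)) + card (Z q) \<le> degree p + 1"
    and w: "w \<noteq> 0" "w \<noteq> c" and z: "poly (r w) z = 0"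
  have "z \<in> Z (r w)" using z by (simp add: Z_def)
  moreover have "Z p \<inter> Z (r w) = {}" "Z (r c) \<inter> Z (r w) = {}" "Z (r w) \<inter> Z q = {}"
    using disj(2)[OF w(1)[symmetric], unfolded r0] disj(2)[OF w(2)[symmetric]] disj(1)[of w]
    by blast+
  ultimately have "z \<notin> ?U" by blast
  \<comment> \<open>The roots in \<open>?U\<close> already exhaust the degree of the Wronskian,
    which is at most \<open>degree p + degree q - 1\<close>, so it cannot vanish at a further
    point.\<close>
  then have "(\<Sum>z\<in>insert z ?U. order z ?W) = order z ?W + (\<Sum>z\<in>?U. order z ?W)"
    using finU by simp
  moreover have "(\<Sum>z\<in>insert z ?U. order z ?W) \<le> degree ?W"
    by (rule sum_order_le_degree[OF W]) (simp only: finite_insert finU)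
  ultimately have "order z ?W = 0"
    using low N wronskian_degree[OF degp, of q] by linarith
  then have "order z (r w) \<le> 1"
    using wronskian_order[OF rnz z Wr W] by simp
  moreover have "order z (r w) \<noteq> 0" using z rnz by (simp add: order_root)
  ultimately show "order z (r w) = 1" by simp
qed

section \<open>Holomorphic maps and charts of the sphere\<close>

lemma homeomorphism_imp_homeomorphic_map:
  assumes "homeomorphism S T f g"
  shows "homeomorphic_map (top_of_set S) (top_of_set T) f"
proof -
  have "homeomorphic_maps (top_of_set S) (top_of_set T) f g"
    using assms unfolding homeomorphic_maps_def homeomorphism_def
    by (auto simp: continuous_map_in_subtopology)
  then show ?thesis
    using homeomorphic_maps_map by blast
qed

text \<open>A target chart can be shrunk into any neighbourhood of \<open>f x\<close>, and the
  source chart follows. This supplies the continuity clause of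
  \<open>branched_cover\<close>.\<close>

lemma continuous_map_if_local_model:
  assumes lm: "\<And>x. x \<in> topspace X \<Longrightarrow> \<exists>k. local_model X Y f x k"
  shows "continuous_map X Y f"
proof -
  have fY: "f x \<in> topspace Y" if x: "x \<in> topspace X" for x
  proof -
    obtain k where "local_model X Y f x k" using lm[OF x] by blast
    then obtain U V where "x \<in> U" "openin Y V" "f ` U \<subseteq> V"
      unfolding local_model_def by blast
    then show ?thesis using openin_subset by blast
  qed
  show ?thesis
    unfolding continuous_map
  proof (intro conjI allI impI)
    show "f ` topspace X \<subseteq> topspace Y" using fY by blast
    fix W assume W: "openin Y W"
    show "openin X {x \<in> topspace X. f x \<in> W}"
    proof (subst openin_subopen, intro ballI)
      fix x assume x: "x \<in> {x \<in> topspace X. f x \<in> W}"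
      then have fx: "f x \<in> W" "x \<in> topspace X" by auto
      obtain k where k: "local_model X Y f x k" using lm[OF fx(2)] by blast
      obtain U V \<phi> \<psi> r where
        "r > (0::real)" "k \<ge> 1" "openin X U" "U \<subseteq> topspace X" "x \<in> U" "openin Y V" "V \<subseteq> W"
        "homeomorphic_map (subtopology X U) (top_of_set (ball (0::complex) r)) \<phi>"
        "homeomorphic_map (subtopology Y V) (top_of_set (ball (0::complex) (r ^ k))) \<psi>"
        "\<phi> x = 0" "\<psi> (f x) = 0" "\<And>u. u \<in> U \<Longrightarrow> f u \<in> V \<and> \<psi> (f u) = \<phi> u ^ k"
        by (rule local_model_discs[OF k openin_topspace fx(2) W fx(1)]) (rule that)
      then show "\<exists>T. openin X T \<and> x \<in> T \<and> T \<subseteq> {x \<in> topspace X. f x \<in> W}"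
        using openin_subset by (intro exI[of _ U]) blast
    qed
  qed
qed

lemma holomorphic_nth_root:
  assumes G: "G holomorphic_on ball x e" "G x \<noteq> (0::complex)" and e: "e > 0" and k: "k \<ge> 1"
  obtains H d where "0 < d" "d \<le> e" "H holomorphic_on ball x d" "H x \<noteq> 0"
    "\<And>z. z \<in> ball x d \<Longrightarrow> H z ^ k = G z"
proof -
  have cont: "continuous_on (ball x e) G"
    using G(1) by (rule holomorphic_on_imp_continuous_on)
  then have "isCont G x"
    using e by (simp add: continuous_on_eq_continuous_at)
  then have "(G \<longlongrightarrow> G x) (at x)" by (simp add: isCont_def)
  then have "\<forall>\<^sub>F z in at x. dist (G z) (G x) < norm (G x)"
    using G(2) by (intro tendstoD) auto
  then obtain d0 where d0: "d0 > 0" "\<And>z. z \<noteq> x \<Longrightarrow> dist z x < d0 \<Longrightarrow> dist (G z) (G x) < norm (G x)"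
    unfolding eventually_at by auto
  define d where "d = min d0 e"
  have d: "d > 0" "d \<le> e" "d \<le> d0" using d0(1) e by (auto simp: d_def)
  have close: "dist (G z) (G x) < norm (G x)" if "z \<in> ball x d" for z
    using d0(2)[of z] that d G(2) by (cases "z = x") (auto simp: dist_commute)
  \<comment> \<open>The quotient stays in the disc of radius 1 about 1, hence off the cut of
    \<open>Ln\<close>; this makes \<open>H\<close> holomorphic.\<close>
  have nonpos: "G z / G x \<notin> \<real>\<^sub>\<le>\<^sub>0" if z: "z \<in> ball x d" for z
  proof
    assume "G z / G x \<in> \<real>\<^sub>\<le>\<^sub>0"
    then have re: "Re (G z / G x) \<le> 0" by (simp add: complex_nonpos_Reals_iff)
    have "G z / G x - 1 = (G z - G x) / G x" using G(2) by (simp add: diff_divide_distrib)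
    then have "norm (G z / G x - 1) < 1"
      using close[OF z] G(2) by (simp add: dist_norm norm_divide)
    moreover have "1 - Re (G z / G x) \<le> norm (G z / G x - 1)"
      using abs_Re_le_cmod[of "G z / G x - 1"] by simp
    ultimately show False using re by linarith
  qed
  define H where "H z = exp ((Ln (G z / G x) + Ln (G x)) / of_nat k)" for z
  show thesis
  proof
    show "H holomorphic_on ball x d"
      unfolding H_def
      by (intro holomorphic_intros holomorphic_on_subset[OF G(1)]) (use d nonpos G(2) k in auto)
    show "H z ^ k = G z" if z: "z \<in> ball x d" for z
    proof -
      have "G z \<noteq> 0" using close[OF z] by (auto simp: dist_norm)
      have "H z ^ k = exp (Ln (G z / G x) + Ln (G x))"
        using k by (simp add: H_def flip: exp_of_nat_mult)
      also have "\<dots> = G z" using \<open>G z \<noteq> 0\<close> G(2) by (simp add: exp_add)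
      finally show ?thesis .
    qed
  qed (use d in \<open>auto simp: H_def\<close>)
qed

text \<open>With \<open>H\<close> a k-th root of the cofactor \<open>G\<close>, the function
  \<open>P z = (z - a x) * H z\<close> satisfies \<open>P z ^ k = g z - g (a x)\<close> and has the
  nonzero derivative \<open>H (a x)\<close> at \<open>a x\<close>. So \<open>P\<close> is a local
  coordinate in which the map is the k-th power.\<close>

lemma local_model_holomorphic:
  assumes U: "openin X U" "x \<in> U" and V: "openin Y V" and FUV: "F ` U \<subseteq> V"
    and AB: "open A" "open B"
    and ha: "homeomorphic_map (subtopology X U) (top_of_set A) a"
    and hb: "homeomorphic_map (subtopology Y V) (top_of_set B) b"
    and eq: "\<And>u. u \<in> U \<Longrightarrow> b (F u) = g (a u)"
    and k: "k \<ge> 1" and e: "e > 0" and G: "G holomorphic_on ball (a x) e" "G (a x) \<noteq> 0"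
    and gG: "\<And>z. z \<in> A \<Longrightarrow> z \<in> ball (a x) e \<Longrightarrow> g z = g (a x) + (z - a x) ^ k * G z"
  shows "local_model X Y F x k"
proof -
  obtain H d where d: "0 < d" "d \<le> e" and H: "H holomorphic_on ball (a x) d" "H (a x) \<noteq> 0"
    and HG: "\<And>z. z \<in> ball (a x) d \<Longrightarrow> H z ^ k = G z"
    by (rule holomorphic_nth_root[OF G e k]) (rule that)
  have subX: "U \<subseteq> topspace X" and subY: "V \<subseteq> topspace Y"
    using U V openin_subset by auto
  have "a x \<in> A"
    using homeomorphic_imp_surjective_map[OF ha] subX U(2) by (auto simp: Int_absorb1)
  then have ax: "a x \<in> A \<inter> ball (a x) d" using d by simp
  define P where "P z = (z - a x) * H z" for z
  have P: "P holomorphic_on A \<inter> ball (a x) d"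
    unfolding P_def by (intro holomorphic_intros holomorphic_on_subset[OF H(1)]) auto
  have "(H has_field_derivative deriv H (a x)) (at (a x))"
    using H(1) d by (simp add: holomorphic_derivI)
  then have "(P has_field_derivative H (a x)) (at (a x))"
    unfolding P_def by (auto intro!: derivative_eq_intros)
  then have "deriv P (a x) \<noteq> 0" using H(2) by (simp add: DERIV_imp_deriv)
  then obtain r where r: "r > 0" "ball (a x) r \<subseteq> A \<inter> ball (a x) d" "inj_on P (ball (a x) r)"
    using has_complex_derivative_locally_injective[OF P ax] AB by blast
  have Pr: "P holomorphic_on ball (a x) r"
    using P r(2) by (rule holomorphic_on_subset)
  obtain Q where Q: "homeomorphism (ball (a x) r) (P ` ball (a x) r) P Q"
    using invariance_of_domain_homeomorphism[OF open_ball holomorphic_on_imp_continuous_on[OF Pr]]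
      r(3) by blast
  have hP: "homeomorphic_map (top_of_set (ball (a x) r)) (top_of_set (P ` ball (a x) r)) P"
    by (rule homeomorphism_imp_homeomorphic_map[OF Q])
  let ?U = "{u \<in> U. a u \<in> ball (a x) r}"
  have ha': "homeomorphic_map (subtopology X ?U) (top_of_set (ball (a x) r)) a"
    by (rule homeomorphic_map_restrict[OF ha subX]) (use r in auto)
  have hs: "homeomorphism B ((\<lambda>z. z - g (a x)) ` B) (\<lambda>z. z - g (a x)) (\<lambda>z. z + g (a x))"
    by (auto simp: homeomorphism_def image_image intro!: continuous_intros)
  show ?thesis
    unfolding local_model_def
  proof (intro conjI exI)
    show "openin X ?U"
      by (rule openin_homeomorphic_preimage[OF ha U(1)]) (use r AB in \<open>auto simp: open_subset\<close>)
    show "openin Y V" "x \<in> ?U" "k \<ge> 1" using V U r k by auto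
    show "F ` ?U \<subseteq> V" using FUV by auto
    show "open (P ` ball (a x) r)" by (rule open_mapping_thm3[OF Pr _ r(3)]) simp
    show "open ((\<lambda>z. z - g (a x)) ` B)"
      using open_translation[OF AB(2), of "- g (a x)"] by (simp add: image_def)
    show "homeomorphic_map (subtopology X ?U) (top_of_set (P ` ball (a x) r)) (P \<circ> a)"
      by (rule homeomorphic_map_compose[OF ha' hP])
    show "homeomorphic_map (subtopology Y V) (top_of_set ((\<lambda>z. z - g (a x)) ` B)) ((\<lambda>z. z - g (a x)) \<circ> b)"
      by (rule homeomorphic_map_compose[OF hb homeomorphism_imp_homeomorphic_map[OF hs]])
    show "(P \<circ> a) x = 0" by (simp add: P_def)
    show "((\<lambda>z. z - g (a x)) \<circ> b) (F x) = 0" using eq[OF U(2)] by simp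
    show "\<forall>u\<in>?U. ((\<lambda>z. z - g (a x)) \<circ> b) (F u) = (P \<circ> a) u ^ k"
    proof
      fix u assume u: "u \<in> ?U"
      then have m: "a u \<in> A" "a u \<in> ball (a x) d" "a u \<in> ball (a x) e" using r(2) d by auto
      show "((\<lambda>z. z - g (a x)) \<circ> b) (F u) = (P \<circ> a) u ^ k"
        using eq[of u] u gG[OF m(1,3)] HG[OF m(2)] by (simp add: P_def power_mult_distrib)
    qed
  qed
qed

text \<open>Projection of the punctured sphere to a hyperplane, followed by an identification of
  two-dimensional spaces. A homeomorphism suffices because local models are topological.\<close>

lemma sphere_chart:
  assumes "b \<in> sphere (0::real^3) 1"
  obtains h e where "homeomorphism (sphere 0 1 - {b}) (UNIV :: complex set) h e"
proof -
  have "(sphere (0::real^3) 1 - {b}) homeomorphic {x::real^3. axis 1 1 \<bullet> x = 0}"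
    using assms by (intro homeomorphic_punctured_sphere_hyperplane) auto
  also have "{x::real^3. axis 1 1 \<bullet> x = 0} homeomorphic (UNIV :: complex set)"
  proof (rule homeomorphic_subspaces)
    show "subspace {x::real^3. axis 1 1 \<bullet> x = 0}" by (rule subspace_hyperplane)
    have "dim {x::real^3. axis 1 1 \<bullet> x = 0} = DIM(real^3) - 1"
      by (rule dim_hyperplane) simp
    then show "dim {x::real^3. axis 1 1 \<bullet> x = 0} = dim (UNIV :: complex set)" by simp
  qed simp
  finally show thesis using that unfolding homeomorphic_def by blast
qed

text \<open>Outside a neighbourhood of \<open>b\<close> the sphere is compact, so its image under
  \<open>h\<close> is bounded; conversely, the image of a closed disc under \<open>e\<close> is
  compact and avoids \<open>b\<close>.\<close>

lemma sphere_chart_tendsto: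
  assumes h: "homeomorphism (sphere 0 1 - {b}) (UNIV :: complex set) h e"
    and b: "b \<in> sphere (0::'a::euclidean_space) 1"
  shows "(e \<longlongrightarrow> b) at_infinity"
    and "filterlim h at_infinity (at b within sphere 0 1)"
proof -
  have ch: "continuous_on (sphere 0 1 - {b}) h" and ce: "continuous_on UNIV e"
    and eh: "\<And>v. v \<in> sphere 0 1 - {b} \<Longrightarrow> e (h v) = v" and he: "\<And>z. h (e z) = z"
    and eim: "\<And>z. e z \<in> sphere 0 1 - {b}"
    using h unfolding homeomorphism_def by blast+
  show "(e \<longlongrightarrow> b) at_infinity"
  proof (rule topological_tendstoI)
    fix N assume N: "open N" "b \<in> N"
    have "compact (sphere 0 1 - N)" by (intro compact_diff N) simp
    then have "bounded (h ` (sphere 0 1 - N))"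
      by (intro compact_imp_bounded compact_continuous_image continuous_on_subset[OF ch])
        (use N in auto)
    then obtain R where R: "\<And>v. v \<in> sphere 0 1 - N \<Longrightarrow> norm (h v) \<le> R"
      unfolding bounded_iff by blast
    show "\<forall>\<^sub>F z in at_infinity. e z \<in> N"
      unfolding eventually_at_infinity
    proof (intro exI[of _ "R + 1"] allI impI)
      fix z :: complex assume "R + 1 \<le> norm z"
      then show "e z \<in> N" using R[of "e z"] he[of z] eim[of z] by fastforce
    qed
  qed
  show "filterlim h at_infinity (at b within sphere 0 1)"
    unfolding filterlim_at_infinity[OF order_refl]
  proof (intro allI impI)
    fix r :: real assume "r > 0"
    have "compact (e ` cball 0 r)"
      by (intro compact_continuous_image continuous_on_subset[OF ce]) auto
    then have "open (- e ` cball 0 r)" by (simp add: compact_imp_closed open_Compl)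
    moreover have "b \<in> - e ` cball 0 r" using eim by force
    ultimately have "\<forall>\<^sub>F v in at b within sphere 0 1. v \<in> - e ` cball 0 r"
      by (rule eventually_at_topological[THEN iffD2, OF exI, OF conjI, OF _ conjI]) auto
    then show "\<forall>\<^sub>F v in at b within sphere 0 1. r \<le> norm (h v)"
    proof (rule eventually_elim2[of _ _ "\<lambda>v. v \<in> sphere 0 1 - {b}"])
      show "\<forall>\<^sub>F v in at b within sphere 0 1. v \<in> sphere 0 1 - {b}"
        by (auto simp: eventually_at_filter)
      fix v assume v: "v \<in> - e ` cball 0 r" "v \<in> sphere 0 1 - {b}"
      show "r \<le> norm (h v)"
      proof (rule ccontr)
        assume "\<not> r \<le> norm (h v)"
        then have "e (h v) \<in> e ` cball 0 r" by auto
        then show False using v eh by auto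
      qed
    qed
  qed
qed

text \<open>This is the coordinate 1/z around infinity: inversion moves the puncture from
  \<open>b\<close> to \<open>e 0\<close>. Continuity at \<open>b\<close> and at 0 comes from the
  limits in \<open>sphere_chart_tendsto\<close>.\<close>

lemma sphere_chart_infinity:
  assumes h: "homeomorphism (sphere 0 1 - {b}) (UNIV :: complex set) h e"
    and b: "b \<in> sphere (0::'a::euclidean_space) 1"
  shows "homeomorphism (sphere 0 1 - {e 0}) UNIV
    (\<lambda>v. if v = b then 0 else inverse (h v)) (\<lambda>w. if w = 0 then b else e (inverse w))"
proof -
  have ch: "continuous_on (sphere 0 1 - {b}) h" and ce: "continuous_on UNIV e"
    and eh: "\<And>v. v \<in> sphere 0 1 - {b} \<Longrightarrow> e (h v) = v" and he: "\<And>z. h (e z) = z"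
    and eim: "\<And>z. e z \<in> sphere 0 1 - {b}"
    using h unfolding homeomorphism_def by blast+
  have hnz: "h v \<noteq> 0" if "v \<in> sphere 0 1 - {e 0}" "v \<noteq> b" for v
    using eh[of v] that by auto
  have einj: "e z = e w \<longleftrightarrow> z = w" for z w using he by metis
  let ?h = "\<lambda>v. if v = b then 0 else inverse (h v)"
  let ?e = "\<lambda>w. if w = 0 then b else e (inverse w)"
  have "continuous_on (sphere 0 1 - {e 0}) ?h"
    unfolding continuous_on_eq_continuous_within
  proof
    fix v assume v: "v \<in> sphere 0 1 - {e 0}"
    show "continuous (at v within sphere 0 1 - {e 0}) ?h"
    proof (cases "v = b")
      case True
      have "((\<lambda>v. inverse (h v)) \<longlongrightarrow> 0) (at b within sphere 0 1)"
        by (rule filterlim_compose[OF tendsto_inverse_0 sphere_chart_tendsto(2)[OF h b]])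
      then have "((\<lambda>v. inverse (h v)) \<longlongrightarrow> 0) (at b within sphere 0 1 - {e 0})"
        by (rule tendsto_within_subset) auto
      then have "(?h \<longlongrightarrow> 0) (at b within sphere 0 1 - {e 0})"
        by (rule Lim_transform_eventually) (auto simp: eventually_at_filter)
      then show ?thesis using True by (simp add: continuous_within)
    next
      case False
      have o: "open (- {b})" by auto
      have "continuous_on (sphere 0 1 - {e 0} - {b}) (\<lambda>v. inverse (h v))"
        by (intro continuous_intros continuous_on_subset[OF ch]) (use hnz in auto)
      then have "continuous_on ((sphere 0 1 - {e 0}) \<inter> - {b}) ?h"
        by (rule continuous_on_eq[THEN continuous_on_subset]) auto
      then have "continuous (at v within (sphere 0 1 - {e 0}) \<inter> - {b}) ?h"
        using v False by (auto simp: continuous_on_eq_continuous_within)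
      moreover have "at v within (sphere 0 1 - {e 0}) \<inter> - {b} = at v within sphere 0 1 - {e 0}"
        by (rule at_within_nhd[of _ "- {b}"]) (use False in auto)
      ultimately show ?thesis by simp
    qed
  qed
  moreover have "continuous_on UNIV ?e"
    unfolding continuous_on_eq_continuous_within
  proof
    fix w :: complex
    show "continuous (at w) ?e"
    proof (cases "w = 0")
      case True
      have "((\<lambda>w. e (inverse w)) \<longlongrightarrow> b) (at 0)"
        by (rule filterlim_compose[OF sphere_chart_tendsto(1)[OF h b] filterlim_inverse_at_infinity])
      then have "(?e \<longlongrightarrow> b) (at 0)"
        by (rule Lim_transform_eventually) (auto simp: eventually_at_filter)
      then show ?thesis using True by (simp add: continuous_within)
    next
      case False
      have "continuous_on (- {0}) (\<lambda>w. e (inverse w))"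
        by (intro continuous_intros continuous_on_compose2[OF ce]) auto
      then have "continuous_on (- {0}) ?e"
        by (rule continuous_on_eq) auto
      then show ?thesis
        using False by (simp add: continuous_on_eq_continuous_at open_Compl)
    qed
  qed
  moreover have "?h ` (sphere 0 1 - {e 0}) = UNIV"
  proof (intro equalityI subsetI)
    fix w :: complex
    have "?e w \<noteq> e 0"
    proof (cases "w = 0")
      case True
      then show ?thesis using eim[of 0] by auto
    next
      case False
      then show ?thesis by (simp add: einj)
    qed
    then have "w = ?h (?e w)" "?e w \<in> sphere 0 1 - {e 0}"
      using he[of "inverse w"] eim[of "inverse w"] b by auto
    then show "w \<in> ?h ` (sphere 0 1 - {e 0})" by blast
  qed auto
  moreover have "?e ` UNIV = sphere 0 1 - {e 0}"
  proof (intro equalityI subsetI)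
    fix v assume v: "v \<in> sphere 0 1 - {e 0}"
    then have "v = ?e (?h v)" using eh[of v] hnz[of v] by auto
    then show "v \<in> range ?e" by (rule range_eqI)
  next
    fix v assume "v \<in> range ?e"
    then obtain w where w: "v = ?e w" by blast
    show "v \<in> sphere 0 1 - {e 0}"
    proof (cases "w = 0")
      case True
      then show ?thesis using w b eim[of 0] by auto
    next
      case False
      then show ?thesis using w eim[of "inverse w"] by (auto simp: einj)
    qed
  qed
  moreover have "\<forall>v\<in>sphere 0 1 - {e 0}. ?e (?h v) = v" using eh hnz by auto
  moreover have "\<forall>w\<in>UNIV. ?h (?e w) = w"
  proof
    fix w
    show "?h (?e w) = w" using he[of "inverse w"] eim[of "inverse w"] by auto
  qed
  ultimately show ?thesis unfolding homeomorphism_def by blast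
qed

section \<open>Branched covers given by rational functions\<close>

lemma topspace_S2: "topspace S2 = sphere 0 1"
  by (simp add: S2_def)

text \<open>The point \<open>b\<close> stands for infinity. The degree condition makes infinity a
  pole of \<open>p / q\<close>, and coprimality rules out 0/0.\<close>

locale rational_sphere_map =
  fixes b :: "real^3" and h :: "real^3 \<Rightarrow> complex" and e and p q :: "complex poly"
  assumes b: "b \<in> sphere 0 1" and h: "homeomorphism (sphere 0 1 - {b}) UNIV h e"
    and coprime: "poly p z = 0 \<Longrightarrow> poly q z \<noteq> 0"
    and deg: "degree q < degree p" and qnz: "q \<noteq> 0"
begin

definition F :: "real^3 \<Rightarrow> real^3" where
  "F v = (if v = b \<or> poly q (h v) = 0 then b else e (poly p (h v) / poly q (h v)))"

definition hinf :: "real^3 \<Rightarrow> complex" where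
  "hinf v = (if v = b then 0 else inverse (h v))"

lemma chart_simps:
  shows eh: "v \<in> sphere 0 1 \<Longrightarrow> v \<noteq> b \<Longrightarrow> e (h v) = v" and he: "h (e z) = z"
    and enb: "e z \<noteq> b" and eS: "e z \<in> sphere 0 1" and einj: "e z = e w \<longleftrightarrow> z = w"
proof -
  have 1: "\<And>v. v \<in> sphere 0 1 - {b} \<Longrightarrow> e (h v) = v" "\<And>z. h (e z) = z" "\<And>z. e z \<in> sphere 0 1 - {b}"
    using h unfolding homeomorphism_def by blast+
  show "v \<in> sphere 0 1 \<Longrightarrow> v \<noteq> b \<Longrightarrow> e (h v) = v" using 1(1) by blast
  show "h (e z) = z" by (rule 1(2))
  show "e z \<noteq> b" "e z \<in> sphere 0 1" using 1(3)[of z] by blast+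
  show "e z = e w \<longleftrightarrow> z = w" using 1(2) by metis
qed

lemma sphere_cases:
  assumes "v \<in> sphere 0 1"
  obtains "v = b" | z where "v = e z"
  using eh[OF assms] by metis

lemma F_simps: "F b = b" "poly q z = 0 \<Longrightarrow> F (e z) = b"
  "poly q z \<noteq> 0 \<Longrightarrow> F (e z) = e (poly p z / poly q z)"
  using enb by (auto simp: F_def he)

lemma F_sphere: "F v \<in> sphere 0 1"
  using b eS by (auto simp: F_def)

lemma hinf_simps: "hinf b = 0" "hinf (e z) = inverse z"
  using enb by (auto simp: hinf_def he)

lemma openin_S2_delete: "openin S2 (sphere 0 1 - {v})"
proof -
  have "openin (top_of_set (sphere 0 1)) (sphere 0 1 \<inter> - {v})"
    by (rule openin_open_Int) auto
  then show ?thesis by (simp add: S2_def Diff_eq)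
qed

lemma chart: "homeomorphic_map (subtopology S2 (sphere 0 1 - {b})) (top_of_set UNIV) h"
  using homeomorphism_imp_homeomorphic_map[OF h] by (simp add: S2_def subtopology_subtopology inf_absorb2)

lemma chart_inf: "homeomorphic_map (subtopology S2 (sphere 0 1 - {e 0})) (top_of_set UNIV) hinf"
proof -
  have "hinf = (\<lambda>v. if v = b then 0 else inverse (h v))" by (simp add: hinf_def fun_eq_iff)
  then show ?thesis
    using homeomorphism_imp_homeomorphic_map[OF sphere_chart_infinity[OF h b]]
    by (simp add: S2_def subtopology_subtopology inf_absorb2)
qed

lemma open_nonroots: "open {z::complex. poly r z \<noteq> 0}"
proof -
  have "closed {z. poly r z = 0}" by (intro closed_Collect_eq continuous_intros)
  then have "open (- {z. poly r z = 0})" by (rule open_Compl)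
  then show ?thesis by (simp add: Compl_eq)
qed

lemma ball_nonroots:
  assumes "poly r z \<noteq> (0::complex)"
  obtains d where "d > 0" "\<And>w. w \<in> ball z d \<Longrightarrow> poly r w \<noteq> 0"
proof -
  obtain d where "d > 0" "ball z d \<subseteq> {z. poly r z \<noteq> 0}"
    using openE[OF open_nonroots[of r], of z] assms by auto
  then show thesis by (intro that[of d]) auto
qed

lemma order_factor:
  assumes "r \<noteq> (0 :: complex poly)"
  obtains s where "\<And>w. poly r w = (w - z) ^ order z r * poly s w" "poly s z \<noteq> 0"
proof -
  obtain s where s: "r = [:- z, 1:] ^ order z r * s" "\<not> [:- z, 1:] dvd s"
    using order_decomp[OF assms] by blast
  have "poly r w = (w - z) ^ order z r * poly s w" for w
    by (subst s(1)) (simp add: poly_power algebra_simps)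
  moreover have "poly s z \<noteq> 0" using s(2) by (simp add: poly_eq_0_iff_dvd)
  ultimately show thesis by (rule that)
qed

lemma pencil_degree: "degree (p - smult w q) = degree p"
  unfolding diff_conv_add_uminus by (rule degree_add_eq_left) (use deg in simp)

lemma pencil_nonzero: "p - smult w q \<noteq> 0"
  using pencil_degree[of w] deg by auto

text \<open>Factoring \<open>p - w q\<close> as the k-th power of X - z times \<open>s\<close> gives
  \<open>p / q\<close> as \<open>w\<close> plus that power times \<open>s / q\<close>, the form that
  \<open>local_model_holomorphic\<close> asks for.\<close>

lemma local_model_finite:
  assumes qz: "poly q z \<noteq> 0" and pz: "poly (p - smult w q) z = 0"
  shows "local_model S2 S2 F (e z) (order z (p - smult w q))"
proof -
  let ?r = "p - smult w q"
  obtain s where s: "\<And>u. poly ?r u = (u - z) ^ order z ?r * poly s u" "poly s z \<noteq> 0"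
    by (rule order_factor[OF pencil_nonzero]) (rule that)
  obtain d where d: "d > 0" "\<And>u. u \<in> ball z d \<Longrightarrow> poly q u \<noteq> 0"
    by (rule ball_nonroots[OF qz]) (rule that)
  let ?A = "{z. poly q z \<noteq> 0}"
  let ?U = "{v \<in> sphere 0 1 - {b}. h v \<in> ?A}"
  show ?thesis
  proof (rule local_model_holomorphic[where a = h and b = h and g = "\<lambda>u. poly p u / poly q u"
        and G = "\<lambda>u. poly s u / poly q u" and U = ?U and V = "sphere 0 1 - {b}" and A = ?A
        and B = UNIV and e = d])
    show "openin S2 ?U"
      by (rule openin_homeomorphic_preimage[OF chart openin_S2_delete])
        (simp add: open_nonroots)
    show "openin S2 (sphere 0 1 - {b})" by (rule openin_S2_delete)
    show "homeomorphic_map (subtopology S2 ?U) (top_of_set ?A) h"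
      by (rule homeomorphic_map_restrict[OF chart]) (auto simp: topspace_S2)
    show "e z \<in> ?U" using qz eS enb he by simp
    show "open ?A" by (rule open_nonroots)
    show "F ` ?U \<subseteq> sphere 0 1 - {b}"
    proof
      fix y assume "y \<in> F ` ?U"
      then obtain v where "y = F v" "v \<noteq> b" "poly q (h v) \<noteq> 0" by blast
      then have "y = e (poly p (h v) / poly q (h v))" by (simp add: F_def)
      then show "y \<in> sphere 0 1 - {b}" using eS enb by blast
    qed
    show "homeomorphic_map (subtopology S2 (sphere 0 1 - {b})) (top_of_set UNIV) h" by (rule chart)
    show "h (F u) = poly p (h u) / poly q (h u)" if "u \<in> ?U" for u
      using that he by (auto simp: F_def)
    show "1 \<le> order z ?r"
      by (simp only: One_nat_def Suc_le_eq order_gt_0_iff[OF pencil_nonzero] pz)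
    show "d > 0" by (rule d)
    show "(\<lambda>u. poly s u / poly q u) holomorphic_on ball (h (e z)) d"
      by (intro holomorphic_intros) (use d he in auto)
    show "poly s (h (e z)) / poly q (h (e z)) \<noteq> 0" using s qz he by simp
    fix u assume "u \<in> ?A"
    then have u: "poly q u \<noteq> 0" by simp
    have "poly p u = w * poly q u + (u - z) ^ order z ?r * poly s u"
      using s(1)[of u] by (simp add: algebra_simps)
    moreover have "poly p z = w * poly q z" using pz by simp
    ultimately show "poly p u / poly q u = poly p (h (e z)) / poly q (h (e z)) +
        (u - h (e z)) ^ order z ?r * (poly s u / poly q u)"
      using u qz he by (simp add: add_divide_distrib)
  qed simp
qed

text \<open>In the coordinate 1/w on the target the map reads \<open>q / p\<close>, so the pole
  becomes a zero.\<close>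

lemma local_model_pole:
  assumes qz: "poly q z = 0"
  shows "local_model S2 S2 F (e z) (order z q)"
proof -
  have pz: "poly p z \<noteq> 0" using coprime qz by blast
  obtain s where s: "\<And>u. poly q u = (u - z) ^ order z q * poly s u" "poly s z \<noteq> 0"
    by (rule order_factor[OF qnz]) (rule that)
  obtain d where d: "d > 0" "\<And>u. u \<in> ball z d \<Longrightarrow> poly p u \<noteq> 0"
    by (rule ball_nonroots[OF pz]) (rule that)
  let ?A = "{z. poly p z \<noteq> 0}"
  let ?U = "{v \<in> sphere 0 1 - {b}. h v \<in> ?A}"
  show ?thesis
  proof (rule local_model_holomorphic[where a = h and b = hinf and g = "\<lambda>u. poly q u / poly p u"
        and G = "\<lambda>u. poly s u / poly p u" and U = ?U and V = "sphere 0 1 - {e 0}" and A = ?A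
        and B = UNIV and e = d])
    show "openin S2 ?U"
      by (rule openin_homeomorphic_preimage[OF chart openin_S2_delete])
        (simp add: open_nonroots)
    show "openin S2 (sphere 0 1 - {e 0})" by (rule openin_S2_delete)
    show "homeomorphic_map (subtopology S2 ?U) (top_of_set ?A) h"
      by (rule homeomorphic_map_restrict[OF chart]) (auto simp: topspace_S2)
    show "e z \<in> ?U" using pz eS enb he by simp
    show "open ?A" by (rule open_nonroots)
    show "F ` ?U \<subseteq> sphere 0 1 - {e 0}"
    proof
      fix y assume "y \<in> F ` ?U"
      then obtain v where v: "y = F v" "v \<noteq> b" "poly p (h v) \<noteq> 0" by blast
      then have "y \<noteq> e 0" using enb[of 0] einj by (auto simp: F_def)
      then show "y \<in> sphere 0 1 - {e 0}" using v(1) F_sphere by blast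
    qed
    show "homeomorphic_map (subtopology S2 (sphere 0 1 - {e 0})) (top_of_set UNIV) hinf"
      by (rule chart_inf)
    show "hinf (F u) = poly q (h u) / poly p (h u)" if "u \<in> ?U" for u
      using that by (auto simp: F_def hinf_simps)
    show "1 \<le> order z q" using qz qnz by (simp add: order_root Suc_le_eq)
    show "d > 0" by (rule d)
    show "(\<lambda>u. poly s u / poly p u) holomorphic_on ball (h (e z)) d"
      by (intro holomorphic_intros) (use d he in auto)
    show "poly s (h (e z)) / poly p (h (e z)) \<noteq> 0" using s pz he by simp
    fix u show "poly q u / poly p u = poly q (h (e z)) / poly p (h (e z)) +
        (u - h (e z)) ^ order z q * (poly s u / poly p u)"
      using s(1)[of u] qz he by simp
  qed simp
qed

text \<open>With 1/z as coordinate on both sides the map is a power of \<open>u\<close>, with the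
  difference of the degrees as exponent, times a quotient of reflected polynomials. Their constant
  terms are the leading coefficients, hence nonzero.\<close>

lemma local_model_infinity: "local_model S2 S2 F b (degree p - degree q)"
proof -
  let ?p = "reflect_poly p" and ?q = "reflect_poly q" and ?m = "degree p - degree q"
  have pnz: "p \<noteq> 0" using deg by auto
  have p0: "poly ?p 0 \<noteq> 0" and q0: "poly ?q 0 \<noteq> 0" using pnz qnz by simp_all
  obtain d where d: "d > 0" "\<And>u. u \<in> ball 0 d \<Longrightarrow> poly ?p u \<noteq> 0"
    by (rule ball_nonroots[OF p0]) (rule that)
  let ?A = "{z. poly ?p z \<noteq> 0}"
  let ?U = "{v \<in> sphere 0 1 - {e 0}. hinf v \<in> ?A}"
  have pinv: "poly p (inverse u) = poly ?p u / u ^ degree p"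
    and qinv: "poly q (inverse u) = poly ?q u / u ^ degree q" if "u \<noteq> 0" for u
    using that by (simp_all add: poly_reflect_poly_nz)
  have finv: "poly q (inverse u) / poly p (inverse u) = u ^ ?m * poly ?q u / poly ?p u" if "u \<noteq> 0" for u
  proof -
    have "u ^ degree p = u ^ degree q * u ^ ?m" using deg by (simp flip: power_add)
    then show ?thesis using that by (simp add: pinv qinv)
  qed
  have U: "v = b \<or> (\<exists>z. v = e z \<and> z \<noteq> 0 \<and> poly p z \<noteq> 0)" if "v \<in> ?U" for v
  proof -
    have "v \<in> sphere 0 1" using that by simp
    then show ?thesis
    proof (cases rule: sphere_cases)
      case (2 z)
      then have "z \<noteq> 0" "poly ?p (inverse z) \<noteq> 0" using that by (auto simp: hinf_simps)
      then show ?thesis using 2 pinv[of "inverse z"] by auto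
    qed simp
  qed
  show ?thesis
  proof (rule local_model_holomorphic[where a = hinf and b = hinf
        and g = "\<lambda>u. u ^ ?m * poly ?q u / poly ?p u"
        and G = "\<lambda>u. poly ?q u / poly ?p u" and U = ?U and V = "sphere 0 1 - {e 0}" and A = ?A
        and B = UNIV and e = d])
    show "openin S2 ?U"
      by (rule openin_homeomorphic_preimage[OF chart_inf openin_S2_delete])
        (simp add: open_nonroots)
    show "openin S2 (sphere 0 1 - {e 0})" by (rule openin_S2_delete)
    show "homeomorphic_map (subtopology S2 ?U) (top_of_set ?A) hinf"
      by (rule homeomorphic_map_restrict[OF chart_inf]) (auto simp: topspace_S2)
    show "b \<in> ?U" using p0 pnz b enb[of 0] by (auto simp: hinf_simps)
    show "open ?A" by (rule open_nonroots)
    show "F ` ?U \<subseteq> sphere 0 1 - {e 0}"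
    proof
      fix y assume "y \<in> F ` ?U"
      then obtain v where v: "v \<in> ?U" "y = F v" by blast
      have "F v \<noteq> e 0"
        using U[OF v(1)]
      proof (elim disjE exE conjE)
        fix z assume "v = e z" "poly p z \<noteq> 0"
        then show ?thesis
          using einj enb[of 0] by (cases "poly q z = 0") (auto simp: F_simps)
      qed (use F_simps(1) enb[of 0] in auto)
      then show "y \<in> sphere 0 1 - {e 0}" using v(2) F_sphere[of v] by simp
    qed
    show "homeomorphic_map (subtopology S2 (sphere 0 1 - {e 0})) (top_of_set UNIV) hinf"
      by (rule chart_inf)
    show "hinf (F v) = hinf v ^ ?m * poly ?q (hinf v) / poly ?p (hinf v)" if "v \<in> ?U" for v
      using U[OF that]
    proof (elim disjE exE conjE)
      assume "v = b"
      then show ?thesis using deg by (simp add: F_simps hinf_simps)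
    next
      fix z assume z: "v = e z" "z \<noteq> 0"
      have "hinf (F v) = poly q z / poly p z"
        using z by (cases "poly q z = 0") (auto simp: F_simps hinf_simps)
      then show ?thesis using finv[of "inverse z"] z by (simp add: hinf_simps)
    qed
    show "1 \<le> ?m" using deg by simp
    show "d > 0" by (rule d)
    show "(\<lambda>u. poly ?q u / poly ?p u) holomorphic_on ball (hinf b) d"
      by (intro holomorphic_intros) (use d in \<open>auto simp: hinf_simps\<close>)
    show "poly ?q (hinf b) / poly ?p (hinf b) \<noteq> 0" using p0 q0 by (simp add: hinf_simps)
    show "u ^ ?m * poly ?q u / poly ?p u = hinf b ^ ?m * poly ?q (hinf b) / poly ?p (hinf b) +
        (u - hinf b) ^ ?m * (poly ?q u / poly ?p u)" for u
      using deg by (simp add: hinf_simps)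
  qed simp
qed

lemma local_degree_simps:
  shows "local_degree S2 S2 F b = degree p - degree q"
    and "poly q z = 0 \<Longrightarrow> local_degree S2 S2 F (e z) = order z q"
    and "poly q z \<noteq> 0 \<Longrightarrow> poly (p - smult w q) z = 0 \<Longrightarrow>
      local_degree S2 S2 F (e z) = order z (p - smult w q)"
proof -
  have "v \<in> sphere 0 1 \<Longrightarrow> local_model S2 S2 F v k \<Longrightarrow> local_degree S2 S2 F v = k" for v k
    by (rule local_degree_eq) (use F_sphere topspace_S2 in auto)
  then show "local_degree S2 S2 F b = degree p - degree q"
    "poly q z = 0 \<Longrightarrow> local_degree S2 S2 F (e z) = order z q"
    "poly q z \<noteq> 0 \<Longrightarrow> poly (p - smult w q) z = 0 \<Longrightarrow>
      local_degree S2 S2 F (e z) = order z (p - smult w q)"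
    using local_model_infinity local_model_pole local_model_finite b eS by metis+
qed

lemma branched_cover_F: "branched_cover S2 S2 F"
proof -
  have "\<exists>k. local_model S2 S2 F v k" if "v \<in> topspace S2" for v
  proof -
    have "v \<in> sphere 0 1" using that topspace_S2 by simp
    then show ?thesis
    proof (cases rule: sphere_cases)
      case 1
      then show ?thesis using local_model_infinity by blast
    next
      case (2 z)
      show ?thesis
      proof (cases "poly q z = 0")
        case True
        then show ?thesis using 2 local_model_pole by blast
      next
        case False
        then have "poly (p - smult (poly p z / poly q z) q) z = 0" by simp
        then show ?thesis using 2 local_model_finite[OF False] by blast
      qed
    qed
  qed
  then show ?thesis
    unfolding branched_cover_def using continuous_map_if_local_model by blast
qed

lemma fibre_finite: "fibre S2 F (e w) = e ` {z. poly (p - smult w q) z = 0}"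
proof (intro equalityI subsetI)
  fix v assume "v \<in> fibre S2 F (e w)"
  then have v: "v \<in> sphere 0 1" "F v = e w" by (auto simp: fibre_def topspace_S2)
  from v(1) show "v \<in> e ` {z. poly (p - smult w q) z = 0}"
  proof (cases rule: sphere_cases)
    case 1
    then show ?thesis using v enb[of w] by (simp add: F_simps)
  next
    case (2 z)
    have "poly q z \<noteq> 0" using v(2) 2 enb[of w] F_simps(2)[of z] by auto
    then show ?thesis using v(2) 2 einj by (auto simp: F_simps)
  qed
next
  fix v assume "v \<in> e ` {z. poly (p - smult w q) z = 0}"
  then obtain z where z: "v = e z" "poly p z = w * poly q z" by auto
  then have "poly q z \<noteq> 0" using coprime[of z] by auto
  then show "v \<in> fibre S2 F (e w)" using z eS by (simp add: fibre_def topspace_S2 F_simps)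
qed

lemma fibre_infinity: "fibre S2 F b = insert b (e ` {z. poly q z = 0})"
proof (intro equalityI subsetI)
  fix v assume "v \<in> fibre S2 F b"
  then have v: "v \<in> sphere 0 1" "F v = b" by (auto simp: fibre_def topspace_S2)
  from v(1) show "v \<in> insert b (e ` {z. poly q z = 0})"
  proof (cases rule: sphere_cases)
    case (2 z)
    have "poly q z = 0" using v(2) 2 enb F_simps(3)[of z] by auto
    then show ?thesis using 2 by simp
  qed simp
next
  fix v assume "v \<in> insert b (e ` {z. poly q z = 0})"
  then show "v \<in> fibre S2 F b" using eS b by (auto simp: fibre_def topspace_S2 F_simps)
qed

lemma local_degrees_over_finite:
  "local_degrees_over S2 S2 F (e w) = root_orders (p - smult w q)"
proof -
  have "local_degree S2 S2 F (e z) = order z (p - smult w q)"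
    if "poly (p - smult w q) z = 0" for z
    using that coprime[of z] by (intro local_degree_simps(3)) auto
  moreover have "mset_set (fibre S2 F (e w)) = image_mset e (mset_set {z. poly (p - smult w q) z = 0})"
    unfolding fibre_finite using einj by (simp add: image_mset_mset_set inj_on_def)
  moreover have "finite {z. poly (p - smult w q) z = 0}"
    by (rule poly_roots_finite[OF pencil_nonzero])
  ultimately show ?thesis
    unfolding local_degrees_over_def root_orders_def
    by (auto simp del: poly_diff poly_smult simp: multiset.map_comp intro!: image_mset_cong)
qed

lemma local_degrees_over_infinity:
  "local_degrees_over S2 S2 F b = add_mset (degree p - degree q) (root_orders q)"
proof -
  have fin: "finite {z. poly q z = 0}" by (rule poly_roots_finite[OF qnz])
  have "b \<notin> e ` {z. poly q z = 0}" using enb by blast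
  then have "mset_set (fibre S2 F b) = add_mset b (image_mset e (mset_set {z. poly q z = 0}))"
    unfolding fibre_infinity using einj fin by (simp add: image_mset_mset_set inj_on_def)
  then show ?thesis
    unfolding local_degrees_over_def root_orders_def using fin
    by (auto simp: multiset.map_comp local_degree_simps intro!: image_mset_cong)
qed

lemma branching_iff:
  "y \<in> branching_points S2 S2 F \<longleftrightarrow>
     y \<in> sphere 0 1 \<and> (\<exists>k\<in>#local_degrees_over S2 S2 F y. k > 1)"
proof -
  have "finite (fibre S2 F y)" if "y \<in> sphere 0 1"
    using that
  proof (cases rule: sphere_cases)
    case 1
    then show ?thesis using poly_roots_finite[OF qnz] fibre_infinity by simp
  next
    case (2 z)
    then show ?thesis using poly_roots_finite[OF pencil_nonzero] fibre_finite by simp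
  qed
  then show ?thesis
    by (auto simp: branching_points_def local_degrees_over_def topspace_S2)
qed

theorem realizes_F:
  assumes c: "c \<noteq> 0"
    and count: "card {z. poly p z = 0} + card {z. poly (p - smult c q) z = 0} + card {z. poly q z = 0}
      \<le> degree p + 1"
    and branch: "\<exists>k\<in>#root_orders p. k > 1" "\<exists>k\<in>#root_orders (p - smult c q). k > 1"
      "\<exists>k\<in>#add_mset (degree p - degree q) (root_orders q). k > 1"
  shows "realizes S2 S2 (degree p)
    {# root_orders p, root_orders (p - smult c q), add_mset (degree p - degree q) (root_orders q) #} F"
proof -
  have cop: "\<And>z. poly p z = 0 \<Longrightarrow> poly q z \<noteq> 0" by (rule coprime)
  \<comment> \<open>Equality in the Mason-Stothers count excludes multiple roots over every finite
    value other than 0 and \<open>c\<close>.\<close>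
  have simple: "order z (p - smult w q) = 1"
    if "w \<noteq> 0" "w \<noteq> c" "poly (p - smult w q) z = 0" for w z
    using mason_stothers_count(2)[OF cop deg qnz c count that] .
  have p0: "root_orders p = local_degrees_over S2 S2 F (e 0)"
    using local_degrees_over_finite[of 0] by simp
  have B: "branching_points S2 S2 F = {e 0, e c, b}"
  proof (intro equalityI subsetI)
    fix y assume y: "y \<in> branching_points S2 S2 F"
    then have "y \<in> sphere 0 1" by (simp add: branching_iff)
    then show "y \<in> {e 0, e c, b}"
    proof (cases rule: sphere_cases)
      case (2 w)
      have "w = 0 \<or> w = c"
      proof (rule ccontr)
        assume "\<not> (w = 0 \<or> w = c)"
        moreover have "finite {z. poly (p - smult w q) z = 0}"
          by (rule poly_roots_finite[OF pencil_nonzero])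
        ultimately have "\<forall>k\<in>#local_degrees_over S2 S2 F y. k = 1"
          unfolding 2 local_degrees_over_finite root_orders_def using simple by auto
        then show False using y by (auto simp: branching_iff)
      qed
      then show ?thesis using 2 by auto
    qed simp
  next
    fix y assume "y \<in> {e 0, e c, b}"
    then show "y \<in> branching_points S2 S2 F"
      using branch eS b p0 local_degrees_over_finite[of c] local_degrees_over_infinity
      unfolding branching_iff by auto
  qed
  have "has_degree S2 S2 F (degree p)"
    unfolding has_degree_def
  proof
    fix y assume y: "y \<in> topspace S2 - branching_points S2 S2 F"
    then have "y \<in> sphere 0 1" by (simp add: topspace_S2)
    then show "finite (fibre S2 F y) \<and> card (fibre S2 F y) = degree p"
    proof (cases rule: sphere_cases)
      case 1
      then show ?thesis using y B by simp
    next
      case (2 w)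
      then have "w \<noteq> 0" "w \<noteq> c" using y B by auto
      then have "card {z. poly (p - smult w q) z = 0} = degree p"
        using simple_roots_card[OF pencil_nonzero, of w] simple[of w] pencil_degree by metis
      moreover have "inj e" using einj by (simp add: inj_on_def)
      ultimately show ?thesis
        unfolding 2 fibre_finite using poly_roots_finite[OF pencil_nonzero]
        by (metis card_image finite_imageI inj_on_subset subset_UNIV)
    qed
  qed
  moreover have "\<forall>y\<in>branching_points S2 S2 F. finite (fibre S2 F y)"
    unfolding B using poly_roots_finite[OF qnz] poly_roots_finite[OF pencil_nonzero]
    by (simp add: fibre_infinity fibre_finite del: poly_diff poly_smult diff_zero smult_0_left)
  moreover have "image_mset (local_degrees_over S2 S2 F) (mset_set (branching_points S2 S2 F)) =
      {# root_orders p, root_orders (p - smult c q), add_mset (degree p - degree q) (root_orders q) #}"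
  proof -
    have "e 0 \<noteq> e c" "b \<noteq> e 0" "b \<noteq> e c" using einj enb c by metis+
    then have "mset_set {e 0, e c, b} = {# e 0, e c, b #}" by simp
    then show ?thesis
      unfolding B using p0 local_degrees_over_finite[of c] local_degrees_over_infinity by simp
  qed
  ultimately show ?thesis
    unfolding realizes_def using branched_cover_F B by simp
qed

end

text \<open>The factor degrees bound the numbers of distinct roots of \<open>p\<close>,
  \<open>p - c q\<close> and \<open>q\<close> from above, and \<open>count\<close> makes their sum
  equal to the Mason-Stothers lower bound \<open>d + 1\<close>; so all three bounds are attained.
  The part \<open>m\<close> is the local degree at infinity. Two factors per polynomial suffice for
  the candidates, and an absent factor is replaced by 1.\<close>

theorem realizable_by_rational_map:
  fixes A1 A2 B1 B2 C1 C2 :: "complex poly"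
  assumes eq: "A1 ^ a1 * A2 ^ a2 - smult c (C1 ^ c1 * C2 ^ c2) = B1 ^ b1 * B2 ^ b2"
    and nz: "A1 \<noteq> 0" "A2 \<noteq> 0" "B1 \<noteq> 0" "B2 \<noteq> 0" "C1 \<noteq> 0" "C2 \<noteq> 0"
    and pos: "a1 \<ge> 1" "a2 \<ge> 1" "b1 \<ge> 1" "b2 \<ge> 1" "c1 \<ge> 1" "c2 \<ge> 1"
    and cop: "\<And>z. poly (A1 * A2) z = 0 \<Longrightarrow> poly (C1 * C2) z \<noteq> 0" and c: "c \<noteq> 0"
    and d: "degree A1 * a1 + degree A2 * a2 = d"
    and m: "degree C1 * c1 + degree C2 * c2 + m = d" "m \<ge> 1"
    and count: "degree A1 + degree A2 + degree B1 + degree B2 + degree C1 + degree C2 = d + 1"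
    and \<alpha>: "\<alpha> = replicate_mset (degree A1) a1 + replicate_mset (degree A2) a2"
    and \<beta>: "\<beta> = replicate_mset (degree B1) b1 + replicate_mset (degree B2) b2"
    and \<gamma>: "\<gamma> = add_mset m (replicate_mset (degree C1) c1 + replicate_mset (degree C2) c2)"
    and branch: "\<exists>k\<in>#\<alpha>. k > 1" "\<exists>k\<in>#\<beta>. k > 1" "\<exists>k\<in>#\<gamma>. k > 1"
  shows "sphere_realizable d {# \<alpha>, \<beta>, \<gamma> #}"
proof -
  define p q where "p = A1 ^ a1 * A2 ^ a2" and "q = C1 ^ c1 * C2 ^ c2"
  let ?r = "p - smult c q"
  have r: "?r = B1 ^ b1 * B2 ^ b2" using eq by (simp add: p_def q_def)
  have degp: "degree p = d" and degq: "degree q + m = d"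
    using nz d m by (simp_all add: p_def q_def degree_mult_eq degree_power_eq mult.commute)
  have deg: "degree q < degree p" using degp degq m(2) by linarith
  have degr: "degree ?r = d"
    unfolding diff_conv_add_uminus using deg degp by (subst degree_add_eq_left) auto
  have qnz: "q \<noteq> 0" using nz by (simp add: q_def)
  have cop': "poly q z \<noteq> 0" if "poly p z = 0" for z
    using cop[of z] that by (auto simp: p_def q_def)
  have le: "card {z. poly (A ^ a * B ^ b) z = 0} \<le> degree A + degree B"
    if "A \<noteq> 0" "B \<noteq> 0" for A B :: "complex poly" and a b
  proof -
    have "{z. poly (A ^ a * B ^ b) z = 0} \<subseteq> {z. poly A z = 0} \<union> {z. poly B z = 0}" by auto
    then have "card {z. poly (A ^ a * B ^ b) z = 0} \<le> card ({z. poly A z = 0} \<union> {z. poly B z = 0})"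
      using that by (intro card_mono) (auto simp: poly_roots_finite)
    also have "\<dots> \<le> card {z. poly A z = 0} + card {z. poly B z = 0}" by (rule card_Un_le)
    also have "\<dots> \<le> degree A + degree B"
      using that by (intro add_mono card_poly_roots_bound)
    finally show ?thesis .
  qed
  have "card {z. poly p z = 0} \<le> degree A1 + degree A2"
    "card {z. poly ?r z = 0} \<le> degree B1 + degree B2"
    "card {z. poly q z = 0} \<le> degree C1 + degree C2"
    unfolding r unfolding p_def q_def by (rule le; rule nz)+
  moreover have "d + 1 \<le> card {z. poly p z = 0} + card {z. poly ?r z = 0} + card {z. poly q z = 0}"
    using mason_stothers_count(1)[OF cop' deg qnz c] degp by simp
  ultimately have le': "degree A1 + degree A2 \<le> card {z. poly p z = 0}"
    "degree B1 + degree B2 \<le> card {z. poly ?r z = 0}"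
    "degree C1 + degree C2 \<le> card {z. poly q z = 0}"
    and N: "card {z. poly p z = 0} + card {z. poly ?r z = 0} + card {z. poly q z = 0} \<le> degree p + 1"
    using count degp by linarith+
  have m': "degree p - degree q = m" using degp degq by simp
  have o: "root_orders p = \<alpha>" "root_orders ?r = \<beta>" "add_mset (degree p - degree q) (root_orders q) = \<gamma>"
    using root_orders_power_mult[OF p_def pos(1,2) nz(1,2) le'(1)]
      root_orders_power_mult[OF r pos(3,4) nz(3,4) le'(2)]
      root_orders_power_mult[OF q_def pos(5,6) nz(5,6) le'(3)] \<alpha> \<beta> \<gamma> m' by simp_all
  obtain b :: "real^3" where b: "b \<in> sphere 0 1"
    using vector_choose_size[of 1] by (metis mem_sphere_0 zero_le_one)
  obtain h e where h: "homeomorphism (sphere 0 1 - {b}) (UNIV :: complex set) h e"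
    by (rule sphere_chart[OF b]) (rule that)
  interpret rational_sphere_map b h e p q
    using b h cop' deg qnz by unfold_locales
  have "degree B1 * b1 + degree B2 * b2 = d"
    using degr nz unfolding r by (simp add: degree_mult_eq degree_power_eq mult.commute)
  then have part: "is_partition d \<alpha>" "is_partition d \<beta>" "is_partition d \<gamma>"
    using d m pos by (auto simp: is_partition_def \<alpha> \<beta> \<gamma> in_replicate_mset)
  have "d \<ge> 2"
  proof -
    obtain k where "k \<in># \<alpha>" "k > 1" using branch(1) by blast
    then have "k \<le> sum_mset \<alpha>" by (metis le_add1 mset_add sum_mset.add_mset)
    then show ?thesis using part(1) \<open>k > 1\<close> by (simp add: is_partition_def)
  qed
  \<comment> \<open>The part \<open>m\<close> adds 1 to \<open>count\<close>. A total length of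
    \<open>d + 2\<close> is the Riemann-Hurwitz condition for three partitions on the
    sphere.\<close>
  have "int (size \<alpha>) + int (size \<beta>) + int (size \<gamma>) = int d + 2"
    using count by (simp add: \<alpha> \<beta> \<gamma>)
  then have "sphere_candidate d {# \<alpha>, \<beta>, \<gamma> #}"
    using \<open>d \<ge> 2\<close> part by (simp add: sphere_candidate_def riemann_hurwitz_def)
  then show ?thesis
    using realizes_F[OF c N] branch degp unfolding o sphere_realizable_def by blast
qed

section \<open>The realizable candidates\<close>

text \<open>The maps for degrees 8, 12, 12 and 24 are the \<open>j\<close>-invariants of \<open>X\<^sub>0(7)\<close>, \<open>X\<^sub>0(8)\<close>,
  \<open>X\<^sub>0(9)\<close> and \<open>X\<^sub>1(7)\<close>, with branching value 1728. The others come from comparing coefficients,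
  using that \<open>p\<close> agrees with a square up to a polynomial of degree \<open>degree q\<close> (times a linear
  factor in degree 9).\<close>

lemma poly_no_common_root:
  fixes A B :: "'a::comm_ring_1 poly"
  assumes "U * A + V * B = 1" "poly A z = 0"
  shows "poly B z \<noteq> 0"
proof
  assume "poly B z = 0"
  then have "poly (U * A + V * B) z = 0" using assms(2) by simp
  then show False using assms(1) by simp
qed

text \<open>The square of X^3 + 2 X^2 + 8 X - 16 has no terms of degree 3 and 2, so it is X^4 times
  a quadratic plus the linear remainder -256 (X - 1).\<close>

lemma realizable_6: "sphere_realizable 6 {# {#4, 1, 1#}, replicate_mset 3 2, {#5, 1#} #}"
proof (rule realizable_by_rational_map[of "[:0, 1:]" 4 "[:20, 4, 1:]" 1 256 "[:-1, 1:]" 1 1 1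
      "[:-16, 8, 2, 1:]" 2 1 1 _ 5])
  show "poly ([:-1, 1:] * 1) z \<noteq> 0" if "poly ([:0, 1:] * [:20, 4, 1:]) z = 0" for z :: complex
    \<comment> \<open>\<open>[:1/25:]\<close> and \<open>[:-1/5, -1/25:]\<close> are Bezout
      cofactors for X^2 + 4 X + 20 and X - 1; the root 0 is checked directly. The cofactors in the
      later instances are of the same kind.\<close>
    using that poly_no_common_root[of "[:1/25:]" "[:20, 4, 1:]" "[:-1/5, -1/25:]" "[:-1, 1:]" z]
    by (auto simp del: poly_pCons) simp_all
qed (simp_all add: eval_nat_numeral)

lemma realizable_8: "sphere_realizable 8 {# {#3, 3, 1, 1#}, replicate_mset 4 2, {#7, 1#} #}"
proof (rule realizable_by_rational_map[of "[:1, 5, 1:]" 3 "[:49, 13, 1:]" 1 1728 "[:0, 1:]" 1 1 1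
      "[:-7, 70, 63, 14, 1:]" 2 1 1 _ 7])
  show "poly ([:0, 1:] * 1) z \<noteq> 0" if "poly ([:1, 5, 1:] * [:49, 13, 1:]) z = 0" for z :: complex
    using that by auto
qed (simp_all add: eval_nat_numeral)

text \<open>The cube and X times the square agree from degree 9 down to degree 3. Their quadratic
  difference is taken as \<open>q\<close> itself, so the branching value is 1.\<close>

lemma realizable_9:
  "sphere_realizable 9 {# replicate_mset 3 3, replicate_mset 4 2 + {#1#}, {#7, 1, 1#} #}"
proof (rule realizable_by_rational_map[of "[:6, 10, 4, 1:]" 3 1 1 1 "[:216, 351/4, 27:]" 1 1 1
      "[:63/2, 35, 21, 6, 1:]" 2 "[:0, 1:]" 1 _ 7])
  show "poly ([:216, 351/4, 27:] * 1) z \<noteq> 0" if "poly ([:6, 10, 4, 1:] * 1) z = 0" for z :: complex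
    using that poly_no_common_root[of "[:13/14, 2/7:]" "[:6, 10, 4, 1:]"
        "[:-4/189, -8/189, -2/189:]" "[:216, 351/4, 27:]" z] by simp
qed (simp_all add: eval_nat_numeral)

lemma realizable_10:
  "sphere_realizable 10 {# {#3, 3, 3, 1#}, replicate_mset 5 2, {#8, 1, 1#} #}"
proof (rule realizable_by_rational_map[of "[:12, 15, 6, 1:]" 3 "[:0, 1:]" 1 1
      "[:-729/4, -189/2, -81/4:]" 1 1 1 "[:27/2, 135/2, 72, 36, 9, 1:]" 2 1 1 _ 8])
  show "poly ([:-729/4, -189/2, -81/4:] * 1) z \<noteq> 0"
    if "poly ([:12, 15, 6, 1:] * [:0, 1:]) z = 0" for z :: complex
  proof (cases "z = 0")
    case False
    then have "poly [:12, 15, 6, 1:] z = 0" using that by simp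
    then have "poly [:-729/4, -189/2, -81/4:] z \<noteq> 0"
      by (intro poly_no_common_root[of "[:7/3, 1/2:]" "[:12, 15, 6, 1:]"
          "[:4/27, 4/27, 2/81:]" "[:-729/4, -189/2, -81/4:]" z]) simp_all
    then show ?thesis by simp
  qed simp
qed (simp_all add: eval_nat_numeral)

lemma realizable_12:
  "sphere_realizable 12 {# replicate_mset 4 3, replicate_mset 6 2, {#8, 2, 1, 1#} #}"
proof (rule realizable_by_rational_map[of "[:16, 0, -16, 0, 1:]" 3 1 1 1728 "[:0, 1:]" 2
      "[:-16, 0, 1:]" 1 "[:64, 0, 120, 0, -24, 0, 1:]" 2 1 1 _ 8])
  show "poly ([:0, 1:] * [:-16, 0, 1:]) z \<noteq> 0"
    if "poly ([:16, 0, -16, 0, 1:] * 1) z = 0" for z :: complex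
    using that poly_no_common_root[of "[:1/16:]" "[:16, 0, -16, 0, 1:]"
        "[:0, 0, -1/16:]" "[:-16, 0, 1:]" z] by auto
qed (simp_all add: eval_nat_numeral)

lemma realizable_12':
  "sphere_realizable 12 {# replicate_mset 4 3, replicate_mset 6 2, {#9, 1, 1, 1#} #}"
proof (rule realizable_by_rational_map[of "[:9, 84, 54, 12, 1:]" 3 1 1 1728 "[:0, 1:]" 1
      "[:27, 9, 1:]" 1 "[:-27, 486, 891, 504, 135, 18, 1:]" 2 1 1 _ 9])
  show "poly ([:0, 1:] * [:27, 9, 1:]) z \<noteq> 0"
    if "poly ([:9, 84, 54, 12, 1:] * 1) z = 0" for z :: complex
    using that poly_no_common_root[of "[:-2/9, -1/27:]" "[:9, 84, 54, 12, 1:]"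
        "[:1/9, 2/3, 1/3, 1/27:]" "[:27, 9, 1:]" z] by auto
qed (simp_all add: eval_nat_numeral)

text \<open>This is c4^3 - c6^2 = 1728 Delta for the Tate normal form of an elliptic curve with a
  point of order 7, where Delta = t^7 (t - 1)^7 (t^3 - 8 t^2 + 5 t + 1). The pole orders of j are
  the cusp widths.\<close>

lemma realizable_24:
  "sphere_realizable 24 {# replicate_mset 8 3, replicate_mset 12 2, {#7, 7, 7, 1, 1, 1#} #}"
proof (rule realizable_by_rational_map[of "[:1, 4, -14, 0, 35, -56, 42, -12, 1:]" 3 1 1 1728
      "[:0, -1, 1:]" 7 "[:1, 5, -8, 1:]" 1
      "[:1, 6, -15, -46, 174, -222, 273, -486, 570, -354, 117, -18, 1:]" 2 1 1 _ 7])
  show "poly ([:0, -1, 1:] * [:1, 5, -8, 1:]) z \<noteq> 0"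
    if "poly ([:1, 4, -14, 0, 35, -56, 42, -12, 1:] * 1) z = 0" for z :: complex
  proof -
    have "poly [:1, 5, -8, 1:] z \<noteq> 0"
      using that by (intro poly_no_common_root[of "[:1710/49, 3005/49, -444/49:]"
            "[:1, 4, -14, 0, 35, -56, 42, -12, 1:]"
            "[:-1661/49, -220/7, 968/7, -99/7, -979/7, 1790/7, -683/7, 444/49:]"]) simp_all
    moreover have "z \<noteq> 0" "z \<noteq> 1" using that by auto
    moreover have "poly [:0, -1, 1:] z = z * (z - 1)" by (simp add: algebra_simps)
    ultimately show ?thesis by (simp only: poly_mult mult_eq_0_iff) simp
  qed
qed (simp_all add: eval_nat_numeral)

section \<open>Sections over slit planes\<close>

lemma finite_separated:
  assumes "finite (Z :: 'a::metric_space set)"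
  obtains r where "r > 0" "\<And>x x'. x \<in> Z \<Longrightarrow> x' \<in> Z \<Longrightarrow> x \<noteq> x' \<Longrightarrow> ball x r \<inter> ball x' r = {}"
proof -
  define D where "D = (\<lambda>(x, x'). dist x x') ` {(x, x') \<in> Z \<times> Z. x \<noteq> x'}"
  have "finite D" unfolding D_def using assms
    by (intro finite_imageI) (auto intro: finite_subset[of _ "Z \<times> Z"])
  \<comment> \<open>The element 2 keeps the set nonempty when \<open>Z\<close> has at most one
    point.\<close>
  then have fin: "finite (insert 2 D)" by simp
  have pos: "Min (insert 2 D) > 0" using fin by (subst Min_gr_iff) (auto simp: D_def)
  have "Min (insert 2 D) \<le> dist x x'" if "x \<in> Z" "x' \<in> Z" "x \<noteq> x'" for x x'
    by (rule Min_le[OF fin]) (use that in \<open>auto simp: D_def image_iff\<close>)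
  then show thesis using pos
    by (intro that[of "Min (insert 2 D) / 2"]) (auto intro!: disjoint_ballI)
qed

text \<open>The d points over \<open>y\<close> have disjoint neighbourhoods \<open>V x\<close> on
  which \<open>p\<close> is injective. Over the intersection \<open>T\<close> of their images each
  \<open>V x\<close> contains one preimage; as every fibre has d points, there are no others and
  \<open>T\<close> is evenly covered. Constancy of the fibre size does the work of
  properness.\<close>

lemma covering_space_if_card_fibres:
  fixes p :: "'a::metric_space \<Rightarrow> 'b::t2_space"
  assumes cont: "continuous_on X p" and im: "p ` X \<subseteq> S" and d: "d > 0"
    and loc: "\<And>x. x \<in> X \<Longrightarrow> \<exists>U q. x \<in> U \<and> openin (top_of_set X) U \<and>
      openin (top_of_set S) (p ` U) \<and> homeomorphism U (p ` U) p q"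
    and card: "\<And>y. y \<in> S \<Longrightarrow> finite {x \<in> X. p x = y} \<and> card {x \<in> X. p x = y} = d"
  shows "covering_space X p S"
proof
  show "continuous_on X p" by (rule cont)
  show "p ` X = S"
  proof (intro equalityI subsetI)
    fix y assume "y \<in> S"
    then have "{x \<in> X. p x = y} \<noteq> {}" using card[of y] d by (metis card.empty less_irrefl)
    then show "y \<in> p ` X" by auto
  qed (use im in auto)
  fix y assume y: "y \<in> S"
  define Z where "Z = {x \<in> X. p x = y}"
  have finZ: "finite Z" and cardZ: "card Z = d" using card[OF y] by (simp_all add: Z_def)
  have Zne: "Z \<noteq> {}" using cardZ d by auto
  obtain r where r: "r > 0" "\<And>x x'. x \<in> Z \<Longrightarrow> x' \<in> Z \<Longrightarrow> x \<noteq> x' \<Longrightarrow> ball x r \<inter> ball x' r = {}"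
    by (rule finite_separated[OF finZ]) (rule that)
  have "\<forall>x\<in>Z. \<exists>U q. x \<in> U \<and> openin (top_of_set X) U \<and>
      openin (top_of_set S) (p ` U) \<and> homeomorphism U (p ` U) p q"
    using loc by (auto simp: Z_def)
  then obtain U q where U: "\<And>x. x \<in> Z \<Longrightarrow> x \<in> U x" "\<And>x. x \<in> Z \<Longrightarrow> openin (top_of_set X) (U x)"
    "\<And>x. x \<in> Z \<Longrightarrow> openin (top_of_set S) (p ` U x)"
    "\<And>x. x \<in> Z \<Longrightarrow> homeomorphism (U x) (p ` U x) p (q x)"
    by metis
  define V where "V x = U x \<inter> ball x r" for x
  have V: "x \<in> V x" "openin (top_of_set X) (V x)" "V x \<subseteq> U x" if "x \<in> Z" for x
    using U(1,2)[OF that] r(1) by (auto simp: V_def openin_Int_open)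
  have disjV: "V x \<inter> V x' = {}" if "x \<in> Z" "x' \<in> Z" "x \<noteq> x'" for x x'
    using r(2)[OF that] by (auto simp: V_def)
  have pV: "openin (top_of_set S) (p ` V x)" if x: "x \<in> Z" for x
  proof -
    have "openin (top_of_set (U x)) (V x)"
      by (simp add: V_def openin_open_Int)
    then have "openin (top_of_set (p ` U x)) (p ` V x)"
      by (rule homeomorphism_imp_open_map[OF U(4)[OF x]])
    then show ?thesis using U(3)[OF x] openin_trans by blast
  qed
  define T where "T = \<Inter> ((\<lambda>x. p ` V x) ` Z)"
  have T: "openin (top_of_set S) T"
    unfolding T_def using finZ Zne pV by (intro openin_Inter) auto
  have yT: "y \<in> T"
  proof -
    have "y \<in> p ` V x" if "x \<in> Z" for x
      using that V(1)[OF that] by (auto simp: Z_def)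
    then show ?thesis by (auto simp: T_def)
  qed
  have inj: "x1 = x2" if "x \<in> Z" "x1 \<in> V x" "x2 \<in> V x" "p x1 = p x2" for x x1 x2
    using U(4)[OF that(1)] V(3)[OF that(1)] that(2-4) unfolding homeomorphism_def by (metis subsetD)
  have VX: "V x \<subseteq> X" if "x \<in> Z" for x using openin_imp_subset[OF V(2)[OF that]] .
  have cover: "\<exists>x\<in>Z. u \<in> V x" if u: "u \<in> X" "p u \<in> T" for u
  proof -
    have "\<forall>x\<in>Z. \<exists>v. v \<in> V x \<and> p v = p u"
    proof
      fix x assume "x \<in> Z"
      then have "p u \<in> p ` V x" using u(2) by (auto simp: T_def)
      then show "\<exists>v. v \<in> V x \<and> p v = p u" by (metis imageE)
    qed
    then obtain v where v: "\<And>x. x \<in> Z \<Longrightarrow> v x \<in> V x" "\<And>x. x \<in> Z \<Longrightarrow> p (v x) = p u" by metis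
    have pu: "p u \<in> S" using im u(1) by auto
    have "inj_on v Z"
    proof (rule inj_onI, rule ccontr)
      fix x x' assume "x \<in> Z" "x' \<in> Z" "v x = v x'" "x \<noteq> x'"
      then show False using disjV[of x x'] v(1)[of x] v(1)[of x'] by auto
    qed
    then have "card (v ` Z) = d" using cardZ by (simp add: card_image)
    moreover have "v ` Z \<subseteq> {x \<in> X. p x = p u}" using v VX by blast
    ultimately have "v ` Z = {x \<in> X. p x = p u}"
      using card[OF pu] by (intro card_subset_eq) auto
    then have "u \<in> v ` Z" using u(1) by simp
    then show ?thesis using v(1) by blast
  qed
  show "\<exists>T. y \<in> T \<and> openin (top_of_set S) T \<and>
      (\<exists>v. \<Union>v = X \<inter> p -` T \<and> (\<forall>u\<in>v. openin (top_of_set X) u) \<and> pairwise disjnt v \<and>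
        (\<forall>u\<in>v. \<exists>q. homeomorphism u T p q))"
  proof (intro exI[of _ T] conjI yT T exI[of _ "(\<lambda>x. V x \<inter> p -` T) ` Z"])
    show "\<Union> ((\<lambda>x. V x \<inter> p -` T) ` Z) = X \<inter> p -` T"
    proof (intro equalityI subsetI)
      fix u assume "u \<in> X \<inter> p -` T"
      then obtain x where "x \<in> Z" "u \<in> V x" using cover[of u] by auto
      then show "u \<in> \<Union> ((\<lambda>x. V x \<inter> p -` T) ` Z)" using \<open>u \<in> X \<inter> p -` T\<close> by auto
    next
      fix u assume "u \<in> \<Union> ((\<lambda>x. V x \<inter> p -` T) ` Z)"
      then obtain x where "x \<in> Z" "u \<in> V x" "u \<in> p -` T" by auto
      then show "u \<in> X \<inter> p -` T" using VX by auto
    qed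
    show "\<forall>u\<in>(\<lambda>x. V x \<inter> p -` T) ` Z. openin (top_of_set X) u"
    proof
      fix u assume "u \<in> (\<lambda>x. V x \<inter> p -` T) ` Z"
      then obtain x where x: "x \<in> Z" "u = V x \<inter> p -` T" by auto
      have "openin (top_of_set X) (X \<inter> p -` T)"
        by (rule continuous_openin_preimage[OF cont _ T]) (use im in auto)
      then have "openin (top_of_set X) (V x \<inter> (X \<inter> p -` T))"
        by (rule openin_Int[OF V(2)[OF x(1)]])
      moreover have "V x \<inter> (X \<inter> p -` T) = u" using x VX by auto
      ultimately show "openin (top_of_set X) u" by simp
    qed
    show "pairwise disjnt ((\<lambda>x. V x \<inter> p -` T) ` Z)"
    proof (rule pairwise_imageI)
      fix x x' assume "x \<in> Z" "x' \<in> Z" "x \<noteq> x'"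
      then show "disjnt (V x \<inter> p -` T) (V x' \<inter> p -` T)"
        using disjV by (auto simp: disjnt_def)
    qed
    show "\<forall>u\<in>(\<lambda>x. V x \<inter> p -` T) ` Z. \<exists>q. homeomorphism u T p q"
    proof
      fix u assume "u \<in> (\<lambda>x. V x \<inter> p -` T) ` Z"
      then obtain x where x: "x \<in> Z" "u = V x \<inter> p -` T" by auto
      have "T \<subseteq> p ` V x" using x(1) by (auto simp: T_def)
      then have "p ` u = T" unfolding x(2) by blast
      moreover have "T \<subseteq> p ` U x" using \<open>T \<subseteq> p ` V x\<close> V(3)[OF x(1)] by blast
      moreover have "u \<subseteq> U x" using x V(3)[OF x(1)] by auto
      ultimately have "homeomorphism u T p (q x)"
        using homeomorphism_of_subsets[OF U(4)[OF x(1)]] by blast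
      then show "\<exists>q. homeomorphism u T p q" by blast
    qed
  qed
qed

lemma connected_subset_openin:
  assumes "connected E" "E \<subseteq> X" "openin (top_of_set X) A" "openin (top_of_set X) B"
    "E \<subseteq> A \<union> B" "A \<inter> B = {}"
  shows "E \<subseteq> A \<or> E \<subseteq> B"
proof -
  obtain A' B' where "open A'" "A = X \<inter> A'" "open B'" "B = X \<inter> B'"
    using assms(3,4) unfolding openin_open by blast
  then have "A' \<inter> E = {} \<or> B' \<inter> E = {}"
    using connectedD[OF assms(1), of A' B'] assms(2,5,6) by blast
  then show ?thesis
    using assms(2,5) \<open>A = X \<inter> A'\<close> \<open>B = X \<inter> B'\<close> by blast
qed

section \<open>Half-planes and slit planes\<close>

definition upper :: "complex set" where "upper = {z. Im z > 0}"
definition lower :: "complex set" where "lower = {z. Im z < 0}"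

text \<open>The planes are named after the rays that they lose. Each keeps one of the three segments
  cut out by 0 and 1: \<open>slit_left\<close> the one right of 1, \<open>slit_right\<close> the one
  left of 0, \<open>slit_both\<close> the one in between.\<close>

definition slit_left :: "complex set" where "slit_left = - (complex_of_real ` {..1})"
definition slit_right :: "complex set" where "slit_right = - (complex_of_real ` {0..})"
definition slit_both :: "complex set" where "slit_both = - (complex_of_real ` ({..0} \<union> {1..}))"

definition slits :: "complex set set" where "slits = {slit_left, slit_right, slit_both}"

lemma in_of_real_image: "z \<in> complex_of_real ` A \<longleftrightarrow> Im z = 0 \<and> Re z \<in> A"
  by (auto simp: complex_eq_iff image_iff)

lemma slits_mem:
  "z \<in> slit_left \<longleftrightarrow> Im z \<noteq> 0 \<or> Re z > 1"
  "z \<in> slit_right \<longleftrightarrow> Im z \<noteq> 0 \<or> Re z < 0"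
  "z \<in> slit_both \<longleftrightarrow> Im z \<noteq> 0 \<or> 0 < Re z \<and> Re z < 1"
  by (auto simp: slit_left_def slit_right_def slit_both_def in_of_real_image)

lemma
  assumes "D \<in> slits"
  shows slits_open: "open D"
    and slits_simply_connected: "simply_connected D"
    and slits_halves: "upper \<subseteq> D" "lower \<subseteq> D"
    and slits_punctured: "D \<subseteq> - {0, 1}"
proof -
  have "closed (complex_of_real ` A)" if "closed A" for A :: "real set"
    using that by (rule closed_injective_linear_image) (auto simp: linear_iff inj_on_def scaleR_conv_of_real)
  then show "open D"
    using assms unfolding slits_def slit_left_def slit_right_def slit_both_def
    by (auto intro!: open_Compl closed_Un simp: image_Un)
  show "simply_connected D"
    using assms unfolding slits_def slit_left_def slit_right_def slit_both_def
    using simply_connected_slotted_complex_plane_left simply_connected_slotted_complex_plane_right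
      simply_connected_doubly_slotted_complex_plane[of 0 1] by auto
  show "upper \<subseteq> D" "lower \<subseteq> D" "D \<subseteq> - {0, 1}"
    using assms by (auto simp: slits_def slits_mem upper_def lower_def)
qed

lemma slits_Int:
  assumes "D \<in> slits" "D' \<in> slits" "D \<noteq> D'"
  shows "D \<inter> D' = upper \<union> lower"
proof -
  have "z \<in> D \<inter> D' \<longleftrightarrow> z \<in> upper \<union> lower" for z
    using assms unfolding slits_def
    by (elim insertE emptyE; simp add: slits_mem upper_def lower_def; linarith)
  then show ?thesis by blast
qed

lemma slits_Union: "\<Union>slits = - {0, 1}"
proof -
  have "z \<in> \<Union>slits \<longleftrightarrow> z \<in> - {0, 1}" for z
  proof -
    have "z \<in> \<Union>slits \<longleftrightarrow> Im z \<noteq> 0 \<or> Re z \<noteq> 0 \<and> Re z \<noteq> 1"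
      unfolding slits_def by (auto simp: slits_mem)
    then show ?thesis by (auto simp: complex_eq_iff)
  qed
  then show ?thesis by blast
qed

lemma halves_connected: "connected upper" "connected lower"
proof -
  show "connected upper" "connected lower"
    unfolding upper_def lower_def
    using convex_halfspace_Im_gt convex_halfspace_Im_lt by (blast intro: convex_connected)+
qed

lemma halves_mem: "\<i> \<in> upper" "- \<i> \<in> lower"
  by (simp_all add: upper_def lower_def)

section \<open>Lifts and sheets of a cover of the twice-punctured plane\<close>

locale punctured_plane_cover =
  fixes X :: "'a::real_normed_vector set" and p :: "'a \<Rightarrow> complex"
  assumes cov: "covering_space X p (- {0, 1})"
begin

text \<open>A lift of the identity of \<open>D\<close>, available because \<open>D\<close> is simply
  connected. The base point \<open>a\<close> may lie over any point of \<open>D\<close>, so a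
  section can be restarted elsewhere.\<close>

definition sec :: "complex set \<Rightarrow> 'a \<Rightarrow> complex \<Rightarrow> 'a" where
  "sec D a = (SOME s. continuous_on D s \<and> s ` D \<subseteq> X \<and> s (p a) = a \<and> (\<forall>z\<in>D. p (s z) = z))"

lemma sec:
  assumes D: "D \<in> slits" and a: "a \<in> X" "p a \<in> D"
  shows sec_continuous: "continuous_on D (sec D a)"
    and sec_in: "z \<in> D \<Longrightarrow> sec D a z \<in> X"
    and sec_base: "sec D a (p a) = a"
    and sec_section: "z \<in> D \<Longrightarrow> p (sec D a z) = z"
proof -
  have "\<exists>s. continuous_on D s \<and> s ` D \<subseteq> X \<and> s (p a) = a \<and> (\<forall>z\<in>D. p (s z) = z)"
  proof -
    have "locally path_connected D"
      using slits_open[OF D] open_imp_locally_path_connected by blast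
    moreover have "(\<lambda>z. z) \<in> D \<rightarrow> - {0, 1}" using slits_punctured[OF D] by auto
    ultimately obtain s where "continuous_on D s" "s \<in> D \<rightarrow> X" "s (p a) = a"
      "\<And>z. z \<in> D \<Longrightarrow> p (s z) = z"
      using covering_space_lift_strong[OF cov a(1,2) slits_simply_connected[OF D], of "\<lambda>z. z"]
      by auto
    then show ?thesis by blast
  qed
  then have "continuous_on D (sec D a) \<and> sec D a ` D \<subseteq> X \<and> sec D a (p a) = a \<and>
      (\<forall>z\<in>D. p (sec D a z) = z)"
    unfolding sec_def by (rule someI_ex)
  then show "continuous_on D (sec D a)" "z \<in> D \<Longrightarrow> sec D a z \<in> X" "sec D a (p a) = a"
    "z \<in> D \<Longrightarrow> p (sec D a z) = z" by auto
qed

lemma sec_unique: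
  assumes D: "D \<in> slits" "a \<in> X" "p a \<in> D" and D': "D' \<in> slits" "b \<in> X" "p b \<in> D'"
    and T: "connected T" "T \<subseteq> D" "T \<subseteq> D'" and t: "t \<in> T" "sec D a t = sec D' b t" and z: "z \<in> T"
  shows "sec D a z = sec D' b z"
proof (rule covering_space_lift_unique[OF cov, where f = "\<lambda>z. z" and a = t and T = T])
  show "continuous_on T (sec D a)" "continuous_on T (sec D' b)"
    using sec_continuous[OF D] sec_continuous[OF D'] T continuous_on_subset by blast+
  show "(\<lambda>z. z) \<in> T \<rightarrow> - {0, 1}" using T(2) slits_punctured[OF D(1)] by auto
  show "sec D a \<in> T \<rightarrow> X" "sec D' b \<in> T \<rightarrow> X"
    using sec_in[OF D] sec_in[OF D'] T by auto
  show "z = p (sec D a z)" if "z \<in> T" for z using sec_section[OF D] that T by auto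
  show "z = p (sec D' b z)" if "z \<in> T" for z using sec_section[OF D'] that T by auto
qed (use t T z in auto)

definition P :: "'a set" where "P = {x \<in> X. p x = \<i>}"
definition M :: "'a set" where "M = {x \<in> X. p x = - \<i>}"

lemma base_slits:
  assumes "D \<in> slits"
  shows "\<i> \<in> D" "- \<i> \<in> D" "connected D"
  using slits_halves[OF assms] halves_mem simply_connected_imp_connected[OF slits_simply_connected[OF assms]]
  by auto

lemma P_facts:
  assumes "D \<in> slits" "a \<in> P"
  shows "a \<in> X" "p a \<in> D" "p a = \<i>" "sec D a \<i> = a"
proof -
  show 1: "a \<in> X" "p a = \<i>" using assms by (auto simp: P_def)
  then show 2: "p a \<in> D" using base_slits[OF assms(1)] by simp
  show "sec D a \<i> = a" using sec_base[OF assms(1) 1(1) 2] 1(2) by simp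
qed

lemma sec_eq_upper:
  assumes D: "D \<in> slits" "a \<in> P" and D': "D' \<in> slits" "b \<in> P"
    and t: "t \<in> upper" "sec D a t = sec D' b t"
  shows "a = b"
proof -
  have "sec D a \<i> = sec D' b \<i>"
    by (rule sec_unique[OF D(1) P_facts(1,2)[OF D] D'(1) P_facts(1,2)[OF D'] halves_connected(1) _ _ t(1,2)])
      (use slits_halves D D' halves_mem in auto)
  then show ?thesis using P_facts(4)[OF D] P_facts(4)[OF D'] by simp
qed

lemma sec_upper:
  assumes D: "D \<in> slits" and D': "D' \<in> slits" and a: "a \<in> P" and t: "t \<in> upper"
  shows "sec D a t = sec D' a t"
  by (rule sec_unique[OF D P_facts(1,2)[OF D a] D' P_facts(1,2)[OF D' a] halves_connected(1),
        where t = \<i>])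
    (use slits_halves D D' halves_mem t P_facts(4)[OF D a] P_facts(4)[OF D' a] in auto)

lemma sec_eq_lower:
  assumes D: "D \<in> slits" "a \<in> P" and D': "D' \<in> slits" "b \<in> P"
    and t: "t \<in> lower" "sec D a t = sec D' b t" and u: "u \<in> lower"
  shows "sec D a u = sec D' b u"
  by (rule sec_unique[OF D(1) P_facts(1,2)[OF D] D'(1) P_facts(1,2)[OF D'] halves_connected(2) _ _ t(1,2)])
    (use slits_halves D D' u in auto)

text \<open>Transport from the fibre over i to the fibre over -i through the one real segment that
  \<open>D\<close> keeps.\<close>

definition \<beta> :: "complex set \<Rightarrow> 'a \<Rightarrow> 'a" where "\<beta> D a = sec D a (- \<i>)"

lemma \<beta>_bij:
  assumes D: "D \<in> slits"
  shows "bij_betw (\<beta> D) P M"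
proof (rule bij_betw_imageI)
  show "inj_on (\<beta> D) P"
  proof (rule inj_onI)
    fix a b assume a: "a \<in> P" and b: "b \<in> P" and "\<beta> D a = \<beta> D b"
    then have eq: "sec D a (- \<i>) = sec D b (- \<i>)" by (simp add: \<beta>_def)
    have "sec D a \<i> = sec D b \<i>"
      by (rule sec_unique[OF D P_facts(1,2)[OF D a] D P_facts(1,2)[OF D b] base_slits(3)[OF D] _ _ _ eq])
        (use base_slits[OF D] in auto)
    then show "a = b" using P_facts(4)[OF D a] P_facts(4)[OF D b] by simp
  qed
  show "\<beta> D ` P = M"
  proof (intro equalityI subsetI)
    fix y assume "y \<in> \<beta> D ` P"
    then obtain a where a: "a \<in> P" "y = sec D a (- \<i>)" by (auto simp: \<beta>_def)
    then show "y \<in> M"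
      using sec_in[OF D P_facts(1,2)[OF D a(1)]] sec_section[OF D P_facts(1,2)[OF D a(1)]]
        base_slits[OF D] by (simp add: M_def)
  next
    fix y assume "y \<in> M"
    then have y: "y \<in> X" "p y \<in> D" "p y = - \<i>" using base_slits[OF D] by (auto simp: M_def)
    let ?a = "sec D y \<i>"
    have a: "?a \<in> P"
      using sec_in[OF D y(1,2)] sec_section[OF D y(1,2)] base_slits[OF D] by (simp add: P_def)
    have "sec D ?a (- \<i>) = sec D y (- \<i>)"
      by (rule sec_unique[OF D P_facts(1,2)[OF D a] D y(1,2) base_slits(3)[OF D], where t = \<i>])
        (use base_slits[OF D] P_facts(4)[OF D a] in auto)
    then have "\<beta> D ?a = y" using sec_base[OF D y(1,2)] y(3) by (simp add: \<beta>_def)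
    then show "y \<in> \<beta> D ` P" using a by (metis imageI)
  qed
qed

definition sheet :: "complex set \<Rightarrow> 'a \<Rightarrow> 'a set" where
  "sheet D a = {x \<in> X. p x \<in> D \<and> sec D a (p x) = x}"

lemma sec_in_sheet:
  assumes "D \<in> slits" "a \<in> P" "z \<in> D"
  shows "sec D a z \<in> sheet D a"
  using sec_in[OF assms(1) P_facts(1,2)[OF assms(1,2)] assms(3)]
    sec_section[OF assms(1) P_facts(1,2)[OF assms(1,2)] assms(3)] assms(3)
  by (simp add: sheet_def)

text \<open>Near \<open>x\<close> the map \<open>p\<close> is injective on some open
  \<open>T\<close>, and by continuity the section keeps its values in \<open>T\<close>. So a nearby
  \<open>w\<close> and \<open>sec D a (p w)\<close>, having the same image, coincide.\<close>

lemma sheet_open: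
  assumes D: "D \<in> slits" and a: "a \<in> P"
  shows "openin (top_of_set X) (sheet D a)"
proof (subst openin_subopen, intro ballI)
  note aX = P_facts(1,2)[OF D a]
  fix x assume x: "x \<in> sheet D a"
  then have xX: "x \<in> X" "p x \<in> D" "sec D a (p x) = x" by (auto simp: sheet_def)
  obtain T u q where T: "x \<in> T" "openin (top_of_set X) T" "homeomorphism T u p q"
    using covering_space_local_homeomorphism[OF cov xX(1)] by metis
  have inj: "x1 = x2" if "x1 \<in> T" "x2 \<in> T" "p x1 = p x2" for x1 x2
    using T(3) that unfolding homeomorphism_def by metis
  have TX: "T \<subseteq> X" using openin_imp_subset[OF T(2)] .
  obtain T' where T': "open T'" "T = X \<inter> T'" using T(2) by (auto simp: openin_open)
  have "openin (top_of_set D) (D \<inter> sec D a -` T')"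
    by (rule continuous_openin_preimage_gen[OF sec_continuous[OF D aX] T'(1)])
  then have oD: "open (D \<inter> sec D a -` T')"
    using slits_open[OF D] openin_open_trans by blast
  have "openin (top_of_set X) (X \<inter> p -` (D \<inter> sec D a -` T'))"
    by (rule continuous_openin_preimage_gen[OF covering_space_imp_continuous[OF cov] oD])
  then have "openin (top_of_set X) (T \<inter> (X \<inter> p -` (D \<inter> sec D a -` T')))"
    by (rule openin_Int[OF T(2)])
  moreover have "x \<in> T \<inter> (X \<inter> p -` (D \<inter> sec D a -` T'))" using T T' xX by auto
  moreover have "T \<inter> (X \<inter> p -` (D \<inter> sec D a -` T')) \<subseteq> sheet D a"
  proof
    fix w assume w: "w \<in> T \<inter> (X \<inter> p -` (D \<inter> sec D a -` T'))"
    then have "sec D a (p w) \<in> T" "p (sec D a (p w)) = p w"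
      using T' sec_in[OF D aX] sec_section[OF D aX] by auto
    then have "sec D a (p w) = w" using w inj by blast
    then show "w \<in> sheet D a" using w by (auto simp: sheet_def)
  qed
  ultimately show "\<exists>T. openin (top_of_set X) T \<and> x \<in> T \<and> T \<subseteq> sheet D a" by blast
qed

lemma sheet_exists:
  assumes D: "D \<in> slits" and x: "x \<in> X" "p x \<in> D"
  obtains a where "a \<in> P" "x \<in> sheet D a"
proof
  let ?a = "sec D x \<i>"
  show a: "?a \<in> P"
    using sec_in[OF D x] sec_section[OF D x] base_slits[OF D] by (simp add: P_def)
  have "sec D ?a (p x) = sec D x (p x)"
    by (rule sec_unique[OF D P_facts(1,2)[OF D a] D x base_slits(3)[OF D], where t = \<i>])
      (use base_slits[OF D] P_facts(4)[OF D a] x in auto)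
  then show "x \<in> sheet D ?a" using x sec_base[OF D x] by (simp add: sheet_def)
qed

text \<open>Over different slit planes a common point lies over a half-plane. Sections that agree
  over the upper one have the same base point over i, those that agree over the lower one have the
  same endpoint over -i.\<close>

lemma sheet_meet:
  assumes D: "D \<in> slits" "a \<in> P" and D': "D' \<in> slits" "b \<in> P"
    and x: "x \<in> sheet D a" "x \<in> sheet D' b"
  shows "a = b \<or> \<beta> D a = \<beta> D' b"
proof -
  have eq: "sec D a (p x) = sec D' b (p x)" and px: "p x \<in> D" "p x \<in> D'"
    using x by (auto simp: sheet_def)
  show ?thesis
  proof (cases "D = D'")
    case True
    have "sec D a (- \<i>) = sec D' b (- \<i>)"
      by (rule sec_unique[OF D(1) P_facts(1,2)[OF D] D'(1) P_facts(1,2)[OF D'] base_slits(3)[OF D(1)] _ _ _ eq])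
        (use px True base_slits[OF D(1)] in auto)
    then show ?thesis by (simp add: \<beta>_def)
  next
    case False
    then have "p x \<in> upper \<or> p x \<in> lower" using slits_Int[OF D(1) D'(1)] px by blast
    then show ?thesis
    proof
      assume "p x \<in> upper"
      then show ?thesis using sec_eq_upper[OF D D' _ eq] by simp
    next
      assume "p x \<in> lower"
      then show ?thesis using sec_eq_lower[OF D D' _ eq halves_mem(2)] by (simp add: \<beta>_def)
    qed
  qed
qed

text \<open>If the matchings in question send \<open>Q\<close> to the same set, then by
  \<open>sheet_meet\<close> no sheet based in \<open>Q\<close> meets one based in
  \<open>P - Q\<close>. The two unions of sheets are open and cover \<open>E\<close>, so
  connectedness puts \<open>E\<close> into one of them.\<close>

lemma sheets_dichotomy:
  assumes \<D>: "\<D> \<subseteq> slits" and E: "connected E" "E \<subseteq> X" "p ` E \<subseteq> \<Union>\<D>"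
    and Q: "Q \<subseteq> P" "\<And>D D'. D \<in> \<D> \<Longrightarrow> D' \<in> \<D> \<Longrightarrow> \<beta> D ` Q = \<beta> D' ` Q"
  defines "T \<equiv> \<Union>D\<in>\<D>. \<Union>a\<in>Q. sheet D a"
  shows "E \<subseteq> T \<or> E \<inter> T = {}"
proof -
  let ?T' = "\<Union>D\<in>\<D>. \<Union>a\<in>P - Q. sheet D a"
  have "openin (top_of_set X) T" "openin (top_of_set X) ?T'"
    unfolding T_def using \<D> Q(1) by (auto intro!: openin_Union sheet_open)
  moreover have "E \<subseteq> T \<union> ?T'"
  proof
    fix x assume x: "x \<in> E"
    then obtain D where D: "D \<in> \<D>" "p x \<in> D" using E(3) by auto
    obtain a where "a \<in> P" "x \<in> sheet D a"
      using sheet_exists[of D x] \<D> D x E(2) by (metis subsetD)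
    then show "x \<in> T \<union> ?T'" using D x by (auto simp: T_def)
  qed
  moreover have "T \<inter> ?T' = {}"
  proof (rule ccontr)
    assume "T \<inter> ?T' \<noteq> {}"
    then obtain x D D' a b where D: "D \<in> \<D>" "a \<in> Q" "x \<in> sheet D a"
      and D': "D' \<in> \<D>" "b \<in> P - Q" "x \<in> sheet D' b"
      unfolding T_def by blast
    have sl: "D \<in> slits" "D' \<in> slits" "a \<in> P" "b \<in> P" using \<D> D D' Q(1) by auto
    have "\<beta> D a = \<beta> D' b"
      using sheet_meet[OF sl(1,3,2,4) D(3) D'(3)] D D' by auto
    then have "\<beta> D' b \<in> \<beta> D' ` Q" using Q(2)[OF D(1) D'(1)] D(2) by (metis imageI)
    then have "b \<in> Q"
      using \<beta>_bij[OF sl(2)] sl(4) Q(1) by (metis bij_betw_imp_inj_on inj_on_image_mem_iff)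
    then show False using D' by simp
  qed
  ultimately show ?thesis
    using connected_subset_openin[OF E(1,2), of T ?T'] by blast
qed

text \<open>Transitivity of the monodromy: a set on which the three matchings have one common image
  carries a union of sheets that is open and closed in \<open>X\<close>.\<close>

lemma transitive:
  assumes conn: "connected X" and Q: "Q \<subseteq> P" "Q \<noteq> {}"
    "\<And>D D'. D \<in> slits \<Longrightarrow> D' \<in> slits \<Longrightarrow> \<beta> D ` Q = \<beta> D' ` Q"
  shows "Q = P"
proof -
  let ?T = "\<Union>D\<in>slits. \<Union>a\<in>Q. sheet D a"
  have S: "slit_left \<in> slits" by (simp add: slits_def)
  have "p ` X \<subseteq> \<Union>slits"
    using covering_space_imp_surjective[OF cov] slits_Union by simp
  then have dich: "X \<subseteq> ?T \<or> X \<inter> ?T = {}"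
    by (rule sheets_dichotomy[OF order_refl conn order_refl _ Q(1,3)])
  have in_sheet: "a \<in> sheet D a" if "D \<in> slits" "a \<in> P" for D a
    using sec_in_sheet[OF that base_slits(1)[OF that(1)]] P_facts(4)[OF that] by simp
  obtain a where "a \<in> Q" using Q(2) by blast
  then have "a \<in> X \<inter> ?T" using Q(1) in_sheet[OF S] S P_facts(1)[OF S] by blast
  then have XT: "X \<subseteq> ?T" using dich by blast
  have "b \<in> Q" if b: "b \<in> P" for b
  proof -
    have "b \<in> ?T" using XT P_facts(1)[OF S b] by blast
    then obtain D a where D: "D \<in> slits" "a \<in> Q" "b \<in> sheet D a" by blast
    have aP: "a \<in> P" using D Q by auto
    have "sec D a \<i> = sec D b \<i>"
      using D(3) P_facts(3,4)[OF D(1) b] by (simp add: sheet_def)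
    then have "a = b" using sec_eq_upper[OF D(1) aP D(1) b halves_mem(1)] by simp
    then show ?thesis using D by simp
  qed
  then show ?thesis using Q(1) by blast
qed

text \<open>The sets \<open>K x\<close> are the punctured discs around the points \<open>x\<close> over a puncture that
  separates the segments of the real line lying in \<open>D\<close> and in \<open>D'\<close>; a disc is a single orbit
  of the monodromy \<open>(\<beta> D')\<inverse> \<beta> D\<close> around that puncture.\<close>

lemma vertex_orbits:
  fixes K :: "'i \<Rightarrow> 'a set"
  assumes D: "D \<in> slits" "D' \<in> slits"
    and K: "\<forall>x\<in>I. connected (K x)" "\<forall>x\<in>I. openin (top_of_set X) (K x)"
      "\<forall>x\<in>I. p ` K x \<subseteq> D \<union> D'" "\<forall>x\<in>I. \<forall>y\<in>I. x \<noteq> y \<longrightarrow> K x \<inter> K y = {}"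
    and N: "{x \<in> X. p x \<in> N} \<subseteq> (\<Union>x\<in>I. K x)" "connected (N \<inter> D)" "connected (N \<inter> D')"
    and n: "n \<in> N" "n \<in> upper" and n': "n' \<in> N" "n' \<in> lower"
  defines "Orb \<equiv> \<lambda>x. {a \<in> P. sec D a n \<in> K x}"
  shows "P = (\<Union>x\<in>I. Orb x)"
    and "\<And>x y. x \<in> I \<Longrightarrow> y \<in> I \<Longrightarrow> x \<noteq> y \<Longrightarrow> Orb x \<inter> Orb y = {}"
    and "\<And>x. x \<in> I \<Longrightarrow> card (Orb x) = card {u \<in> K x. p u = n}"
    and "\<And>x a b. x \<in> I \<Longrightarrow> a \<in> Orb x \<Longrightarrow> b \<in> P \<Longrightarrow> \<beta> D a = \<beta> D' b \<Longrightarrow> b \<in> Orb x"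
    and "\<And>x Q. x \<in> I \<Longrightarrow> Q \<subseteq> P \<Longrightarrow> \<beta> D ` Q = \<beta> D' ` Q \<Longrightarrow> Orb x \<subseteq> Q \<or> Orb x \<inter> Q = {}"
proof -
  note K = K[rule_format]
  have nD: "n \<in> D" "n \<in> D'" "n' \<in> D" "n' \<in> D'"
    using slits_halves[OF D(1)] slits_halves[OF D(2)] n n' by auto
  have KX: "K x \<subseteq> X" if "x \<in> I" for x using openin_imp_subset[OF K(2)[OF that]] .
  \<comment> \<open>The part of a sheet over the connected set \<open>N \<inter> C\<close> is
    connected and covered by the disjoint open sets \<open>K y\<close>, hence lies in a single
    one.\<close>
  have sheet_in_K: "sec C a z \<in> K x"
    if C: "C \<in> {D, D'}" and a: "a \<in> P" and x: "x \<in> I" and w: "w \<in> N \<inter> C" "sec C a w \<in> K x"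
      and z: "z \<in> N \<inter> C" for C a x w z
  proof -
    have Cs: "C \<in> slits" and conn: "connected (N \<inter> C)" using C D N by auto
    note aX = P_facts(1,2)[OF Cs a]
    let ?J = "sec C a ` (N \<inter> C)"
    have cJ: "connected ?J"
      by (rule connected_continuous_image[OF continuous_on_subset[OF sec_continuous[OF Cs aX]] conn]) auto
    have JX: "?J \<subseteq> X" using sec_in[OF Cs aX] by auto
    have JK: "?J \<subseteq> (\<Union>x\<in>I. K x)"
      using N(1) sec_in[OF Cs aX] sec_section[OF Cs aX] by auto
    let ?R = "\<Union>y\<in>I - {x}. K y"
    have "openin (top_of_set X) ?R" using K(2) by (auto intro!: openin_Union)
    moreover have "?J \<subseteq> K x \<union> ?R" using JK by blast
    moreover have "K x \<inter> ?R = {}" using K(4)[OF x] by blast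
    ultimately have "?J \<subseteq> K x \<or> ?J \<subseteq> ?R"
      using connected_subset_openin[OF cJ JX K(2)[OF x]] by blast
    moreover have "sec C a w \<in> ?J" using w by blast
    ultimately have "?J \<subseteq> K x" using w(2) \<open>K x \<inter> ?R = {}\<close> by blast
    then show ?thesis using z by blast
  qed
  have On: "sec D a n \<in> (\<Union>x\<in>I. K x)" if "a \<in> P" for a
    using N(1) n(1) sec_in[OF D(1) P_facts(1,2)[OF D(1) that] nD(1)]
      sec_section[OF D(1) P_facts(1,2)[OF D(1) that] nD(1)] by auto
  show "P = (\<Union>x\<in>I. Orb x)" using On by (auto simp: Orb_def)
  show "Orb x \<inter> Orb y = {}" if "x \<in> I" "y \<in> I" "x \<noteq> y" for x y
    using K(4)[OF that] by (auto simp: Orb_def)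
  show "card (Orb x) = card {u \<in> K x. p u = n}" if x: "x \<in> I" for x
  proof (rule bij_betw_same_card, rule bij_betw_imageI)
    show "inj_on (\<lambda>a. sec D a n) (Orb x)"
      using sec_eq_upper[OF D(1) _ D(1) _ n(2)] by (auto simp: inj_on_def Orb_def)
    show "(\<lambda>a. sec D a n) ` Orb x = {u \<in> K x. p u = n}"
    proof (intro equalityI subsetI)
      fix u assume "u \<in> (\<lambda>a. sec D a n) ` Orb x"
      then show "u \<in> {u \<in> K x. p u = n}"
        using sec_section[OF D(1) P_facts(1,2)[OF D(1)] nD(1)] by (auto simp: Orb_def)
    next
      fix u assume u: "u \<in> {u \<in> K x. p u = n}"
      then have "u \<in> X" "p u \<in> D" using KX[OF x] nD by auto
      then obtain a where a: "a \<in> P" "u \<in> sheet D a" by (rule sheet_exists[OF D(1)])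
      then have "sec D a n = u" using u by (simp add: sheet_def)
      then show "u \<in> (\<lambda>a. sec D a n) ` Orb x"
        using u a(1) by (intro image_eqI[of _ _ a]) (simp_all add: Orb_def)
    qed
  qed
  \<comment> \<open>Descend from \<open>n\<close> to \<open>n'\<close> inside
    \<open>N \<inter> D\<close>, then climb back inside \<open>N \<inter> D'\<close>; neither
    passage leaves \<open>K x\<close>.\<close>
  show "b \<in> Orb x" if x: "x \<in> I" and a: "a \<in> Orb x" and b: "b \<in> P" and eq: "\<beta> D a = \<beta> D' b" for x a b
  proof -
    have aP: "a \<in> P" and aK: "sec D a n \<in> K x" using a by (auto simp: Orb_def)
    have 1: "sec D a n' \<in> K x"
      by (rule sheet_in_K[OF _ aP x _ aK]) (use n n' nD in auto)
    have "sec D a n' = sec D' b n'"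
      by (rule sec_eq_lower[OF D(1) aP D(2) b halves_mem(2) _ n'(2)]) (use eq in \<open>simp add: \<beta>_def\<close>)
    then have 2: "sec D' b n' \<in> K x" using 1 by simp
    have "sec D' b n \<in> K x"
      by (rule sheet_in_K[OF _ b x _ 2]) (use n n' nD in auto)
    then show ?thesis using sec_upper[OF D b n(2)] b by (simp add: Orb_def)
  qed
  show "Orb x \<subseteq> Q \<or> Orb x \<inter> Q = {}" if x: "x \<in> I" and Q: "Q \<subseteq> P" "\<beta> D ` Q = \<beta> D' ` Q" for x Q
  proof -
    let ?T = "\<Union>C\<in>{D, D'}. \<Union>a\<in>Q. sheet C a"
    \<comment> \<open>Connectedness of \<open>K x\<close> makes the orbit minimal: the sheets of an
      invariant \<open>Q\<close> contain \<open>K x\<close> or miss it.\<close>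
    have dich: "K x \<subseteq> ?T \<or> K x \<inter> ?T = {}"
      by (rule sheets_dichotomy[OF _ K(1)[OF x] KX[OF x] _ Q(1)]) (use D K(3)[OF x] Q in auto)
    have "Orb x \<subseteq> Q" if a: "a \<in> Orb x \<inter> Q" for a
    proof
      fix b assume b: "b \<in> Orb x"
      have aP: "a \<in> P" "sec D a n \<in> K x" and bP: "b \<in> P" "sec D b n \<in> K x"
        using a b by (auto simp: Orb_def)
      have "sec D a n \<in> K x \<inter> ?T" using aP a sec_in_sheet[OF D(1) aP(1) nD(1)] by auto
      then have "K x \<subseteq> ?T" using dich by blast
      then obtain C c where c: "C \<in> {D, D'}" "c \<in> Q" "sec D b n \<in> sheet C c" using bP(2) by blast
      have C: "C \<in> slits" "c \<in> P" using c D Q by auto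
      have "p (sec D b n) = n" by (rule sec_section[OF D(1) P_facts(1,2)[OF D(1) bP(1)] nD(1)])
      then have "sec C c n = sec D b n" using c(3) by (simp add: sheet_def)
      then have "c = b" by (rule sec_eq_upper[OF C D(1) bP(1) n(2)])
      then show "b \<in> Q" using c by simp
    qed
    then show ?thesis by blast
  qed
qed

end

section \<open>Permutations with prescribed cycle types\<close>

text \<open>Cycles are minimal nonempty invariant sets rather than sets of iterates: connectedness
  of punctured discs yields them in this form, and \<open>single_orbit\<close> recovers the
  iterates.\<close>

definition has_cycle_type :: "'a set \<Rightarrow> ('a \<Rightarrow> 'a) \<Rightarrow> nat multiset \<Rightarrow> bool" where
  "has_cycle_type P s \<pi> \<longleftrightarrow> (\<exists>\<C>. finite \<C> \<and> \<Union>\<C> = P \<and> disjoint \<C> \<and> {} \<notin> \<C> \<and>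
     (\<forall>C\<in>\<C>. s ` C = C \<and> (\<forall>Q\<subseteq>P. s ` Q = Q \<longrightarrow> C \<subseteq> Q \<or> C \<inter> Q = {})) \<and>
     image_mset card (mset_set \<C>) = \<pi>)"

text \<open>The forward orbit of \<open>a\<close> is invariant, since an injective self-map of a
  finite set is onto; minimality then makes it all of \<open>C\<close>. Its size is the first return
  time \<open>m\<close>.\<close>

lemma single_orbit:
  assumes fin: "finite C" and sC: "s ` C = C"
    and min: "\<And>Q. Q \<subseteq> C \<Longrightarrow> s ` Q = Q \<Longrightarrow> C \<subseteq> Q \<or> C \<inter> Q = {}" and a: "a \<in> C"
  shows "(s ^^ card C) a = a" and "C = (\<lambda>i. (s ^^ i) a) ` {..<card C}"
proof -
  define f where "f i = (s ^^ i) a" for i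
  have fC: "f i \<in> C" for i
    by (induction i) (use a sC in \<open>auto simp: f_def\<close>)
  have inj: "inj_on s C" using fin sC by (simp add: eq_card_imp_inj_on)
  have cancel: "f (j - i) = a" if "i \<le> j" "f i = f j" for i j
    using that
  proof (induction i arbitrary: j)
    case (Suc i)
    then obtain j' where j: "j = Suc j'" using Suc_le_D by blast
    have "s (f i) = s (f j')" using Suc.prems j by (simp add: f_def)
    then have "f i = f j'" using inj fC by (meson inj_onD)
    then show ?case using Suc j by simp
  qed (simp add: f_def)
  let ?Q = "range f"
  have QC: "?Q \<subseteq> C" using fC by auto
  then have finQ: "finite ?Q" using fin finite_subset by blast
  have "s ` ?Q \<subseteq> ?Q"
  proof
    fix u assume "u \<in> s ` ?Q"
    then obtain i where "u = f (Suc i)" by (auto simp: f_def)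
    then show "u \<in> ?Q" by simp
  qed
  then have "s ` ?Q = ?Q"
    using finQ inj QC by (meson endo_inj_surj inj_on_subset)
  moreover have "a \<in> ?Q" by (rule range_eqI[of _ _ 0]) (simp add: f_def)
  ultimately have CQ: "C = ?Q" using min[OF QC] QC a by blast
  obtain i j where "i \<noteq> j" "f i = f j"
    using finQ finite_imageD[of f UNIV] by (metis infinite_UNIV_nat inj_onI)
  then obtain i j where "i < j" "f i = f j" by (metis linorder_neqE_nat)
  then have ex: "\<exists>m. m > 0 \<and> f m = a" using cancel[of i j] by (intro exI[of _ "j - i"]) simp
  define m where "m = (LEAST m. m > 0 \<and> f m = a)"
  have m: "m > 0" "f m = a" using LeastI_ex[OF ex] by (simp_all add: m_def)
  have mle: "m \<le> k" if "k > 0" "f k = a" for k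
    unfolding m_def by (rule Least_le) (use that in simp)
  have fm: "f i = f (i mod m)" for i
  proof (induction i rule: less_induct)
    case (less i)
    show ?case
    proof (cases "i < m")
      case False
      have "f i = (s ^^ (i - m)) (f m)"
        using False by (simp add: f_def flip: funpow_add[unfolded comp_def, THEN fun_cong])
      also have "\<dots> = f (i - m)" using m(2) by (simp add: f_def)
      also have "\<dots> = f ((i - m) mod m)" using less.IH[of "i - m"] False m(1) by simp
      finally show ?thesis using False by (simp add: le_mod_geq)
    qed simp
  qed
  have Cm: "C = f ` {..<m}"
  proof -
    have "f i \<in> f ` {..<m}" for i using fm[of i] m(1) by auto
    then show ?thesis using CQ by blast
  qed
  have "inj_on f {..<m}"
  proof (rule linorder_inj_onI)
    fix i j assume ij: "i < j" "i \<in> {..<m}" "j \<in> {..<m}"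
    show "f i \<noteq> f j"
    proof
      assume "f i = f j"
      then have "f (j - i) = a" using cancel[of i j] ij by simp
      then show False using mle[of "j - i"] ij by simp
    qed
  qed (rule linear)
  then have "card C = m" using Cm by (simp add: card_image)
  then show "(s ^^ card C) a = a" "C = (\<lambda>i. (s ^^ i) a) ` {..<card C}"
    using m(2) Cm by (auto simp: f_def)
qed

locale cycle_partition =
  fixes P :: "'a set" and s :: "'a \<Rightarrow> 'a" and \<pi> :: "nat multiset" and \<C> :: "'a set set"
  assumes finP: "finite P" and fin: "finite \<C>" and un: "\<Union>\<C> = P" and disj: "disjoint \<C>"
    and sC: "\<And>C. C \<in> \<C> \<Longrightarrow> s ` C = C"
    and min: "\<And>C Q. C \<in> \<C> \<Longrightarrow> Q \<subseteq> P \<Longrightarrow> s ` Q = Q \<Longrightarrow> C \<subseteq> Q \<or> C \<inter> Q = {}"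
    and ty: "image_mset card (mset_set \<C>) = \<pi>"
begin

lemma orbit:
  assumes C: "C \<in> \<C>" and a: "a \<in> C"
  shows "(s ^^ card C) a = a" and "C = (\<lambda>i. (s ^^ i) a) ` {..<card C}"
proof -
  have "C \<subseteq> P" using C un by blast
  then have "finite C" "\<And>Q. Q \<subseteq> C \<Longrightarrow> s ` Q = Q \<Longrightarrow> C \<subseteq> Q \<or> C \<inter> Q = {}"
    using finP finite_subset min[OF C] by (blast, meson order_trans)
  then show "(s ^^ card C) a = a" "C = (\<lambda>i. (s ^^ i) a) ` {..<card C}"
    using single_orbit[OF _ sC[OF C] _ a] by blast+
qed

lemma cycle_of:
  assumes "a \<in> P"
  obtains C where "C \<in> \<C>" "a \<in> C" "card C \<in># \<pi>"
  using assms un fin ty by (metis UnionE finite_set_mset_mset_set image_eqI set_image_mset)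

lemma card_cycles: "card {C \<in> \<C>. card C = k} = count \<pi> k"
proof -
  have "card -` {k} \<inter> \<C> = {C \<in> \<C>. card C = k}" by auto
  then show ?thesis
    unfolding ty[symmetric] count_image_mset using fin by simp
qed

lemma fixed_iff:
  assumes C: "C \<in> \<C>" and a: "a \<in> C"
  shows "s a = a \<longleftrightarrow> card C = 1"
proof
  assume "card C = 1"
  then show "s a = a" using orbit(1)[OF C a] by simp
next
  assume "s a = a"
  then have "s ` {a} = {a}" by simp
  moreover have "{a} \<subseteq> P" using C a un by blast
  ultimately have "C = {a}" using min[OF C, of "{a}"] a by blast
  then show "card C = 1" by simp
qed

lemma card_fixed: "card {a \<in> P. s a = a} = count \<pi> 1"
proof -
  have "bij_betw (\<lambda>a. {a}) {a \<in> P. s a = a} {C \<in> \<C>. card C = 1}"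
  proof (rule bij_betw_imageI)
    show "(\<lambda>a. {a}) ` {a \<in> P. s a = a} = {C \<in> \<C>. card C = 1}"
    proof (intro equalityI subsetI)
      fix C assume "C \<in> (\<lambda>a. {a}) ` {a \<in> P. s a = a}"
      then obtain a where a: "C = {a}" "a \<in> P" "s a = a" by blast
      obtain C' where C': "C' \<in> \<C>" "a \<in> C'" using a un by blast
      then have "card C' = 1" using fixed_iff a by blast
      then have "C' = C" using a C' by (metis card_1_singletonE singletonD)
      then show "C \<in> {C \<in> \<C>. card C = 1}" using C' \<open>card C' = 1\<close> by simp
    next
      fix C assume C: "C \<in> {C \<in> \<C>. card C = 1}"
      then have "card C = 1" by simp
      then obtain a where a: "C = {a}" by (rule card_1_singletonE)
      then show "C \<in> (\<lambda>a. {a}) ` {a \<in> P. s a = a}" using C fixed_iff[of C a] un by auto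
    qed
  qed simp
  then show ?thesis using card_cycles[of 1] by (simp add: bij_betw_same_card)
qed

end

lemma has_cycle_typeE:
  assumes "has_cycle_type P s \<pi>" "finite P"
  obtains \<C> where "cycle_partition P s \<pi> \<C>"
proof -
  obtain \<C> where "finite \<C> \<and> \<Union>\<C> = P \<and> disjoint \<C> \<and> {} \<notin> \<C> \<and>
     (\<forall>C\<in>\<C>. s ` C = C \<and> (\<forall>Q\<subseteq>P. s ` Q = Q \<longrightarrow> C \<subseteq> Q \<or> C \<inter> Q = {})) \<and>
     image_mset card (mset_set \<C>) = \<pi>"
    using assms(1) unfolding has_cycle_type_def by blast
  then show thesis
    using assms(2) by (intro that[of \<C>]) (unfold_locales; blast)
qed

section \<open>Nonexistence of the two transitive pairs of permutations\<close>

locale transitive_pair =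
  fixes P :: "'a set" and x y :: "'a \<Rightarrow> 'a"
  assumes finP: "finite P" and bx: "bij_betw x P P" and bij_y: "bij_betw y P P"
    and trans: "\<And>Q. Q \<subseteq> P \<Longrightarrow> x ` Q = Q \<Longrightarrow> y ` Q = Q \<Longrightarrow> Q = {} \<or> Q = P"
begin

lemma P_closed: "a \<in> P \<Longrightarrow> x a \<in> P" "a \<in> P \<Longrightarrow> y a \<in> P"
  using bx bij_y bij_betwE by blast+

lemma x_inj: "a \<in> P \<Longrightarrow> b \<in> P \<Longrightarrow> x a = x b \<longleftrightarrow> a = b"
  and y_inj: "a \<in> P \<Longrightarrow> b \<in> P \<Longrightarrow> y a = y b \<longleftrightarrow> a = b"
  using bx bij_y by (auto simp: bij_betw_def inj_on_def)

text \<open>On a finite set, forward closure under a permutation is already invariance, so closure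
  is all that has to be checked when a proper part of the dessin is exhibited.\<close>

lemma closed_subset:
  assumes "Q \<subseteq> P" "Q \<noteq> {}" "x ` Q \<subseteq> Q" "y ` Q \<subseteq> Q"
  shows "Q = P"
proof -
  have "finite Q" "inj_on x Q" "inj_on y Q"
    using finite_subset[OF assms(1) finP] bx bij_y assms(1) unfolding bij_betw_def
    by (auto intro: inj_on_subset)
  then have "x ` Q = Q" "y ` Q = Q" using assms by (simp_all add: endo_inj_surj)
  then show ?thesis using trans[OF assms(1)] assms(2) by blast
qed

text \<open>A fixed point \<open>a\<close> of \<open>y \<circ> x\<close> gives an orbit \<open>{a, x a}\<close> of \<open>x\<close> inside an orbit of \<open>y\<close>
  (a loop of the dessin); an orbit of \<open>y\<close> of size 4 holding two of them would be closed under \<open>x\<close>.\<close>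

lemma no_4_4:
  assumes tx: "has_cycle_type P x (replicate_mset 4 2)" and ty: "has_cycle_type P y {#4, 4#}"
    and tz: "has_cycle_type P (y \<circ> x) {#5, 1, 1, 1#}" and card: "card P = 8"
  shows False
proof -
  obtain \<X> where "cycle_partition P x (replicate_mset 4 2) \<X>" using has_cycle_typeE[OF tx finP] .
  then interpret X: cycle_partition P x "replicate_mset 4 2" \<X> .
  obtain \<Y> where "cycle_partition P y {#4, 4#} \<Y>" using has_cycle_typeE[OF ty finP] .
  then interpret Y: cycle_partition P y "{#4, 4#}" \<Y> .
  obtain \<Z> where "cycle_partition P (y \<circ> x) {#5, 1, 1, 1#} \<Z>" using has_cycle_typeE[OF tz finP] .
  then interpret Z: cycle_partition P "y \<circ> x" "{#5, 1, 1, 1#}" \<Z> .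
  have xx: "x (x a) = a" and xne: "x a \<noteq> a" if a: "a \<in> P" for a
  proof -
    obtain C where C: "C \<in> \<X>" "a \<in> C" "card C \<in># replicate_mset 4 2" by (rule X.cycle_of[OF a])
    then have c: "card C = 2" by (simp add: in_replicate_mset)
    show "x (x a) = a" using X.orbit(1)[OF C(1,2)] by (simp add: c numeral_2_eq_2)
    show "x a \<noteq> a" using X.fixed_iff[OF C(1,2)] c by simp
  qed
  define F where "F = {a \<in> P. y (x a) = a}"
  have cF: "card F = 3" using Z.card_fixed by (simp add: F_def)
  have y4: "\<exists>C\<in>\<Y>. a \<in> C \<and> card C = 4" if a: "a \<in> P" for a
  proof -
    obtain C where "C \<in> \<Y>" "a \<in> C" "card C \<in># {#4, 4#}" by (rule Y.cycle_of[OF a])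
    then show ?thesis by auto
  qed
  then obtain cyc where cyc: "\<And>a. a \<in> P \<Longrightarrow> cyc a \<in> \<Y>" "\<And>a. a \<in> P \<Longrightarrow> a \<in> cyc a"
    "\<And>a. a \<in> P \<Longrightarrow> card (cyc a) = 4" by metis
  have "cyc ` F \<subseteq> {C \<in> \<Y>. card C = 4}" using cyc by (auto simp: F_def)
  then have "card (cyc ` F) \<le> 2"
    using Y.card_cycles[of 4] Y.fin card_mono[of "{C \<in> \<Y>. card C = 4}" "cyc ` F"] by simp
  \<comment> \<open>Pigeonhole: three fixed points of \<open>y \<circ> x\<close>, but two cycles of
    \<open>y\<close>.\<close>
  then have "\<not> inj_on cyc F" using cF by (auto dest: card_image)
  then obtain p p' where p: "p \<in> F" "p' \<in> F" "p \<noteq> p'" "cyc p = cyc p'" by (auto simp: inj_on_def)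
  have pP: "p \<in> P" "p' \<in> P" using p by (auto simp: F_def)
  have xP: "x p \<in> P" "x p' \<in> P" using pP P_closed by blast+
  have yx: "y (x p) = p" "y (x p') = p'" using p by (auto simp: F_def)
  let ?C = "cyc p"
  \<comment> \<open>As \<open>y (x q) = q\<close>, the point \<open>x q\<close> precedes
    \<open>q\<close> in its cycle of \<open>y\<close>.\<close>
  have in_cyc: "x q \<in> cyc q" if "q \<in> F" for q
  proof -
    have q: "q \<in> P" "y (x q) = q" using that by (auto simp: F_def)
    have "q \<in> y ` cyc q" using Y.sC[OF cyc(1)[OF q(1)]] cyc(2)[OF q(1)] by simp
    then obtain u where u: "u \<in> cyc q" "y u = q" by (metis imageE)
    have "u \<in> P" using u(1) cyc(1)[OF q(1)] Y.un by blast
    moreover have "y u = y (x q)" using u(2) q(2) by (rule HOL.trans[OF _ sym])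
    ultimately have "u = x q" using y_inj P_closed(1)[OF q(1)] by blast
    then show ?thesis using u(1) by simp
  qed
  have sub: "{p, x p, p', x p'} \<subseteq> ?C" using cyc(2) pP in_cyc p by auto
  \<comment> \<open>Otherwise \<open>{p, p'}\<close> would be invariant under \<open>y\<close>,
    although it lies properly inside a cycle of length 4.\<close>
  have ne: "x p \<noteq> p'"
  proof
    assume eq: "x p = p'"
    then have "x p' = p" using xx[OF pP(1)] by simp
    then have "y p = p'" "y p' = p" using yx eq by auto
    then have "y ` {p, p'} = {p, p'}" by auto
    then have "?C \<subseteq> {p, p'}" using Y.min[OF cyc(1)[OF pP(1)], of "{p, p'}"] pP cyc(2)[OF pP(1)] by blast
    then have "card ?C \<le> card {p, p'}" by (intro card_mono) auto
    then show False using cyc(3)[OF pP(1)] p(3) by simp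
  qed
  then have ne': "x p' \<noteq> p" using xx[OF pP(2)] xx[OF pP(1)] by metis
  have "x p \<noteq> x p'" using p(3) x_inj pP by blast
  then have "card {p, x p, p', x p'} = 4"
    using p(3) ne ne' xne[OF pP(1)] xne[OF pP(2)] by (simp add: eq_commute)
  moreover have finC: "finite ?C" using cyc(3)[OF pP(1)] by (metis card.infinite zero_neq_numeral)
  ultimately have C: "?C = {p, x p, p', x p'}"
    using sub cyc(3)[OF pP(1)] by (metis card_subset_eq)
  have "x ` ?C \<subseteq> ?C" unfolding C using xx pP by auto
  moreover have "y ` ?C \<subseteq> ?C" using Y.sC[OF cyc(1)[OF pP(1)]] by simp
  moreover have "?C \<subseteq> P" using cyc(1)[OF pP(1)] Y.un by blast
  ultimately have "?C = P" using closed_subset[of ?C] cyc(2)[OF pP(1)] by blast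
  then show False using cyc(3)[OF pP(1)] card by simp
qed

text \<open>In the dessin the two fixed points of \<open>y \<circ> x\<close> are loops at vertices \<open>{p\<^sub>i, q\<^sub>i, s\<^sub>i}\<close> whose third
  edge is \<open>{s\<^sub>i, u\<^sub>i}\<close>, and the fixed point \<open>r\<close> of \<open>y\<close> is a leaf on the edge \<open>{r, w}\<close>. Two of
  \<open>u\<^sub>1, u\<^sub>2, w\<close> lie on the same face of length 7, and following that face closes up a proper part of
  the dessin.\<close>

lemma no_3_3_3_3_3_1:
  assumes tx: "has_cycle_type P x (replicate_mset 8 2)"
    and ty: "has_cycle_type P y (replicate_mset 5 3 + {#1#})"
    and tz: "has_cycle_type P (y \<circ> x) {#7, 7, 1, 1#}" and card: "card P = 16"
  shows False
proof -
  obtain \<X> where "cycle_partition P x (replicate_mset 8 2) \<X>" using has_cycle_typeE[OF tx finP] .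
  then interpret X: cycle_partition P x "replicate_mset 8 2" \<X> .
  obtain \<Y> where "cycle_partition P y (replicate_mset 5 3 + {#1#}) \<Y>"
    using has_cycle_typeE[OF ty finP] .
  then interpret Y: cycle_partition P y "replicate_mset 5 3 + {#1#}" \<Y> .
  obtain \<Z> where "cycle_partition P (y \<circ> x) {#7, 7, 1, 1#} \<Z>" using has_cycle_typeE[OF tz finP] .
  then interpret Z: cycle_partition P "y \<circ> x" "{#7, 7, 1, 1#}" \<Z> .
  define z where "z = y \<circ> x"
  have xx: "x (x a) = a" and xne: "x a \<noteq> a" if a: "a \<in> P" for a
  proof -
    obtain C where C: "C \<in> \<X>" "a \<in> C" "card C \<in># replicate_mset 8 2" by (rule X.cycle_of[OF a])
    then have c: "card C = 2" by (simp add: in_replicate_mset)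
    show "x (x a) = a" using X.orbit(1)[OF C(1,2)] by (simp add: c numeral_2_eq_2)
    show "x a \<noteq> a" using X.fixed_iff[OF C(1,2)] c by simp
  qed
  have yyy: "y (y (y a)) = a" if a: "a \<in> P" for a
  proof -
    obtain C where C: "C \<in> \<Y>" "a \<in> C" "card C \<in># replicate_mset 5 3 + {#1#}"
      by (rule Y.cycle_of[OF a])
    then have "card C = 3 \<or> card C = 1" by (auto simp: in_replicate_mset)
    then show ?thesis using Y.orbit(1)[OF C(1,2)] by (auto simp: numeral_3_eq_3)
  qed
  have z7: "(z ^^ 7) a = a" if a: "a \<in> P" for a
  proof -
    obtain C where C: "C \<in> \<Z>" "a \<in> C" "card C \<in># {#7, 7, 1, 1#}" by (rule Z.cycle_of[OF a])
    then have "card C = 7 \<or> card C = 1" by auto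
    moreover have "(z ^^ 7) a = a" if "z a = a" using that by (simp add: eval_nat_numeral)
    ultimately show ?thesis using Z.orbit(1)[OF C(1,2)] by (auto simp: z_def)
  qed
  have zP: "z a \<in> P" if "a \<in> P" for a using that P_closed by (simp add: z_def)
  obtain r where "{a \<in> P. y a = a} = {r}"
    using Y.card_fixed by (auto simp: card_1_singleton_iff)
  then have r: "r \<in> P" "y r = r" and r_unique: "\<And>a. a \<in> P \<Longrightarrow> y a = a \<Longrightarrow> a = r" by blast+
  have "card {a \<in> P. z a = a} = 2" using Z.card_fixed by (simp add: z_def)
  then obtain p1 p2 where "{a \<in> P. z a = a} = {p1, p2}" "p1 \<noteq> p2"
    by (meson card_2_iff)
  then have p: "p1 \<in> P" "p2 \<in> P" "z p1 = p1" "z p2 = p2" and p_ne: "p1 \<noteq> p2"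
    and p_unique: "\<And>a. a \<in> P \<Longrightarrow> z a = a \<Longrightarrow> a = p1 \<or> a = p2" by blast+
  \<comment> \<open>Pigeonhole: points not fixed by \<open>z\<close> lie on cycles of length 7, of
    which there are two.\<close>
  have same_face: "\<exists>i<7. (z ^^ i) a = b \<or> (z ^^ i) a = c \<or> (z ^^ i) b = c"
    if abc: "a \<in> P" "b \<in> P" "c \<in> P" and nf: "z a \<noteq> a" "z b \<noteq> b" "z c \<noteq> c" for a b c
  proof -
    have "\<exists>C\<in>{C \<in> \<Z>. card C = 7}. e \<in> C" if e: "e \<in> P" "z e \<noteq> e" for e
    proof -
      obtain C where C: "C \<in> \<Z>" "e \<in> C" "card C \<in># {#7, 7, 1, 1#}" by (rule Z.cycle_of[OF e(1)])
      then have "card C = 7" using Z.fixed_iff[OF C(1,2)] e(2) by (auto simp: z_def)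
      then show ?thesis using C by blast
    qed
    note face = this
    obtain A where A: "A \<in> \<Z>" "card A = 7" "a \<in> A" using face[OF abc(1) nf(1)] by auto
    obtain B where B: "B \<in> \<Z>" "card B = 7" "b \<in> B" using face[OF abc(2) nf(2)] by auto
    obtain C where C: "C \<in> \<Z>" "card C = 7" "c \<in> C" using face[OF abc(3) nf(3)] by auto
    have "\<not> (A \<noteq> B \<and> A \<noteq> C \<and> B \<noteq> C)"
    proof
      assume "A \<noteq> B \<and> A \<noteq> C \<and> B \<noteq> C"
      then have "card {A, B, C} = 3" by simp
      moreover have "card {A, B, C} \<le> card {C \<in> \<Z>. card C = 7}"
        by (rule card_mono) (use Z.fin A B C in auto)
      ultimately show False using Z.card_cycles[of 7] by simp
    qed
    moreover have "A = (\<lambda>i. (z ^^ i) a) ` {..<7}" "B = (\<lambda>i. (z ^^ i) b) ` {..<7}"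
      using Z.orbit(2)[OF A(1,3)] Z.orbit(2)[OF B(1,3)] A(2) B(2) by (simp_all add: z_def)
    ultimately consider "b \<in> (\<lambda>i. (z ^^ i) a) ` {..<7}" | "c \<in> (\<lambda>i. (z ^^ i) a) ` {..<7}"
      | "c \<in> (\<lambda>i. (z ^^ i) b) ` {..<7}"
      using B C by blast
    then show ?thesis by cases auto
  qed
  have small: False if "Q \<subseteq> P" "Q \<noteq> {}" "x ` Q \<subseteq> Q" "y ` Q \<subseteq> Q" "card Q < 16" for Q
    using closed_subset[OF that(1-4)] that(5) card by simp
  have zz: "z a = y (x a)" for a by (simp add: z_def)

  define q1 s1 u1 q2 s2 u2 w where "q1 = x p1" and "s1 = y p1" and "u1 = x s1"
    and "q2 = x p2" and "s2 = y p2" and "u2 = x s2" and "w = x r"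
  note defs = q1_def s1_def u1_def q2_def s2_def u2_def w_def
  have inP: "q1 \<in> P" "s1 \<in> P" "u1 \<in> P" "q2 \<in> P" "s2 \<in> P" "u2 \<in> P" "w \<in> P"
    unfolding defs using p r P_closed by blast+
  have x_rules: "x p1 = q1" "x q1 = p1" "x s1 = u1" "x u1 = s1" "x p2 = q2" "x q2 = p2"
    "x s2 = u2" "x u2 = s2" "x r = w" "x w = r"
    using xx p r inP by (simp_all add: defs)
  have y_rules: "y q1 = p1" "y p1 = s1" "y s1 = q1" "y q2 = p2" "y p2 = s2" "y s2 = q2" "y r = r"
  proof -
    show 1: "y q1 = p1" "y q2 = p2" using p by (simp_all add: defs zz)
    show "y p1 = s1" "y p2 = s2" "y r = r" using r by (simp_all add: defs)
    show "y s1 = q1" "y s2 = q2" using yyy[OF inP(1)] yyy[OF inP(4)] 1 by (simp_all add: defs)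
  qed
  have z_rules: "z q1 = s1" "z q2 = s2" "z u1 = q1" "z u2 = q2" "z s1 = y u1" "z s2 = y u2"
    "z w = r" "z r = y w"
    by (simp_all add: zz x_rules y_rules)
  have pq: "p1 \<noteq> q1" "p2 \<noteq> q2" using xne p x_rules by metis+
  have ps: "p1 \<noteq> s1" "p2 \<noteq> s2" using pq y_rules p inP y_inj by metis+
  have qs: "q1 \<noteq> s1" "q2 \<noteq> s2" using pq ps y_rules by metis+
  have pr: "p1 \<noteq> r" "p2 \<noteq> r" "q1 \<noteq> r" "q2 \<noteq> r" "s1 \<noteq> r" "s2 \<noteq> r"
    using pq ps qs y_rules by metis+
  have p2T: "p2 \<noteq> q1" "p2 \<noteq> s1"
  proof -
    show 1: "p2 \<noteq> q1"
    proof
      assume "p2 = q1"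
      then have "p1 = s2" "q2 = p1" using x_rules y_rules by metis+
      then show False using qs by simp
    qed
    show "p2 \<noteq> s1"
    proof
      assume eq: "p2 = s1"
      then have "y q2 = y p1" using y_rules by simp
      then have "q2 = p1" using y_inj inP p by blast
      then have "p2 = q1" using x_rules by metis
      then show False using 1 by simp
    qed
  qed
  have T12: "q2 \<noteq> p1" "q2 \<noteq> q1" "q2 \<noteq> s1" "s2 \<noteq> p1" "s2 \<noteq> q1" "s2 \<noteq> s1"
    using p2T p_ne y_rules by metis+
  have u_ne: "u1 \<noteq> p1" "u1 \<noteq> q1" "u1 \<noteq> s1" "u2 \<noteq> p2" "u2 \<noteq> q2" "u2 \<noteq> s2"
    "u1 \<noteq> p2" "u1 \<noteq> q2" "u2 \<noteq> p1" "u2 \<noteq> q1"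
    using x_rules ps qs xne inP T12 p2T by metis+
  \<comment> \<open>Otherwise the loop at \<open>p1\<close> and the leaf would close up into four
    elements.\<close>
  have u1r: "u1 \<noteq> r"
  proof
    assume "u1 = r"
    moreover have "card {p1, q1, s1, r} < 16" by (simp add: card_insert_if)
    ultimately show False using small[of "{p1, q1, s1, r}"] x_rules y_rules p inP r by simp
  qed
  have u2r: "u2 \<noteq> r"
  proof
    assume "u2 = r"
    moreover have "card {p2, q2, s2, r} < 16" by (simp add: card_insert_if)
    ultimately show False using small[of "{p2, q2, s2, r}"] x_rules y_rules p inP r by simp
  qed
  \<comment> \<open>Otherwise the two loops would be joined into a closed part of at most six
    elements.\<close>
  have u1s: "u1 \<noteq> s2"
  proof
    assume "u1 = s2"
    moreover from this have "u2 = s1" using x_rules by metis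
    moreover have "card {p1, q1, s1, p2, q2, s2} < 16" by (simp add: card_insert_if)
    ultimately show False
      using small[of "{p1, q1, s1, p2, q2, s2}"] x_rules y_rules p inP by simp
  qed
  have u2s: "u2 \<noteq> s1" using u1s x_rules by metis
  have u12: "u1 \<noteq> u2" using x_rules T12 by metis
  have w_ne: "w \<noteq> p1" "w \<noteq> q1" "w \<noteq> s1" "w \<noteq> u1" "w \<noteq> p2" "w \<noteq> q2" "w \<noteq> s2" "w \<noteq> u2" "w \<noteq> r"
    using x_rules pr u1r u2r xne[OF r(1)] by metis+
  have nf: "z u1 \<noteq> u1" "z u2 \<noteq> u2" "z w \<noteq> w"
    using p_unique u_ne w_ne inP by metis+

  \<comment> \<open>The relations force \<open>x\<close> to fix \<open>y u'\<close>, but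
    \<open>x\<close> has no fixed point.\<close>
  have uu: False if h: "y u = u'" "z (y u') = u" "u \<in> P" "u' \<in> P" for u u'
  proof -
    have "y (y u') = u" using h yyy by metis
    then have "y (x (y u')) = y (y u')" using h(2) by (simp add: zz)
    then have "x (y u') = y u'" using y_inj P_closed h(4) by blast
    then show False using xne P_closed h(4) by blast
  qed
  \<comment> \<open>The assumptions \<open>T\<close> describe either of the two loops. From
    \<open>u\<close> the face runs through \<open>q\<close>, \<open>s\<close>, \<open>y u\<close>,
    from \<open>w\<close> through \<open>r\<close>, \<open>y w\<close>; since seven steps of
    \<open>z\<close> return to the start, only the distances 3, 4 and 5 from \<open>u\<close> to
    \<open>w\<close> survive.\<close>
  have uw: False
    if T: "{p, q, s} \<subseteq> P" "x p = q" "x q = p" "x s = u" "x u = s" "y q = p" "y p = s" "y s = q"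
      and u: "u \<in> P" "u \<noteq> r" "z u = q" "z q = s" "z s = y u" "w \<noteq> q" "w \<noteq> s" "w \<noteq> u"
      and i: "i < 7" "(z ^^ i) u = w" for p q s u i
  proof -
    have u3: "(z ^^ 3) u = y u" using u by (simp add: numeral_3_eq_3)
    have w2: "(z ^^ 2) w = y w" using z_rules by (simp add: numeral_2_eq_2)
    have split: "(z ^^ (j + k)) a = (z ^^ j) ((z ^^ k) a)" for j k a by (simp add: funpow_add)
    have yP: "y u \<in> P" "y w \<in> P" "x (y u) \<in> P" "x (y w) \<in> P" using u inP P_closed by blast+
    have ret: "(z ^^ (7 - i)) w = u"
      using split[of "7 - i" i u] i z7[OF u(1)] by simp
    have "i \<noteq> 0" using i(2) u(8) by (metis funpow_0)
    moreover have "i \<noteq> 1" "i \<noteq> 2" using i(2) u(3,4,6,7) by (auto simp: numeral_2_eq_2)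
    moreover have "i \<noteq> 6" using ret z_rules u(2) by auto
    ultimately consider "i = 3" | "i = 4" | "i = 5" using i(1) by linarith
    then show False
    proof cases
      case 1
      have yu: "y u = w" using i u3 1 by simp
      have "(z ^^ 4) w = u" using ret 1 by simp
      then have "z (z (z (z w))) = u" by (simp add: eval_nat_numeral)
      then have zzu: "z (z (y w)) = u" using w2 by (simp add: numeral_2_eq_2)
      \<comment> \<open>The relations force \<open>y ?c = ?c\<close>, so \<open>?c\<close> is the
        leaf \<open>r\<close>; then \<open>?b = w\<close>, and \<open>w\<close> would be fixed by
        \<open>y\<close> too. Distance 5 is settled in the same way.\<close>
      let ?b = "y w" and ?c = "z (y w)"
      have yb: "y ?b = u" using yu yyy u by metis
      have "y (x ?c) = y ?b" using zzu yb by (simp add: zz)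
      then have "x ?c = ?b" using y_inj zP yP P_closed by blast
      then have "x ?b = ?c" using xx zP yP by metis
      then have "y ?c = ?c" by (simp add: zz)
      then have "?c = r" using r_unique zP yP by blast
      then have "x r = ?b" using \<open>x ?c = ?b\<close> by simp
      then have "y w = w" using x_rules by simp
      then have "w = r" using r_unique inP by blast
      then show False using w_ne by simp
    next
      case 2
      have zyu: "z (y u) = w" using i split[of 1 3 u] u3 2 by simp
      have "(z ^^ 3) w = u" using ret 2 by simp
      then have "z (z (z w)) = u" by (simp add: eval_nat_numeral)
      then have zyw: "z (y w) = u" using w2 by (simp add: numeral_2_eq_2)
      let ?b = "y u" and ?c = "y w"
      have "y (x ?b) = y (y ?c)" using zyu yyy[OF inP(7)] by (simp add: zz)
      then have xb: "x ?b = y ?c" using y_inj yP P_closed by blast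
      have "y (x ?c) = y (y ?b)" using zyw yyy[OF u(1)] by (simp add: zz)
      then have xc: "x ?c = y ?b" using y_inj yP P_closed by blast
      have xyc: "x (y ?c) = ?b" "x (y ?b) = ?c" using xb xc xx yP by metis+
      \<comment> \<open>The loop, the leaf and the cycles of \<open>y\<close> through
        \<open>u\<close> and \<open>w\<close> are closed under both permutations, yet make up at
        most ten of the sixteen elements.\<close>
      let ?Q = "{p, q, s, r, u, ?b, y ?b, w, ?c, y ?c}"
      have "card ?Q < 16"
        using card_length[of "[p, q, s, r, u, ?b, y ?b, w, ?c, y ?c]"]
        by (simp only: list.set length_Cons list.size(3))
      moreover have "x ` ?Q \<subseteq> ?Q" using T xb xc xyc x_rules by auto
      moreover have "y ` ?Q \<subseteq> ?Q" using T yyy u inP r by auto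
      moreover have "?Q \<subseteq> P" using T u r inP P_closed by auto
      ultimately show False using small[of ?Q] by blast
    next
      case 3
      have zzyu: "z (z (y u)) = w" using i split[of 2 3 u] u3 3 by (simp add: numeral_2_eq_2)
      have yw: "y w = u" using ret w2 3 by simp
      let ?b = "y u" and ?c = "z (y u)"
      have yb: "y ?b = w" using yw yyy[OF inP(7)] by simp
      have "y (x ?c) = y ?b" using zzyu yb by (simp add: zz)
      then have "x ?c = ?b" using y_inj zP yP P_closed by blast
      then have "x ?b = ?c" using xx zP yP by metis
      then have "y ?c = ?c" by (simp add: zz)
      then have "?c = r" using r_unique zP yP by blast
      then have "y u = w" using \<open>x ?c = ?b\<close> x_rules by simp
      then have "y w = w" using yb by simp
      then have "w = r" using r_unique inP by blast
      then show False using w_ne by simp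
    qed
  qed
  obtain i where i: "i < 7" "(z ^^ i) u1 = u2 \<or> (z ^^ i) u1 = w \<or> (z ^^ i) u2 = w"
    using same_face[OF inP(3,6,7) nf] by blast
  from i(2) consider "(z ^^ i) u1 = u2" | "(z ^^ i) u1 = w" | "(z ^^ i) u2 = w" by blast
  then show False
  proof cases
    case 1
    have split: "(z ^^ (j + k)) a = (z ^^ j) ((z ^^ k) a)" for j k a by (simp add: funpow_add)
    \<comment> \<open>Both \<open>u1\<close> and \<open>u2\<close> first run around their own loops
      for three steps, so only the distances 3 and 4 remain; \<open>uu\<close> refutes them with the
      roles of \<open>u1\<close> and \<open>u2\<close> exchanged.\<close>
    have 3: "(z ^^ 3) u1 = y u1" "(z ^^ 3) u2 = y u2"
      using z_rules by (simp_all add: numeral_3_eq_3)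
    have ret: "(z ^^ (7 - i)) u2 = u1"
      using split[of "7 - i" i u1] i(1) 1 z7[OF inP(3)] by simp
    have "i \<noteq> 0" using 1 u12 by (metis funpow_0)
    moreover have "i \<noteq> 1" "i \<noteq> 2" using 1 z_rules(1,3) u_ne(10) u2s by (auto simp: numeral_2_eq_2)
    moreover have "i \<noteq> 6" "i \<noteq> 5" using ret z_rules u_ne u1s by (auto simp: numeral_2_eq_2)
    ultimately consider "i = 3" | "i = 4" using i(1) by linarith
    then show False
    proof cases
      case i3: 1
      have "y u1 = u2" using 1 3 i3 by simp
      moreover have "z (y u2) = u1" using ret split[of 1 3 u2] 3 i3 by simp
      ultimately show False using uu inP by blast
    next
      case i4: 2
      have "z (y u1) = u2" using 1 split[of 1 3 u1] 3 i4 by simp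
      moreover have "y u2 = u1" using ret 3 i4 by simp
      ultimately show False using uu inP by blast
    qed
  next
    case 2
    show False
      by (rule uw[of p1 q1 s1 u1 i]) (use x_rules y_rules z_rules inP p w_ne u1r i(1) 2 in auto)
  next
    case 3
    show False
      by (rule uw[of p2 q2 s2 u2 i]) (use x_rules y_rules z_rules inP p w_ne u2r i(1) 3 in auto)
  qed
qed

end

section \<open>Monodromy of a cover with three branching points\<close>

text \<open>Polar coordinates with angle between -pi and pi describe the annulus slit along its left
  ray; the point reflection in \<open>c\<close> gives the other one. An arbitrary set
  \<open>J\<close> of radii covers punctured discs and neighbourhoods of infinity alike.\<close>

lemma connected_slit_annulus:
  assumes J: "connected J" "J \<subseteq> {0<..}"
  shows "connected {z::complex. norm (z - c) \<in> J \<and> (Im (z - c) \<noteq> 0 \<or> Re (z - c) > 0)}" (is "connected ?R")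
    and "connected {z::complex. norm (z - c) \<in> J \<and> (Im (z - c) \<noteq> 0 \<or> Re (z - c) < 0)}" (is "connected ?L")
proof -
  let ?f = "\<lambda>(r, t). c + rcis r t"
  have "?R = ?f ` (J \<times> {-pi<..<pi})"
  proof (intro equalityI subsetI)
    fix z assume z: "z \<in> ?R"
    have "Arg (z - c) \<noteq> pi" using z by (auto simp: Arg_eq_pi)
    then have "Arg (z - c) \<in> {-pi<..<pi}"
      using mpi_less_Arg[of "z - c"] Arg_le_pi[of "z - c"] by auto
    moreover have "z = ?f (norm (z - c), Arg (z - c))" by (simp add: rcis_cmod_Arg)
    ultimately show "z \<in> ?f ` (J \<times> {-pi<..<pi})" using z by (intro image_eqI) auto
  next
    fix z assume "z \<in> ?f ` (J \<times> {-pi<..<pi})"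
    then obtain r t where rt: "r \<in> J" "- pi < t" "t < pi" "z = c + rcis r t" by auto
    have r: "r > 0" using rt(1) J(2) by auto
    have "Im (z - c) \<noteq> 0 \<or> Re (z - c) > 0"
    proof (cases "sin t = 0")
      case True
      then have "t = 0" using sin_eq_0_pi rt by blast
      then show ?thesis using rt r by simp
    next
      case False
      then show ?thesis using rt r by simp
    qed
    moreover have "norm (z - c) \<in> J" using rt r by simp
    ultimately show "z \<in> ?R" by simp
  qed
  moreover have "connected (?f ` (J \<times> {-pi<..<pi}))"
  proof (rule connected_continuous_image)
    show "connected (J \<times> {-pi<..<pi})" using J by (intro connected_Times) auto
    show "continuous_on (J \<times> {-pi<..<pi}) ?f"
      unfolding rcis_def cis.ctr case_prod_unfold
      by (intro continuous_intros)
  qed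
  ultimately show R: "connected ?R" by simp
  have "?L = (\<lambda>z. 2 * c - z) ` ?R"
  proof (intro equalityI subsetI)
    fix z assume "z \<in> ?L"
    then have "2 * c - z \<in> ?R" by (auto simp: norm_minus_commute)
    moreover have "z = 2 * c - (2 * c - z)" by simp
    ultimately show "z \<in> (\<lambda>z. 2 * c - z) ` ?R" by blast
  qed (auto simp: norm_minus_commute)
  moreover have "connected ((\<lambda>z. 2 * c - z) ` ?R)"
    by (intro connected_continuous_image continuous_intros R)
  ultimately show "connected ?L" by simp
qed

lemma homeomorphic_map_imp_homeomorphism:
  assumes "homeomorphic_map (top_of_set S) (top_of_set T) f"
  shows "\<exists>g. homeomorphism S T f g"
proof -
  obtain g where g: "homeomorphic_maps (top_of_set S) (top_of_set T) f g"
    using assms homeomorphic_map_maps by blast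
  then have "f ` S = T" "g ` T = S"
    using homeomorphic_imp_surjective_map homeomorphic_maps_map by (metis topspace_euclidean_subtopology)+
  then have "homeomorphism S T f g"
    using g unfolding homeomorphic_maps_def homeomorphism_def
    by (auto simp: continuous_map_in_subtopology)
  then show ?thesis by blast
qed

text \<open>What the monodromy argument takes from a local model: the punctured disc becomes one
  cycle because it is connected, of length \<open>k\<close> because it is k-to-one.\<close>

lemma local_model_punctured_disc:
  assumes lm: "local_model X Y f x k" and W: "openin X W" "x \<in> W"
    and W': "openin Y W'" "f x \<in> W'"
  shows "\<exists>U V. openin X U \<and> x \<in> U \<and> U \<subseteq> W \<and> openin Y V \<and> f x \<in> V \<and> V \<subseteq> W' \<and>
    connectedin X (U - {x}) \<and> f ` (U - {x}) \<subseteq> V - {f x} \<and>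
    (\<forall>y\<in>V - {f x}. finite {u \<in> U - {x}. f u = y} \<and> card {u \<in> U - {x}. f u = y} = k)"
proof -
  obtain U V \<phi> \<psi> r where
    U: "r > (0::real)" "k \<ge> 1" "openin X U" "U \<subseteq> W" "x \<in> U" "openin Y V" "V \<subseteq> W'"
    "homeomorphic_map (subtopology X U) (top_of_set (ball (0::complex) r)) \<phi>"
    "homeomorphic_map (subtopology Y V) (top_of_set (ball (0::complex) (r ^ k))) \<psi>"
    "\<phi> x = 0" "\<psi> (f x) = 0" "\<And>u. u \<in> U \<Longrightarrow> f u \<in> V \<and> \<psi> (f u) = \<phi> u ^ k"
    by (rule local_model_discs[OF lm W W']) (rule that)
  have sub: "U \<subseteq> topspace X" using openin_subset[OF U(3)] .
  have bij: "inj_on \<phi> U" "\<phi> ` U = ball 0 r"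
    using homeomorphic_imp_surjective_map[OF U(8)] homeomorphic_imp_injective_map[OF U(8)] sub
    by (simp_all add: Int_absorb1)
  have im: "\<phi> ` (U - {x}) = ball 0 r - {0}"
    using bij U(5,10) inj_on_image_set_diff[OF bij(1), of U "{x}"] by simp
  have "connected (ball (0::complex) r - {0})" by (rule connected_punctured_ball) simp
  then have "connectedin (top_of_set (ball 0 r)) (\<phi> ` (U - {x}))"
    unfolding im by (auto simp: connectedin_subtopology)
  then have "connectedin (subtopology X U) (U - {x})"
    using homeomorphic_map_connectedness[OF U(8), of "U - {x}"] sub by (simp add: subset_iff)
  then have conn: "connectedin X (U - {x})" by (simp add: connectedin_subtopology)
  have ne: "f u \<noteq> f x" if "u \<in> U - {x}" for u
  proof
    assume "f u = f x"
    then have "\<phi> u ^ k = 0" using U(11) U(12)[of u] that by simp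
    then have "\<phi> u = 0" by simp
    moreover have "\<phi> u \<in> ball 0 r - {0}" using that im by blast
    ultimately show False by simp
  qed
  have "finite {u \<in> U - {x}. f u = y} \<and> card {u \<in> U - {x}. f u = y} = k" if y: "y \<in> V - {f x}" for y
  proof -
    have "{u \<in> U - {x}. f u = y} = {u \<in> U. f u = y}" using y by auto
    then show ?thesis
      using local_model_fibre_card[OF U(1,2,3,5,6,8,9,10,11,12), of y] y by simp
  qed
  moreover have "f ` (U - {x}) \<subseteq> V - {f x}"
  proof (rule image_subsetI)
    fix u assume u: "u \<in> U - {x}"
    then show "f u \<in> V - {f x}" using ne[OF u] U(12)[of u] by simp
  qed
  moreover have "f x \<in> V" using U(12)[OF U(5)] by simp
  ultimately show ?thesis
    using U(3-7) conn by (intro exI[of _ U] exI[of _ V] conjI ballI) simp_all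
qed

text \<open>The coordinate \<open>g\<close> puts the branching points at 0, 1 and infinity. The sum
  condition \<open>sumB\<close> serves to show that discs around the points over a branching point
  contain the entire nearby fibres.\<close>

locale three_branching_points =
  fixes f :: "real^3 \<Rightarrow> real^3" and d :: nat and y0 y1 y2 :: "real^3"
    and g :: "real^3 \<Rightarrow> complex" and e :: "complex \<Rightarrow> real^3"
  assumes bc: "branched_cover S2 S2 f" and hd: "has_degree S2 S2 f d" and d: "d > 0"
    and B: "branching_points S2 S2 f = {y0, y1, y2}"
    and finB: "\<And>y. y \<in> {y0, y1, y2} \<Longrightarrow> finite (fibre S2 f y)"
    and sumB: "\<And>y. y \<in> {y0, y1, y2} \<Longrightarrow> (\<Sum>x\<in>fibre S2 f y. local_degree S2 S2 f x) = d"
    and g: "homeomorphism (sphere 0 1 - {y2}) UNIV g e" and g0: "g y0 = 0" and g1: "g y1 = 1"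
    and y_ne: "y0 \<noteq> y2" "y1 \<noteq> y2"
begin

lemma y_sphere: "y0 \<in> sphere 0 1" "y1 \<in> sphere 0 1" "y2 \<in> sphere 0 1"
  using B topspace_S2 by (auto simp: branching_points_def)

lemma e_facts:
  shows eg: "v \<in> sphere 0 1 \<Longrightarrow> v \<noteq> y2 \<Longrightarrow> e (g v) = v" and ge: "g (e z) = z"
    and eS: "e z \<in> sphere 0 1" and ey2: "e z \<noteq> y2"
proof -
  have 1: "\<And>v. v \<in> sphere 0 1 - {y2} \<Longrightarrow> e (g v) = v" "\<And>z. g (e z) = z" "\<And>z. e z \<in> sphere 0 1 - {y2}"
    using g unfolding homeomorphism_def by blast+
  show "v \<in> sphere 0 1 \<Longrightarrow> v \<noteq> y2 \<Longrightarrow> e (g v) = v" using 1(1) by blast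
  show "g (e z) = z" by (rule 1(2))
  show "e z \<in> sphere 0 1" "e z \<noteq> y2" using 1(3)[of z] by blast+
qed

lemma e0: "e 0 = y0" and e1: "e 1 = y1"
  using eg[OF y_sphere(1) y_ne(1)] eg[OF y_sphere(2) y_ne(2)] g0 g1 by simp_all

lemma f_sphere: "x \<in> sphere 0 1 \<Longrightarrow> f x \<in> sphere 0 1"
  using bc topspace_S2 unfolding branched_cover_def continuous_map_def by auto

lemma f_continuous: "continuous_on (sphere 0 1) f"
  using bc unfolding branched_cover_def S2_def by (simp add: continuous_map_in_subtopology)

lemma local_model_degree:
  assumes "x \<in> sphere 0 1"
  shows "local_model S2 S2 f x (local_degree S2 S2 f x)"
proof -
  obtain k where k: "local_model S2 S2 f x k"
    using bc assms topspace_S2 unfolding branched_cover_def by blast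
  then have "local_degree S2 S2 f x = k"
    by (rule local_degree_eq) (use assms f_sphere topspace_S2 in auto)
  then show ?thesis using k by simp
qed

definition X where "X = {x \<in> sphere 0 1. f x \<notin> {y0, y1, y2}}"
definition p where "p x = g (f x)"

lemma f_X: "x \<in> X \<Longrightarrow> f x \<in> sphere 0 1 - {y0, y1, y2}"
  using f_sphere by (auto simp: X_def)

lemma openin_S2_minus: "openin S2 (sphere 0 1 - {y0, y1, y2})"
proof -
  have "openin (top_of_set (sphere 0 1)) (sphere 0 1 \<inter> - {y0, y1, y2})"
    by (rule openin_open_Int) (auto intro: finite_imp_closed)
  then show ?thesis by (simp add: S2_def Diff_eq)
qed

lemma X_open: "openin S2 X"
proof -
  have "openin S2 {x \<in> topspace S2. f x \<in> sphere 0 1 - {y0, y1, y2}}"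
    using bc unfolding branched_cover_def
    by (intro openin_continuous_map_preimage[OF _ openin_S2_minus]) simp
  moreover have "{x \<in> topspace S2. f x \<in> sphere 0 1 - {y0, y1, y2}} = X"
    using f_sphere by (auto simp: X_def topspace_S2)
  ultimately show ?thesis by simp
qed

lemma openin_X: "openin S2 U \<Longrightarrow> U \<subseteq> X \<Longrightarrow> openin (top_of_set X) U"
  unfolding S2_def by (rule openin_subset_trans) (auto simp: X_def)

lemma g_open:
  assumes "openin S2 V" "V \<subseteq> sphere 0 1 - {y2}"
  shows "open (g ` V)"
proof -
  have "openin (top_of_set (sphere 0 1 - {y2})) V"
    using assms unfolding S2_def by (rule openin_subset_trans) auto
  then have "openin (top_of_set UNIV) (g ` V)"
    by (rule homeomorphism_imp_open_map[OF g])
  then show ?thesis by simp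
qed

lemma e_open:
  assumes "open A"
  shows "openin S2 (e ` A)"
proof -
  have "homeomorphism UNIV (sphere 0 1 - {y2}) e g" using g homeomorphism_sym by blast
  then have "openin (top_of_set (sphere 0 1 - {y2})) (e ` A)"
    using assms by (intro homeomorphism_imp_open_map) auto
  moreover have "openin (top_of_set (sphere 0 1)) (sphere 0 1 - {y2})"
    by (metis openin_delete openin_subtopology_self)
  ultimately show ?thesis unfolding S2_def by (rule openin_trans)
qed

lemma g_inj: "v \<in> sphere 0 1 - {y2} \<Longrightarrow> w \<in> sphere 0 1 - {y2} \<Longrightarrow> g v = g w \<Longrightarrow> v = w"
  using eg by (metis DiffE singletonI)

lemma p_fibre:
  assumes "z \<notin> {0, 1}"
  shows "{x \<in> X. p x = z} = fibre S2 f (e z)"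
proof -
  have ez: "e z \<notin> {y0, y1, y2}"
    using assms ge g0 g1 ey2 by (metis empty_iff insert_iff)
  show ?thesis
  proof (intro equalityI subsetI)
    fix x assume x: "x \<in> {x \<in> X. p x = z}"
    then have "f x = e z" using eg[of "f x"] f_X by (auto simp: p_def)
    then show "x \<in> fibre S2 f (e z)" using x by (simp add: fibre_def X_def topspace_S2)
  next
    fix x assume "x \<in> fibre S2 f (e z)"
    then have "x \<in> sphere 0 1" "f x = e z" by (auto simp: fibre_def topspace_S2)
    then show "x \<in> {x \<in> X. p x = z}" using ez ge by (simp add: X_def p_def)
  qed
qed

lemma p_card:
  assumes "z \<notin> {0, 1}"
  shows "finite {x \<in> X. p x = z} \<and> card {x \<in> X. p x = z} = d"
proof -
  have "e z \<in> topspace S2 - branching_points S2 S2 f"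
    using eS B assms ge g0 g1 ey2 topspace_S2 by (metis DiffI empty_iff insert_iff)
  then show ?thesis using hd unfolding has_degree_def p_fibre[OF assms] by blast
qed

lemma p_in: "x \<in> X \<Longrightarrow> p x \<in> - {0, 1}"
  using f_X[of x] g_inj[of "f x" y0] g_inj[of "f x" y1] y_sphere y_ne g0 g1 by (auto simp: p_def)

lemma p_continuous: "continuous_on X p"
proof -
  have "continuous_on (sphere 0 1 - {y2}) g" using g by (simp add: homeomorphism_def)
  moreover have "continuous_on X f" by (rule continuous_on_subset[OF f_continuous]) (auto simp: X_def)
  moreover have "f ` X \<subseteq> sphere 0 1 - {y2}" using f_X by auto
  ultimately show ?thesis unfolding p_def by (rule continuous_on_compose2)
qed

text \<open>Off the branching points the exponent is 1, so \<open>f\<close> is locally one chart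
  followed by the inverse of the other.\<close>

lemma p_local_homeomorphism:
  assumes x: "x \<in> X"
  shows "\<exists>U q. x \<in> U \<and> openin (top_of_set X) U \<and>
      openin (top_of_set (- {0, 1})) (p ` U) \<and> homeomorphism U (p ` U) p q"
proof -
  have xS: "x \<in> sphere 0 1" using x by (simp add: X_def)
  have lm: "local_model S2 S2 f x (local_degree S2 S2 f x)" by (rule local_model_degree[OF xS])
  have "f x \<notin> branching_points S2 S2 f" using B f_X[OF x] by simp
  then have "\<not> local_degree S2 S2 f x > 1"
    using f_sphere[OF xS] xS topspace_S2 by (auto simp: branching_points_def fibre_def)
  moreover have "local_degree S2 S2 f x \<ge> 1" using lm by (simp add: local_model_def)
  ultimately have lm1: "local_model S2 S2 f x 1" using lm by (metis le_neq_implies_less)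
  obtain U V \<phi> \<psi> r where
    U: "r > (0::real)" "(1::nat) \<ge> 1" "openin S2 U" "U \<subseteq> X" "x \<in> U" "openin S2 V"
    "V \<subseteq> sphere 0 1 - {y0, y1, y2}"
    "homeomorphic_map (subtopology S2 U) (top_of_set (ball (0::complex) r)) \<phi>"
    "homeomorphic_map (subtopology S2 V) (top_of_set (ball (0::complex) (r ^ 1))) \<psi>"
    "\<phi> x = 0" "\<psi> (f x) = 0" "\<And>u. u \<in> U \<Longrightarrow> f u \<in> V \<and> \<psi> (f u) = \<phi> u ^ 1"
    by (rule local_model_discs[OF lm1 X_open x openin_S2_minus f_X[OF x]]) (rule that)
  have sub: "U \<subseteq> sphere 0 1" "V \<subseteq> sphere 0 1" using openin_subset[OF U(3)] openin_subset[OF U(6)] topspace_S2 by auto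
  obtain \<psi>' where \<psi>': "homeomorphic_maps (subtopology S2 V) (top_of_set (ball (0::complex) (r ^ 1))) \<psi> \<psi>'"
    using U(9) homeomorphic_map_maps by blast
  have top: "topspace (subtopology S2 U) = U" "topspace (subtopology S2 V) = V"
    using sub by (simp_all add: topspace_S2 inf_absorb2)
  have "homeomorphic_map (top_of_set (ball 0 r)) (subtopology S2 V) \<psi>'"
    using \<psi>' homeomorphic_maps_map by (metis power_one_right)
  then have "homeomorphic_map (subtopology S2 U) (subtopology S2 V) (\<psi>' \<circ> \<phi>)"
    by (rule homeomorphic_map_compose[OF U(8)])
  moreover have "(\<psi>' \<circ> \<phi>) u = f u" if "u \<in> topspace (subtopology S2 U)" for u
  proof -
    have u: "u \<in> U" using that top by simp
    have "\<psi>' (\<psi> (f u)) = f u"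
      using \<psi>' U(12)[OF u] top(2) unfolding homeomorphic_maps_map by blast
    then show ?thesis using U(12)[OF u] by simp
  qed
  ultimately have "homeomorphic_map (subtopology S2 U) (subtopology S2 V) f"
    by (rule homeomorphic_map_eq)
  then have "homeomorphic_map (top_of_set U) (top_of_set V) f"
    using sub by (simp add: S2_def subtopology_subtopology inf_absorb2)
  then obtain q where q: "homeomorphism U V f q" using homeomorphic_map_imp_homeomorphism by blast
  have V: "V \<subseteq> sphere 0 1 - {y2}" using U(7) by auto
  have "homeomorphism V (g ` V) g e"
    by (rule homeomorphism_of_subsets[OF g V]) auto
  then have h: "homeomorphism U (g ` V) (g \<circ> f) (q \<circ> e)"
    by (rule homeomorphism_compose[OF q])
  have gf: "g \<circ> f = p" by (simp add: p_def fun_eq_iff)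
  have pU: "p ` U = g ` V" using h unfolding gf homeomorphism_def by blast
  have "open (p ` U)" unfolding pU by (rule g_open[OF U(6) V])
  moreover have "p ` U \<subseteq> - {0, 1}" by (rule image_subsetI, rule p_in, rule subsetD[OF U(4)])
  ultimately have "openin (top_of_set (- {0, 1})) (p ` U)" by (rule open_subset[rotated])
  then show ?thesis
    using h U(5) openin_X[OF U(3,4)] unfolding gf by (intro exI[of _ U] exI[of _ "q \<circ> e"]) (simp add: pU)
qed

lemma covering: "covering_space X p (- {0, 1})"
proof (rule covering_space_if_card_fibres[OF p_continuous _ d])
  show "p ` X \<subseteq> - {0, 1}" by (rule image_subsetI, rule p_in)
qed (use p_local_homeomorphism p_card in auto)

sublocale punctured_plane_cover X p
  by unfold_locales (rule covering)

text \<open>\<open>X\<close> is the sphere minus a finite set. A chart punctured at a removed point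
  \<open>b\<close>, taken over \<open>y2\<close>, turns it into the plane minus a finite
  set.\<close>

lemma X_connected: "connected X"
proof -
  have "fibre S2 f y2 \<noteq> {}" using sumB[of y2] d by auto
  then obtain b where b: "b \<in> sphere 0 1" "f b = y2" by (auto simp: fibre_def topspace_S2)
  obtain h k where h: "homeomorphism (sphere 0 1 - {b}) (UNIV :: complex set) h k"
    by (rule sphere_chart[OF b(1)]) (rule that)
  let ?F = "fibre S2 f y0 \<union> fibre S2 f y1 \<union> fibre S2 f y2"
  have XF: "X = sphere 0 1 - ?F" by (auto simp: X_def fibre_def topspace_S2)
  have bF: "b \<in> ?F" using b by (simp add: fibre_def topspace_S2)
  have hk: "\<And>v. v \<in> sphere 0 1 - {b} \<Longrightarrow> k (h v) = v" "\<And>z. h (k z) = z"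
    "\<And>z. k z \<in> sphere 0 1 - {b}" "continuous_on UNIV k"
    using h unfolding homeomorphism_def by blast+
  have "X = k ` (UNIV - h ` (?F - {b}))"
  proof (intro equalityI subsetI)
    fix x assume x: "x \<in> X"
    then have xb: "x \<in> sphere 0 1 - {b}" using XF bF by blast
    have "h x \<notin> h ` (?F - {b})"
    proof
      assume "h x \<in> h ` (?F - {b})"
      then obtain w where w: "w \<in> ?F - {b}" "h x = h w" by blast
      then have "w \<in> sphere 0 1 - {b}" by (auto simp: fibre_def topspace_S2)
      then have "x = w" using hk(1) xb w(2) by metis
      then show False using w x XF by blast
    qed
    then show "x \<in> k ` (UNIV - h ` (?F - {b}))" using hk(1)[OF xb] by (metis DiffI UNIV_I imageI)
  next
    fix x assume "x \<in> k ` (UNIV - h ` (?F - {b}))"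
    then obtain z where z: "x = k z" "z \<notin> h ` (?F - {b})" by blast
    have "k z \<notin> ?F"
    proof
      assume "k z \<in> ?F"
      then have "h (k z) \<in> h ` (?F - {b})" using hk(3)[of z] by blast
      then show False using z(2) hk(2) by simp
    qed
    then show "x \<in> X" using hk(3)[of z] z(1) XF by blast
  qed
  moreover have "connected (UNIV - h ` (?F - {b}))"
    using finB by (intro connected_open_delete_finite) auto
  ultimately show ?thesis
    by (metis connected_continuous_image continuous_on_subset hk(4) subset_UNIV)
qed

text \<open>The permutation \<open>s\<close> belongs to the loop that descends through
  \<open>D\<close> and returns through \<open>D'\<close>. The punctured discs over \<open>y\<close>
  serve as the sets \<open>K\<close> in \<open>vertex_orbits\<close>, and their local degrees become
  the cycle lengths.\<close>

lemma vertex_cycle_type: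
  assumes y: "y \<in> {y0, y1, y2}" and D: "D \<in> slits" "D' \<in> slits"
    and nbhd: "\<And>W. openin S2 W \<Longrightarrow> y \<in> W \<Longrightarrow> \<exists>W1. openin S2 W1 \<and> y \<in> W1 \<and> W1 \<subseteq> W \<and>
      W1 - {y} \<subseteq> sphere 0 1 - {y0, y1, y2} \<and> g ` (W1 - {y}) \<subseteq> D \<union> D' \<and>
      connected (g ` (W1 - {y}) \<inter> D) \<and> connected (g ` (W1 - {y}) \<inter> D') \<and>
      g ` (W1 - {y}) \<inter> upper \<noteq> {} \<and> g ` (W1 - {y}) \<inter> lower \<noteq> {}"
    and s: "\<And>a. a \<in> P \<Longrightarrow> s a \<in> P" "\<And>a. a \<in> P \<Longrightarrow> \<beta> D' (s a) = \<beta> D a"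
  shows "has_cycle_type P s (local_degrees_over S2 S2 f y)"
proof -
  let ?I = "fibre S2 f y" and ?k = "local_degree S2 S2 f"
  have finI: "finite ?I" using finB[OF y] .
  have I: "x \<in> sphere 0 1" "f x = y" if "x \<in> ?I" for x
    using that by (auto simp: fibre_def topspace_S2)
  have yS: "y \<in> sphere 0 1" using y y_sphere by blast
  \<comment> \<open>Two neighbourhoods are chosen: \<open>W1\<close> controls where the discs are
    mapped; \<open>W2\<close>, chosen after the discs, lies in all their targets \<open>V x\<close>,
    so that each of its points other than \<open>y\<close> has the full number of preimages in every
    disc.\<close>
  obtain W1 where W1: "openin S2 W1" "y \<in> W1" "W1 - {y} \<subseteq> sphere 0 1 - {y0, y1, y2}"
    "g ` (W1 - {y}) \<subseteq> D \<union> D'"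
    using nbhd[OF openin_topspace] yS topspace_S2 by metis
  obtain \<rho> where \<rho>: "\<rho> > 0"
    "\<And>x x'. x \<in> ?I \<Longrightarrow> x' \<in> ?I \<Longrightarrow> x \<noteq> x' \<Longrightarrow> ball x \<rho> \<inter> ball x' \<rho> = {}"
    by (rule finite_separated[OF finI]) (rule that)
  define good where "good x U V \<longleftrightarrow> openin S2 U \<and> x \<in> U \<and> U \<subseteq> sphere 0 1 \<inter> ball x \<rho> \<and>
    openin S2 V \<and> f x \<in> V \<and> V \<subseteq> W1 \<and> connectedin S2 (U - {x}) \<and> f ` (U - {x}) \<subseteq> V - {f x} \<and>
    (\<forall>y\<in>V - {f x}. finite {u \<in> U - {x}. f u = y} \<and> card {u \<in> U - {x}. f u = y} = ?k x)" for x U V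
  have "\<exists>U V. good x U V" if x: "x \<in> ?I" for x
    unfolding good_def
  proof (rule local_model_punctured_disc[OF local_model_degree[OF I(1)[OF x]]])
    show "openin S2 (sphere 0 1 \<inter> ball x \<rho>)" by (simp add: S2_def openin_open_Int)
    show "x \<in> sphere 0 1 \<inter> ball x \<rho>" using I[OF x] \<rho>(1) by simp
    show "openin S2 W1" "f x \<in> W1" using W1 I[OF x] by auto
  qed
  then obtain U V where good: "\<And>x. x \<in> ?I \<Longrightarrow> good x (U x) (V x)" by metis
  note UV = good[unfolded good_def]
  define K where "K x = U x - {x}" for x
  have fK: "f ` K x \<subseteq> W1 - {y}" if "x \<in> ?I" for x
    using UV[OF that] I(2)[OF that] unfolding K_def by blast
  have KX: "K x \<subseteq> X" if x: "x \<in> ?I" for x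
  proof
    fix u assume u: "u \<in> K x"
    then have "u \<in> sphere 0 1" using UV[OF x] unfolding K_def by blast
    moreover have "f u \<in> sphere 0 1 - {y0, y1, y2}" using fK[OF x] u W1(3) by blast
    ultimately show "u \<in> X" by (simp add: X_def)
  qed
  have K1: "connected (K x)" if "x \<in> ?I" for x
    using UV[OF that] unfolding K_def S2_def by (simp add: connectedin_subtopology)
  have K2: "openin (top_of_set X) (K x)" if x: "x \<in> ?I" for x
  proof (rule openin_X[OF _ KX[OF x]])
    have "openin (top_of_set (sphere 0 1)) (U x)" using UV[OF x] unfolding S2_def by blast
    then show "openin S2 (K x)" unfolding K_def S2_def by (rule openin_delete)
  qed
  have K3: "p ` K x \<subseteq> D \<union> D'" if x: "x \<in> ?I" for x
    using fK[OF x] W1(4) by (auto simp: p_def)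
  have K4: "K x \<inter> K x' = {}" if x: "x \<in> ?I" "x' \<in> ?I" "x \<noteq> x'" for x x'
    using UV[OF x(1)] UV[OF x(2)] \<rho>(2)[OF x] unfolding K_def by blast
  have "openin S2 (W1 \<inter> (\<Inter>x\<in>?I. V x))"
  proof (cases "?I = {}")
    case True
    then show ?thesis using W1 by simp
  next
    case False
    then show ?thesis using W1(1) UV finI by (intro openin_Int openin_INT2) simp_all
  qed
  moreover have "y \<in> W1 \<inter> (\<Inter>x\<in>?I. V x)" using W1(2) UV I(2) by fastforce
  ultimately obtain W2 where W2: "W2 \<subseteq> W1 \<inter> (\<Inter>x\<in>?I. V x)"
    "W2 - {y} \<subseteq> sphere 0 1 - {y0, y1, y2}"
    "connected (g ` (W2 - {y}) \<inter> D)" "connected (g ` (W2 - {y}) \<inter> D')"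
    "g ` (W2 - {y}) \<inter> upper \<noteq> {}" "g ` (W2 - {y}) \<inter> lower \<noteq> {}"
    using nbhd by metis
  let ?N = "g ` (W2 - {y})"
  have Kcard: "finite {u \<in> K x. f u = v} \<and> card {u \<in> K x. f u = v} = ?k x"
    if "x \<in> ?I" "v \<in> W2 - {y}" for x v
  proof -
    have "v \<in> V x - {f x}" using that W2(1) I(2)[OF that(1)] by blast
    then show ?thesis using UV[OF that(1)] unfolding K_def by blast
  qed
  have pf: "f u = v" if "u \<in> X" "v \<in> W2 - {y}" "p u = g v" for u v
    by (rule g_inj) (use that f_X[of u] W2(2) in \<open>auto simp: p_def\<close>)
  have cover: "{x \<in> X. p x \<in> ?N} \<subseteq> (\<Union>x\<in>?I. K x)"
  proof
    fix u assume u: "u \<in> {x \<in> X. p x \<in> ?N}"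
    then obtain v where v: "v \<in> W2 - {y}" "p u = g v" by auto
    have fu: "f u = v" using pf u v by blast
    let ?A = "\<lambda>x. {u \<in> K x. f u = v}"
    \<comment> \<open>The local degrees add up to d, the size of the nearby fibre, so no preimage is
      left outside the discs.\<close>
    have "card (\<Union>x\<in>?I. ?A x) = (\<Sum>x\<in>?I. card (?A x))"
      by (rule card_UN_disjoint[OF finI]) (use Kcard v K4 in blast)+
    also have "\<dots> = (\<Sum>x\<in>?I. ?k x)" using Kcard v by simp
    also have "\<dots> = d" by (rule sumB[OF y])
    finally have c: "card (\<Union>x\<in>?I. ?A x) = d" .
    have "v \<in> topspace S2 - branching_points S2 S2 f" using v W2(2) B topspace_S2 by blast
    then have fin: "finite (fibre S2 f v)" "card (fibre S2 f v) = d"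
      using hd unfolding has_degree_def by blast+
    have "(\<Union>x\<in>?I. ?A x) \<subseteq> fibre S2 f v"
      using KX unfolding fibre_def topspace_S2 X_def by blast
    then have "(\<Union>x\<in>?I. ?A x) = fibre S2 f v"
      using fin c by (intro card_subset_eq) auto
    moreover have "u \<in> fibre S2 f v" using u fu by (auto simp: fibre_def topspace_S2 X_def)
    ultimately show "u \<in> (\<Union>x\<in>?I. K x)" by blast
  qed
  obtain v where v: "v \<in> W2 - {y}" "g v \<in> upper" using W2(5) by blast
  obtain n' where n': "n' \<in> ?N" "n' \<in> lower" using W2(6) by blast
  have n: "g v \<in> ?N" using v by blast
  let ?O = "\<lambda>x. {a \<in> P. sec D a (g v) \<in> K x}"
  have K: "\<forall>x\<in>?I. connected (K x)" "\<forall>x\<in>?I. openin (top_of_set X) (K x)"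
    "\<forall>x\<in>?I. p ` K x \<subseteq> D \<union> D'" "\<forall>x\<in>?I. \<forall>x'\<in>?I. x \<noteq> x' \<longrightarrow> K x \<inter> K x' = {}"
    using K1 K2 K3 K4 by auto
  note orbits = vertex_orbits[OF D K cover W2(3,4) n v(2) n']
  have cardO: "card (?O x) = ?k x" if x: "x \<in> ?I" for x
  proof -
    have "{u \<in> K x. p u = g v} = {u \<in> K x. f u = v}"
      using pf[of _ v] v KX[OF x] by (auto simp: p_def)
    then show ?thesis using orbits(3)[OF x] Kcard[OF x v(1)] by simp
  qed
  have kpos: "?k x > 0" if "x \<in> ?I" for x
    using local_model_degree[OF I(1)[OF that]] by (simp add: local_model_def)
  have finP: "finite P"
    using p_card[of \<i>] by (simp add: P_def complex_eq_iff)
  have sinj: "inj_on s P"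
  proof (rule inj_onI)
    fix a b assume ab: "a \<in> P" "b \<in> P" "s a = s b"
    then have "\<beta> D a = \<beta> D b" using s(2) by metis
    then show "a = b" using \<beta>_bij[OF D(1)] ab by (meson bij_betw_imp_inj_on inj_onD)
  qed
  have On: "?O x \<noteq> {}" if "x \<in> ?I" for x
    using cardO[OF that] kpos[OF that] by (metis card.empty less_irrefl)
  have injO: "inj_on ?O ?I"
  proof (rule inj_onI, rule ccontr)
    fix x x' assume x: "x \<in> ?I" "x' \<in> ?I" "?O x = ?O x'" "x \<noteq> x'"
    then show False using orbits(2)[OF x(1,2,4)] On[OF x(1)] by simp
  qed
  show ?thesis
    unfolding has_cycle_type_def
  proof (intro exI conjI ballI allI impI)
    show "finite (?O ` ?I)" using finI by simp
    show "\<Union> (?O ` ?I) = P" using orbits(1) by simp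
    show "disjoint (?O ` ?I)"
    proof (rule pairwise_imageI)
      fix x x' assume x: "x \<in> ?I" "x' \<in> ?I" "x \<noteq> x'"
      show "disjnt (?O x) (?O x')" using orbits(2)[OF x] by (simp add: disjnt_def)
    qed
    show "{} \<notin> ?O ` ?I" using On by blast
    fix C assume "C \<in> ?O ` ?I"
    then obtain x where x: "x \<in> ?I" "C = ?O x" by blast
    have CP: "C \<subseteq> P" using x by blast
    have sub: "s ` C \<subseteq> C"
    proof
      fix b assume "b \<in> s ` C"
      then obtain a where a: "a \<in> C" "b = s a" by blast
      then have "a \<in> P" using CP by blast
      then show "b \<in> C" using orbits(4)[OF x(1), of a b] a x(2) s by simp
    qed
    have "finite C" "inj_on s C" using finite_subset[OF CP finP] inj_on_subset[OF sinj CP] by blast+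
    then show "s ` C = C" using sub by (intro endo_inj_surj)
    fix Q assume Q: "Q \<subseteq> P" "s ` Q = Q"
    have "\<beta> D' ` s ` Q = \<beta> D ` Q"
      unfolding image_image by (rule image_cong[OF refl]) (use s(2) Q(1) in blast)
    then have "\<beta> D ` Q = \<beta> D' ` Q" using Q(2) by simp
    then show "C \<subseteq> Q \<or> C \<inter> Q = {}" using orbits(5)[OF x(1) Q(1)] x(2) by simp
  next
    have "image_mset card (mset_set (?O ` ?I)) = image_mset (\<lambda>x. card (?O x)) (mset_set ?I)"
      using injO by (simp add: multiset.map_comp comp_def flip: image_mset_mset_set)
    also have "\<dots> = image_mset ?k (mset_set ?I)"
      by (rule image_mset_cong) (use cardO finI in simp)
    finally show "image_mset card (mset_set (?O ` ?I)) = local_degrees_over S2 S2 f y"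
      by (simp add: local_degrees_over_def)
  qed
qed

text \<open>Close to \<open>c\<close> the two slit planes keep the real line left and right of
  \<open>c\<close>, so they meet a punctured disc in the two slit annuli of
  \<open>connected_slit_annulus\<close>.\<close>

lemma nbhd_finite:
  fixes c :: complex
  assumes c: "c = 0 \<or> c = 1" and y: "y = e c"
    and D: "\<And>z. norm (z - c) < 1 \<Longrightarrow> z \<in> D \<longleftrightarrow> Im (z - c) \<noteq> 0 \<or> Re (z - c) < 0"
      "\<And>z. norm (z - c) < 1 \<Longrightarrow> z \<in> D' \<longleftrightarrow> Im (z - c) \<noteq> 0 \<or> Re (z - c) > 0"
    and W: "openin S2 W" "y \<in> W"
  shows "\<exists>W1. openin S2 W1 \<and> y \<in> W1 \<and> W1 \<subseteq> W \<and>
      W1 - {y} \<subseteq> sphere 0 1 - {y0, y1, y2} \<and> g ` (W1 - {y}) \<subseteq> D \<union> D' \<and>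
      connected (g ` (W1 - {y}) \<inter> D) \<and> connected (g ` (W1 - {y}) \<inter> D') \<and>
      g ` (W1 - {y}) \<inter> upper \<noteq> {} \<and> g ` (W1 - {y}) \<inter> lower \<noteq> {}"
proof -
  have "openin S2 (W \<inter> e ` UNIV)" by (rule openin_Int[OF W(1) e_open]) simp
  moreover have "W \<inter> e ` UNIV \<subseteq> sphere 0 1 - {y2}" using eS ey2 by blast
  ultimately have "open (g ` (W \<inter> e ` UNIV))" by (rule g_open)
  moreover have "c \<in> g ` (W \<inter> e ` UNIV)" using W(2) ge y by (metis IntI UNIV_I imageI)
  ultimately obtain \<rho>0 where \<rho>0: "\<rho>0 > 0" "ball c \<rho>0 \<subseteq> g ` (W \<inter> e ` UNIV)"
    by (meson openE)
  \<comment> \<open>The bound 1 keeps the other finite puncture out of the disc.\<close>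
  define \<rho> where "\<rho> = min \<rho>0 1"
  have \<rho>: "\<rho> > 0" "\<rho> \<le> 1" "ball c \<rho> \<subseteq> g ` (W \<inter> e ` UNIV)"
    using \<rho>0 by (auto simp: \<rho>_def)
  let ?W = "e ` ball c \<rho>"
  let ?J = "{0<..<\<rho>}"
  have N: "g ` (?W - {y}) = {z. norm (z - c) \<in> ?J}"
  proof -
    have "?W - {y} = e ` (ball c \<rho> - {c})" unfolding y using ge by (metis (no_types, lifting) image_insert image_is_empty image_set_diff inj_on_inverseI image_empty)
    then have "g ` (?W - {y}) = ball c \<rho> - {c}" using ge by (simp add: image_image)
    then show ?thesis by (auto simp: dist_norm norm_minus_commute)
  qed
  have lt1: "norm (z - c) < 1" if "norm (z - c) \<in> ?J" for z using that \<rho> by auto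
  have ND: "g ` (?W - {y}) \<inter> D = {z. norm (z - c) \<in> ?J \<and> (Im (z - c) \<noteq> 0 \<or> Re (z - c) < 0)}"
    unfolding N using D(1) lt1 by blast
  have ND': "g ` (?W - {y}) \<inter> D' = {z. norm (z - c) \<in> ?J \<and> (Im (z - c) \<noteq> 0 \<or> Re (z - c) > 0)}"
    unfolding N using D(2) lt1 by blast
  have J: "connected ?J" "?J \<subseteq> {0<..}" by auto
  show ?thesis
  proof (intro exI[of _ ?W] conjI)
    show "openin S2 ?W" by (rule e_open) simp
    show "y \<in> ?W" using y \<rho>(1) by simp
    show "?W \<subseteq> W"
    proof
      fix v assume "v \<in> ?W"
      then obtain z where z: "v = e z" "z \<in> ball c \<rho>" by blast
      then obtain w where "w \<in> W" "w \<in> e ` UNIV" "z = g w" using \<rho>(3) by blast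
      then show "v \<in> W" using z ge by (metis imageE)
    qed
    show "?W - {y} \<subseteq> sphere 0 1 - {y0, y1, y2}"
    proof
      fix v assume v: "v \<in> ?W - {y}"
      then obtain z where z: "v = e z" by blast
      have "norm (z - c) \<in> ?J" using v N z ge by (metis (mono_tags, lifting) imageI mem_Collect_eq)
      then have "z \<noteq> 0" "z \<noteq> 1" using c \<rho>(2) by auto
      then show "v \<in> sphere 0 1 - {y0, y1, y2}"
        using z eS ey2 ge g0 g1 by (metis DiffI empty_iff insert_iff)
    qed
    show "g ` (?W - {y}) \<subseteq> D \<union> D'"
    proof
      fix z assume z: "z \<in> g ` (?W - {y})"
      then have "norm (z - c) \<in> ?J" unfolding N by simp
      moreover from this have "Im (z - c) \<noteq> 0 \<or> Re (z - c) < 0 \<or> Re (z - c) > 0"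
        by (metis complex_eq_iff greaterThanLessThan_iff linorder_neqE_linordered_idom norm_zero order_less_irrefl zero_complex.sel)
      ultimately show "z \<in> D \<union> D'" using D lt1 by blast
    qed
    show "connected (g ` (?W - {y}) \<inter> D)" unfolding ND by (rule connected_slit_annulus(2)[OF J])
    show "connected (g ` (?W - {y}) \<inter> D')" unfolding ND' by (rule connected_slit_annulus(1)[OF J])
    have "c + \<i> * of_real (\<rho> / 2) \<in> g ` (?W - {y}) \<inter> upper"
      "c - \<i> * of_real (\<rho> / 2) \<in> g ` (?W - {y}) \<inter> lower"
      unfolding N using \<rho>(1) c by (auto simp: upper_def lower_def norm_mult)
    then show "g ` (?W - {y}) \<inter> upper \<noteq> {}" "g ` (?W - {y}) \<inter> lower \<noteq> {}" by blast+
  qed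
qed

text \<open>For real z with |z| above \<open>R\<close>, which is at least 1, \<open>Re z > 1\<close>
  amounts to \<open>Re z > 0\<close>; so the planes again meet the neighbourhood in two slit annuli,
  now with all radii above \<open>R\<close>.\<close>

lemma nbhd_infinity:
  assumes W: "openin S2 W" "y2 \<in> W"
  defines "D \<equiv> slit_right" and "D' \<equiv> slit_left"
  shows "\<exists>W1. openin S2 W1 \<and> y2 \<in> W1 \<and> W1 \<subseteq> W \<and>
      W1 - {y2} \<subseteq> sphere 0 1 - {y0, y1, y2} \<and> g ` (W1 - {y2}) \<subseteq> D \<union> D' \<and>
      connected (g ` (W1 - {y2}) \<inter> D) \<and> connected (g ` (W1 - {y2}) \<inter> D') \<and>
      g ` (W1 - {y2}) \<inter> upper \<noteq> {} \<and> g ` (W1 - {y2}) \<inter> lower \<noteq> {}"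
proof -
  obtain T where T: "open T" "W = sphere 0 1 \<inter> T"
    using W(1) unfolding S2_def openin_open by blast
  have "compact (sphere 0 1 - T)" by (intro compact_diff T) simp
  moreover have "sphere 0 1 - T \<subseteq> sphere 0 1 - {y2}" using W(2) T(2) by blast
  moreover have "continuous_on (sphere 0 1 - {y2}) g" using g by (simp add: homeomorphism_def)
  ultimately have "bounded (g ` (sphere 0 1 - T))"
    by (intro compact_imp_bounded compact_continuous_image) (blast intro: continuous_on_subset)+
  then obtain R0 where R0: "\<And>v. v \<in> sphere 0 1 - T \<Longrightarrow> norm (g v) \<le> R0"
    unfolding bounded_iff by blast
  define R where "R = max R0 1"
  have R: "R \<ge> 1" "\<And>v. v \<in> sphere 0 1 - T \<Longrightarrow> norm (g v) \<le> R"
    using R0 by (auto simp: R_def intro: max.coboundedI1)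
  let ?W = "sphere 0 1 - e ` cball 0 R"
  let ?J = "{R<..}"
  have mem: "e z \<in> e ` cball 0 R \<longleftrightarrow> norm z \<le> R" for z
    using ge by (metis (no_types, lifting) dist_0_norm imageE imageI mem_cball)
  have N: "g ` (?W - {y2}) = {z. norm (z - 0) \<in> ?J}"
  proof (intro equalityI subsetI)
    fix z assume "z \<in> g ` (?W - {y2})"
    then obtain v where v: "v \<in> sphere 0 1" "v \<noteq> y2" "v \<notin> e ` cball 0 R" "z = g v" by blast
    then have "v = e z" using eg by simp
    then show "z \<in> {z. norm (z - 0) \<in> ?J}" using v(3) mem[of z] by simp
  next
    fix z :: complex assume "z \<in> {z. norm (z - 0) \<in> ?J}"
    then have "e z \<in> ?W - {y2}" using mem[of z] eS ey2 by auto
    then show "z \<in> g ` (?W - {y2})" using ge by (metis imageI)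
  qed
  have J: "connected ?J" "?J \<subseteq> {0<..}" using R(1) by auto
  have re: "Im z \<noteq> 0 \<or> Re z > 1 \<longleftrightarrow> Im z \<noteq> 0 \<or> Re z > 0" "Im z \<noteq> 0 \<or> Re z < 0 \<or> Re z > 0"
    if "norm z > R" for z
  proof -
    have "norm z = \<bar>Re z\<bar>" if "Im z = 0" using that by (simp add: norm_complex_def)
    then show "Im z \<noteq> 0 \<or> Re z > 1 \<longleftrightarrow> Im z \<noteq> 0 \<or> Re z > 0" "Im z \<noteq> 0 \<or> Re z < 0 \<or> Re z > 0"
      using that R(1) by auto
  qed
  have ND: "g ` (?W - {y2}) \<inter> D = {z. norm (z - 0) \<in> ?J \<and> (Im (z - 0) \<noteq> 0 \<or> Re (z - 0) < 0)}"
    unfolding N D_def by (auto simp: slits_mem)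
  have ND': "g ` (?W - {y2}) \<inter> D' = {z. norm (z - 0) \<in> ?J \<and> (Im (z - 0) \<noteq> 0 \<or> Re (z - 0) > 0)}"
    unfolding N D'_def using re by (auto simp: slits_mem)
  have ce: "continuous_on UNIV e" using g by (simp add: homeomorphism_def)
  have "closed (e ` cball 0 R)"
    by (intro compact_imp_closed compact_continuous_image continuous_on_subset[OF ce]) auto
  then have "openin (top_of_set (sphere 0 1)) (sphere 0 1 \<inter> - e ` cball 0 R)"
    by (intro openin_open_Int) auto
  then have op: "openin S2 ?W" by (simp add: S2_def Diff_eq)
  show ?thesis
  proof (intro exI[of _ ?W] conjI op)
    show "y2 \<in> ?W" using y_sphere ey2 by blast
    show "?W \<subseteq> W"
    proof
      fix v assume v: "v \<in> ?W"
      show "v \<in> W"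
      proof (rule ccontr)
        assume "v \<notin> W"
        then have "v \<in> sphere 0 1 - T" "v \<noteq> y2" using v T(2) W(2) by auto
        then have "norm (g v) \<le> R" "e (g v) = v" using R(2) eg by auto
        then show False using v mem[of "g v"] by simp
      qed
    qed
    show "?W - {y2} \<subseteq> sphere 0 1 - {y0, y1, y2}"
      using mem[of 0] mem[of 1] R(1) e0 e1 by auto
    show "g ` (?W - {y2}) \<subseteq> D \<union> D'"
      unfolding N D_def D'_def
    proof
      fix z :: complex assume "z \<in> {z. norm (z - 0) \<in> ?J}"
      then have "norm z > R" by simp
      then show "z \<in> slit_right \<union> slit_left" using re[of z] unfolding Un_iff slits_mem by blast
    qed
    show "connected (g ` (?W - {y2}) \<inter> D)" unfolding ND by (rule connected_slit_annulus(2)[OF J])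
    show "connected (g ` (?W - {y2}) \<inter> D')" unfolding ND' by (rule connected_slit_annulus(1)[OF J])
    have "\<i> * of_real (R + 1) \<in> g ` (?W - {y2}) \<inter> upper"
      "- (\<i> * of_real (R + 1)) \<in> g ` (?W - {y2}) \<inter> lower"
      unfolding N using R(1) by (auto simp: upper_def lower_def norm_mult simp del: of_real_add)
    then show "g ` (?W - {y2}) \<inter> upper \<noteq> {}" "g ` (?W - {y2}) \<inter> lower \<noteq> {}" by blast+
  qed
qed

text \<open>\<open>\<sigma>\<close> descends from i left of 0 and returns between 0 and 1, a loop
  around 0; \<open>\<tau>\<close> descends between 0 and 1 and returns right of 1, a loop around 1.
  In \<open>\<tau> \<circ> \<sigma>\<close> the passages between 0 and 1 cancel, leaving a loop
  around infinity.\<close>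

definition \<sigma> where "\<sigma> a = inv_into P (\<beta> slit_both) (\<beta> slit_right a)"
definition \<tau> where "\<tau> a = inv_into P (\<beta> slit_left) (\<beta> slit_both a)"

lemma in_slits: "slit_left \<in> slits" "slit_right \<in> slits" "slit_both \<in> slits"
  by (auto simp: slits_def)

lemma \<sigma>\<tau>:
  assumes "a \<in> P"
  shows "\<sigma> a \<in> P" "\<beta> slit_both (\<sigma> a) = \<beta> slit_right a" "\<tau> a \<in> P" "\<beta> slit_left (\<tau> a) = \<beta> slit_both a"
proof -
  have im: "\<beta> slit_both ` P = M" "\<beta> slit_left ` P = M" "\<beta> slit_right a \<in> M" "\<beta> slit_both a \<in> M"
    using \<beta>_bij in_slits assms unfolding bij_betw_def by blast+
  show "\<sigma> a \<in> P" "\<tau> a \<in> P" unfolding \<sigma>_def \<tau>_def using im by (metis inv_into_into)+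
  show "\<beta> slit_both (\<sigma> a) = \<beta> slit_right a" "\<beta> slit_left (\<tau> a) = \<beta> slit_both a"
    unfolding \<sigma>_def \<tau>_def using im by (metis f_inv_into_f)+
qed

theorem monodromy:
  shows "transitive_pair P \<sigma> \<tau>" and "card P = d"
    and "has_cycle_type P \<sigma> (local_degrees_over S2 S2 f y0)"
    and "has_cycle_type P \<tau> (local_degrees_over S2 S2 f y1)"
    and "has_cycle_type P (\<tau> \<circ> \<sigma>) (local_degrees_over S2 S2 f y2)"
proof -
  show cP: "card P = d" using p_card[of \<i>] by (simp add: P_def complex_eq_iff)
  then have finP: "finite P" using d card_gt_0_iff by blast
  have bij: "bij_betw s P P" if D: "D \<in> slits"
    and s: "\<And>a. a \<in> P \<Longrightarrow> s a \<in> P" "\<And>a. a \<in> P \<Longrightarrow> \<beta> D' (s a) = \<beta> D a" for s D D'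
  proof -
    have "inj_on s P"
    proof (rule inj_onI)
      fix a b assume ab: "a \<in> P" "b \<in> P" "s a = s b"
      then have "\<beta> D a = \<beta> D b" using s(2) by metis
      then show "a = b" using \<beta>_bij[OF D] ab by (meson bij_betw_imp_inj_on inj_onD)
    qed
    then show ?thesis using finP s(1) by (simp add: bij_betw_def endo_inj_surj image_subsetI)
  qed
  show "transitive_pair P \<sigma> \<tau>"
  proof
    show "finite P" by (rule finP)
    show "bij_betw \<sigma> P P" by (rule bij[OF in_slits(2) \<sigma>\<tau>(1,2)])
    show "bij_betw \<tau> P P" by (rule bij[OF in_slits(3) \<sigma>\<tau>(3,4)])
    fix Q assume Q: "Q \<subseteq> P" "\<sigma> ` Q = Q" "\<tau> ` Q = Q"
    \<comment> \<open>Invariance under \<open>\<sigma>\<close> and \<open>\<tau>\<close> means that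
      the three matchings have the same image on \<open>Q\<close>, as \<open>transitive\<close>
      demands.\<close>
    have "\<beta> slit_both ` \<sigma> ` Q = \<beta> slit_right ` Q" "\<beta> slit_left ` \<tau> ` Q = \<beta> slit_both ` Q"
      unfolding image_image by (rule image_cong[OF refl]; use \<sigma>\<tau> Q(1) in blast)+
    then have "\<beta> slit_both ` Q = \<beta> slit_right ` Q" "\<beta> slit_left ` Q = \<beta> slit_both ` Q"
      using Q by simp_all
    then have "\<beta> D ` Q = \<beta> D' ` Q" if "D \<in> slits" "D' \<in> slits" for D D'
      using that unfolding slits_def by (elim insertE emptyE) simp_all
    then show "Q = {} \<or> Q = P" using transitive[OF X_connected Q(1)] by blast
  qed
  show "has_cycle_type P \<sigma> (local_degrees_over S2 S2 f y0)"
  proof (rule vertex_cycle_type[where D = slit_right and D' = slit_both])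
    fix W assume "openin S2 W" "y0 \<in> W"
    then show "\<exists>W1. openin S2 W1 \<and> y0 \<in> W1 \<and> W1 \<subseteq> W \<and>
      W1 - {y0} \<subseteq> sphere 0 1 - {y0, y1, y2} \<and> g ` (W1 - {y0}) \<subseteq> slit_right \<union> slit_both \<and>
      connected (g ` (W1 - {y0}) \<inter> slit_right) \<and> connected (g ` (W1 - {y0}) \<inter> slit_both) \<and>
      g ` (W1 - {y0}) \<inter> upper \<noteq> {} \<and> g ` (W1 - {y0}) \<inter> lower \<noteq> {}"
    proof (rule nbhd_finite[of 0, rotated -2])
      fix z :: complex assume z: "norm (z - 0) < 1"
      show "z \<in> slit_right \<longleftrightarrow> Im (z - 0) \<noteq> 0 \<or> Re (z - 0) < 0" by (simp add: slits_mem)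
      have "Re z < 1" using z complex_Re_le_cmod[of z] by simp
      then show "z \<in> slit_both \<longleftrightarrow> Im (z - 0) \<noteq> 0 \<or> Re (z - 0) > 0" by (auto simp: slits_mem)
    qed (simp_all add: e0)
  qed (use in_slits \<sigma>\<tau> in auto)
  show "has_cycle_type P \<tau> (local_degrees_over S2 S2 f y1)"
  proof (rule vertex_cycle_type[where D = slit_both and D' = slit_left])
    fix W assume "openin S2 W" "y1 \<in> W"
    then show "\<exists>W1. openin S2 W1 \<and> y1 \<in> W1 \<and> W1 \<subseteq> W \<and>
      W1 - {y1} \<subseteq> sphere 0 1 - {y0, y1, y2} \<and> g ` (W1 - {y1}) \<subseteq> slit_both \<union> slit_left \<and>
      connected (g ` (W1 - {y1}) \<inter> slit_both) \<and> connected (g ` (W1 - {y1}) \<inter> slit_left) \<and>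
      g ` (W1 - {y1}) \<inter> upper \<noteq> {} \<and> g ` (W1 - {y1}) \<inter> lower \<noteq> {}"
    proof (rule nbhd_finite[of 1, rotated -2])
      fix z :: complex assume z: "norm (z - 1) < 1"
      have "Re z > 0" using z abs_Re_le_cmod[of "z - 1"] by simp
      then show "z \<in> slit_both \<longleftrightarrow> Im (z - 1) \<noteq> 0 \<or> Re (z - 1) < 0" by (auto simp: slits_mem)
      show "z \<in> slit_left \<longleftrightarrow> Im (z - 1) \<noteq> 0 \<or> Re (z - 1) > 0" by (simp add: slits_mem)
    qed (simp_all add: e1)
  qed (use in_slits \<sigma>\<tau> in auto)
  show "has_cycle_type P (\<tau> \<circ> \<sigma>) (local_degrees_over S2 S2 f y2)"
  proof (rule vertex_cycle_type[where D = slit_right and D' = slit_left])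
    fix W assume "openin S2 W" "y2 \<in> W"
    then show "\<exists>W1. openin S2 W1 \<and> y2 \<in> W1 \<and> W1 \<subseteq> W \<and>
      W1 - {y2} \<subseteq> sphere 0 1 - {y0, y1, y2} \<and> g ` (W1 - {y2}) \<subseteq> slit_right \<union> slit_left \<and>
      connected (g ` (W1 - {y2}) \<inter> slit_right) \<and> connected (g ` (W1 - {y2}) \<inter> slit_left) \<and>
      g ` (W1 - {y2}) \<inter> upper \<noteq> {} \<and> g ` (W1 - {y2}) \<inter> lower \<noteq> {}"
      by (rule nbhd_infinity)
  qed (use in_slits \<sigma>\<tau> in auto)
qed

end

theorem monodromy_of_realization:
  assumes f: "realizes S2 S2 d {# \<pi>0, \<pi>1, \<pi>2 #} f" and d: "d > 0"
    and part: "is_partition d \<pi>0" "is_partition d \<pi>1" "is_partition d \<pi>2"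
  obtains P and \<sigma> \<tau> :: "real^3 \<Rightarrow> real^3"
  where "transitive_pair P \<sigma> \<tau>" "card P = d" "has_cycle_type P \<sigma> \<pi>0" "has_cycle_type P \<tau> \<pi>1"
    "has_cycle_type P (\<tau> \<circ> \<sigma>) \<pi>2"
proof -
  let ?B = "branching_points S2 S2 f" and ?L = "local_degrees_over S2 S2 f"
  have f': "branched_cover S2 S2 f" "has_degree S2 S2 f d" "finite ?B"
    "\<And>y. y \<in> ?B \<Longrightarrow> finite (fibre S2 f y)" "image_mset ?L (mset_set ?B) = {# \<pi>0, \<pi>1, \<pi>2 #}"
    using f unfolding realizes_def by auto
  \<comment> \<open>Peeling partitions off the multiset names a branching point for each; the points
    are distinct, even if partitions coincide, because \<open>mset_set\<close> counts every point
    once.\<close>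
  obtain y0 N0 where y0: "mset_set ?B = add_mset y0 N0" "?L y0 = \<pi>0" "image_mset ?L N0 = {# \<pi>1, \<pi>2 #}"
    using msed_map_invR[OF f'(5)] by blast
  obtain y1 N1 where y1: "N0 = add_mset y1 N1" "?L y1 = \<pi>1" "image_mset ?L N1 = {# \<pi>2 #}"
    using msed_map_invR[OF y0(3)] by blast
  obtain y2 N2 where y2: "N1 = add_mset y2 N2" "?L y2 = \<pi>2" "image_mset ?L N2 = {#}"
    using msed_map_invR[OF y1(3)] by blast
  have M: "mset_set ?B = {# y0, y1, y2 #}" using y0(1) y1(1) y2 by simp
  have B: "?B = {y0, y1, y2}"
    using arg_cong[OF M, of set_mset] f'(3) by simp
  have "card ?B = 3" using arg_cong[OF M, of size] by simp
  then have ne: "y0 \<noteq> y1" "y0 \<noteq> y2" "y1 \<noteq> y2"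
    unfolding B by (auto simp: card_insert_if split: if_splits)
  have yS: "y0 \<in> sphere 0 1" "y1 \<in> sphere 0 1" "y2 \<in> sphere 0 1"
    using B by (auto simp: branching_points_def S2_def)
  obtain h k where h: "homeomorphism (sphere 0 1 - {y2}) (UNIV :: complex set) h k"
    by (rule sphere_chart[OF yS(3)]) (rule that)
  have hk: "\<And>v. v \<in> sphere 0 1 - {y2} \<Longrightarrow> k (h v) = v" using h unfolding homeomorphism_def by blast
  have h01: "h y1 - h y0 \<noteq> 0"
  proof
    assume "h y1 - h y0 = 0"
    then have "h y1 = h y0" by simp
    then show False using hk[of y0] hk[of y1] yS ne by auto
  qed
  \<comment> \<open>An affine change of coordinate moves the two finite branching points to 0 and
    1.\<close>
  let ?l = "\<lambda>z. (z - h y0) / (h y1 - h y0)" and ?m = "\<lambda>z. z * (h y1 - h y0) + h y0"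
  have "homeomorphism UNIV UNIV ?l ?m"
    unfolding homeomorphism_def
  proof (intro conjI ballI)
    show "continuous_on UNIV ?l" "continuous_on UNIV ?m" using h01 by (intro continuous_intros; simp)+
    have lm: "?l (?m z) = z" and ml: "?m (?l z) = z" for z using h01 by simp_all
    show "?m (?l z) = z" "?l (?m z) = z" for z by (fact ml lm)+
    show "range ?l = UNIV" "range ?m = UNIV"
      by (rule surjI[of ?l ?m, OF lm], rule surjI[of ?m ?l, OF ml])
  qed
  then have g: "homeomorphism (sphere 0 1 - {y2}) UNIV (?l \<circ> h) (k \<circ> ?m)"
    by (rule homeomorphism_compose[OF h])
  have sums: "(\<Sum>x\<in>fibre S2 f y. local_degree S2 S2 f x) = sum_mset (?L y)" for y
    by (simp add: local_degrees_over_def sum_unfold_sum_mset)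
  interpret three_branching_points f d y0 y1 y2 "?l \<circ> h" "k \<circ> ?m"
  proof
    show "(\<Sum>x\<in>fibre S2 f y. local_degree S2 S2 f x) = d" if "y \<in> {y0, y1, y2}" for y
      using that part y0(2) y1(2) y2(2) unfolding sums is_partition_def by auto
    show "finite (fibre S2 f y)" if "y \<in> {y0, y1, y2}" for y using f'(4) B that by simp
    show "(?l \<circ> h) y1 = 1" using h01 by simp
  qed (use f'(1,2) d B g ne in auto)
  show thesis
    using that[OF monodromy(1,2)] monodromy(3-5) y0(2) y1(2) y2(2) by simp
qed

theorem proposition4p2:
  shows "sphere_realizable 6 {# {#5, 1#}, {#4, 1, 1#}, replicate_mset 3 2 #} \<and>
    sphere_exceptional 8 {# {#5, 1, 1, 1#}, {#4, 4#}, replicate_mset 4 2 #} \<and>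
    sphere_realizable 8 {# {#7, 1#}, {#3, 3, 1, 1#}, replicate_mset 4 2 #} \<and>
    sphere_realizable 9 {# {#7, 1, 1#}, {#3, 3, 3#}, replicate_mset 4 2 + {#1#} #} \<and>
    sphere_realizable 10 {# {#8, 1, 1#}, {#3, 3, 3, 1#}, replicate_mset 5 2 #} \<and>
    sphere_realizable 12 {# {#8, 2, 1, 1#}, replicate_mset 4 3, replicate_mset 6 2 #} \<and>
    sphere_realizable 12 {# {#9, 1, 1, 1#}, replicate_mset 4 3, replicate_mset 6 2 #} \<and>
    sphere_exceptional 16
      {# {#7, 7, 1, 1#}, replicate_mset 5 3 + {#1#}, replicate_mset 8 2 #} \<and>
    sphere_realizable 24
      {# {#7, 7, 7, 1, 1, 1#}, replicate_mset 8 3, replicate_mset 12 2 #}"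
proof (intro conjI)
  show "sphere_realizable 6 {# {#5, 1#}, {#4, 1, 1#}, replicate_mset 3 2 #}"
    using realizable_6 by (simp only: add_mset_commute)
  show "sphere_realizable 8 {# {#7, 1#}, {#3, 3, 1, 1#}, replicate_mset 4 2 #}"
    using realizable_8 by (simp only: add_mset_commute)
  show "sphere_realizable 9 {# {#7, 1, 1#}, {#3, 3, 3#}, replicate_mset 4 2 + {#1#} #}"
    using realizable_9 by (simp add: add_mset_commute eval_nat_numeral)
  show "sphere_realizable 10 {# {#8, 1, 1#}, {#3, 3, 3, 1#}, replicate_mset 5 2 #}"
    using realizable_10 by (simp only: add_mset_commute)
  show "sphere_realizable 12 {# {#8, 2, 1, 1#}, replicate_mset 4 3, replicate_mset 6 2 #}"
    using realizable_12 by (simp only: add_mset_commute)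
  show "sphere_realizable 12 {# {#9, 1, 1, 1#}, replicate_mset 4 3, replicate_mset 6 2 #}"
    using realizable_12' by (simp only: add_mset_commute)
  show "sphere_realizable 24
      {# {#7, 7, 7, 1, 1, 1#}, replicate_mset 8 3, replicate_mset 12 2 #}"
    using realizable_24 by (simp only: add_mset_commute)
  show "sphere_exceptional 8 {# {#5, 1, 1, 1#}, {#4, 4#}, replicate_mset 4 2 #}"
    unfolding sphere_exceptional_def
  proof
    show "sphere_candidate 8 {# {#5, 1, 1, 1#}, {#4, 4#}, replicate_mset 4 2 #}"
      by (simp add: sphere_candidate_def riemann_hurwitz_def is_partition_def in_replicate_mset)
    show "\<not> (\<exists>f. realizes S2 S2 8 {# {#5, 1, 1, 1#}, {#4, 4#}, replicate_mset 4 2 #} f)"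
    proof
      assume "\<exists>f. realizes S2 S2 8 {# {#5, 1, 1, 1#}, {#4, 4#}, replicate_mset 4 2 #} f"
      then obtain f where "realizes S2 S2 8 {# {#5, 1, 1, 1#}, {#4, 4#}, replicate_mset 4 2 #} f" ..
      \<comment> \<open>The order decides the roles: the involution comes first and the type of the
        product last, as \<open>no_4_4\<close> expects.\<close>
      then have f: "realizes S2 S2 8 {# replicate_mset 4 2, {#4, 4#}, {#5, 1, 1, 1#} #} f"
        by (simp only: add_mset_commute)
      obtain P and \<sigma> \<tau> :: "real^3 \<Rightarrow> real^3" where "transitive_pair P \<sigma> \<tau>" "card P = 8"
        "has_cycle_type P \<sigma> (replicate_mset 4 2)" "has_cycle_type P \<tau> {#4, 4#}"
        "has_cycle_type P (\<tau> \<circ> \<sigma>) {#5, 1, 1, 1#}"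
        by (rule monodromy_of_realization[OF f]) (simp_all add: is_partition_def in_replicate_mset)
      then show False using transitive_pair.no_4_4 by blast
    qed
  qed
  show "sphere_exceptional 16
      {# {#7, 7, 1, 1#}, replicate_mset 5 3 + {#1#}, replicate_mset 8 2 #}"
    unfolding sphere_exceptional_def
  proof
    show "sphere_candidate 16 {# {#7, 7, 1, 1#}, replicate_mset 5 3 + {#1#}, replicate_mset 8 2 #}"
      by (simp add: sphere_candidate_def riemann_hurwitz_def is_partition_def in_replicate_mset)
    show "\<not> (\<exists>f. realizes S2 S2 16
        {# {#7, 7, 1, 1#}, replicate_mset 5 3 + {#1#}, replicate_mset 8 2 #} f)"
    proof
      assume "\<exists>f. realizes S2 S2 16
        {# {#7, 7, 1, 1#}, replicate_mset 5 3 + {#1#}, replicate_mset 8 2 #} f"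
      then obtain f where
        "realizes S2 S2 16 {# {#7, 7, 1, 1#}, replicate_mset 5 3 + {#1#}, replicate_mset 8 2 #} f" ..
      then have f:
        "realizes S2 S2 16 {# replicate_mset 8 2, replicate_mset 5 3 + {#1#}, {#7, 7, 1, 1#} #} f"
        by (simp only: add_mset_commute)
      obtain P and \<sigma> \<tau> :: "real^3 \<Rightarrow> real^3" where "transitive_pair P \<sigma> \<tau>" "card P = 16"
        "has_cycle_type P \<sigma> (replicate_mset 8 2)"
        "has_cycle_type P \<tau> (replicate_mset 5 3 + {#1#})"
        "has_cycle_type P (\<tau> \<circ> \<sigma>) {#7, 7, 1, 1#}"
        by (rule monodromy_of_realization[OF f])
          (simp_all add: is_partition_def in_replicate_mset)
      then show False using transitive_pair.no_3_3_3_3_3_1 by blast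
    qed
  qed
qed

end
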